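(* Let $\mathbf{A}$ be a commutative ring, $E$ and $F$ finitely generated projective $\mathbf{A}$-modules, $\varphi:E\to F$ and $\varphi^\bullet:F\to E$ two $\mathbf{A}$-linear maps, and let $k\ge 0$ be an integer. Write $P_{\varphi\varphi^\bullet}(Z)=\det(\mathrm{Id}_F+Z\varphi\varphi^\bullet)=1+\sum_{\ell\ge1}a_\ell Z^\ell$ (and $a_0=1$). The following are equivalent: 1. $\varphi$ and $\varphi^\bullet$ are crossed and $\operatorname{Im}\varphi$ is a projective module of rank $k$. 2. $\varphi$ and $\varphi^\bullet$ are of rank $\le k$ and $a_k$ is invertible in $\mathbf{A}$. 3. $\deg P_{\varphi\varphi^\bullet}\le k$, $a_k$ is invertible in $\mathbf{A}$ and, setting $$\theta=a_{k-1}\varphi^\bullet-a_{k-2}\varphi^\bullet\varphi\varphi^\bullet+\cdots+(-1)^{k-1}\varphi^\bullet(\varphi\varphi^\bullet)^{k-1},$$ one has $\varphi\,\theta\,\varphi=a_k\varphi$ and $\varphi^\bullet\varphi\,\theta=a_k\varphi^\bullet$.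
   Context: Two linear maps $\varphi:E\to F$ and $\varphi^\bullet:F\to E$ are called crossed if $\operatorname{Im}\varphi\oplus\operatorname{Ker}\varphi^\bullet=F$ and $\operatorname{Ker}\varphi\oplus\operatorname{Im}\varphi^\bullet=E$. For an endomorphism $\psi$ of a finitely generated projective module $E$ with $E\oplus N\simeq\mathbf{A}^n$, $\det\psi:=\det(\psi\oplus\mathrm{Id}_N)$ (independent of choices); determinants involving $Z$ are computed after extending scalars to $\mathbf{A}[Z]$. For a linear map $\varphi:E\to F$ between finitely generated projective modules, the determinantal ideal $\mathcal{D}_j(\varphi)$ is the ideal of $\mathbf{A}$ generated by all $\det(\lambda\circ\varphi\circ\theta)$ with $\lambda:F\to\mathbf{A}^j$ and $\theta:\mathbf{A}^j\to E$ linear. The map $\varphi$ is said to be of rank $\le k$ if $\mathcal{D}_{k+1}(\varphi)=0$. "Projective of rank $k$" means finitely generated projective of constant rank $k$. An empty sum is $0$. *)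

theory Defs
  imports
    "Jordan_Normal_Form.Determinant"
    "HOL-Library.Product_Plus"
    "HOL-Library.FuncSet"
begin

section \<open>Linear maps between carriers, free modules\<close>

text \<open>The base ring is a type of class \<open>comm_ring_1\<close>.  A module is a type with a scalar
  multiplication satisfying \<open>Modules.module\<close>; its submodules, and the free modules
  \<open>carrier_vec n\<close> (with \<open>smult_vec\<close>), are given by a carrier set and a scalar multiplication.
  The qualifier \<open>Modules\<close> is needed because HOL-Algebra has a locale of the same name.\<close>

definition lin_map ::
  "('a \<Rightarrow> 'm::plus \<Rightarrow> 'm) \<Rightarrow> 'm set \<Rightarrow> ('a \<Rightarrow> 'n::plus \<Rightarrow> 'n) \<Rightarrow> 'n set \<Rightarrow> ('m \<Rightarrow> 'n) \<Rightarrow> bool" where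
  "lin_map s M t N f \<longleftrightarrow>
     f \<in> M \<rightarrow> N \<and>
     (\<forall>x\<in>M. \<forall>y\<in>M. f (x + y) = f x + f y) \<and>
     (\<forall>a. \<forall>x\<in>M. f (s a x) = t a (f x))"

definition submodule_vec :: "nat \<Rightarrow> 'a::comm_ring_1 vec set \<Rightarrow> bool" where
  "submodule_vec n N \<longleftrightarrow>
     N \<subseteq> carrier_vec n \<and> 0\<^sub>v n \<in> N \<and>
     (\<forall>x\<in>N. \<forall>y\<in>N. x + y \<in> N) \<and> (\<forall>a. \<forall>x\<in>N. a \<cdot>\<^sub>v x \<in> N)"

definition endo_mat :: "nat \<Rightarrow> ('a::comm_ring_1 vec \<Rightarrow> 'a vec) \<Rightarrow> 'a mat" where
  "endo_mat n f = mat n n (\<lambda>(i, j). f (unit_vec n j) $ i)"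

section \<open>Finitely generated projective modules and determinants of their endomorphisms\<close>

text \<open>\<open>fgp_iso s M n N \<sigma>\<close> says that \<open>\<sigma>\<close> is an isomorphism from the direct sum of \<open>M\<close> and \<open>N\<close>
  onto the free module of rank \<open>n\<close>.  Taking \<open>N\<close> among the submodules of \<open>carrier_vec n\<close> loses
  nothing, since \<open>\<sigma>\<close> embeds every complement there.\<close>

definition fgp_iso ::
  "('a::comm_ring_1 \<Rightarrow> 'm::plus \<Rightarrow> 'm) \<Rightarrow> 'm set \<Rightarrow> nat \<Rightarrow> 'a vec set \<Rightarrow> ('m \<times> 'a vec \<Rightarrow> 'a vec) \<Rightarrow> bool" where
  "fgp_iso s M n N \<sigma> \<longleftrightarrow>
     submodule_vec n N \<and>
     lin_map (\<lambda>a (x, y). (s a x, a \<cdot>\<^sub>v y)) (M \<times> N) (\<cdot>\<^sub>v) (carrier_vec n) \<sigma> \<and>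
     bij_betw \<sigma> (M \<times> N) (carrier_vec n)"

definition fg_projective :: "('a::comm_ring_1 \<Rightarrow> 'm::plus \<Rightarrow> 'm) \<Rightarrow> 'm set \<Rightarrow> bool" where
  "fg_projective s M \<longleftrightarrow> (\<exists>n N \<sigma>. fgp_iso s M n N \<sigma>)"

text \<open>The determinant of \<open>\<psi> \<oplus> Id\<close>, transported to the free module along \<open>\<sigma>\<close>; the value does not
  depend on the complement \<open>N\<close> or on \<open>\<sigma>\<close>.\<close>

definition det_fgp ::
  "('a::comm_ring_1 \<Rightarrow> 'm::plus \<Rightarrow> 'm) \<Rightarrow> 'm set \<Rightarrow> ('m \<Rightarrow> 'm) \<Rightarrow> 'a" where
  "det_fgp s M \<psi> =
     (THE d. \<exists>n N \<sigma>. fgp_iso s M n N \<sigma> \<and>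
        d = det (endo_mat n (\<sigma> \<circ> map_prod \<psi> id \<circ> inv_into (M \<times> N) \<sigma>)))"

section \<open>Extension of scalars to the polynomial ring\<close>

text \<open>The module obtained from \<open>M\<close> by extending scalars from \<open>A\<close> to \<open>A[Z]\<close> is \<open>M[Z]\<close>, that is
  \<open>'m poly\<close> with the following scalar multiplication (see \<open>coeff_poly_scale\<close>).\<close>

definition poly_scale ::
  "('a::comm_ring_1 \<Rightarrow> 'm::ab_group_add \<Rightarrow> 'm) \<Rightarrow> 'a poly \<Rightarrow> 'm poly \<Rightarrow> 'm poly" where
  "poly_scale s p x =
     (\<Sum>i\<le>degree p + degree x. monom (\<Sum>j\<le>i. s (coeff p j) (coeff x (i - j))) i)"

lemma coeff_poly_scale:
  assumes "Modules.module s"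
  shows "coeff (poly_scale s p x) n = (\<Sum>j\<le>n. s (coeff p j) (coeff x (n - j)))"
proof (cases "n \<le> degree p + degree x")
  case True
  then show ?thesis
    by (simp add: poly_scale_def coeff_sum)
next
  case False
  interpret Modules.module s by fact
  have "s (coeff p j) (coeff x (n - j)) = 0" if "j \<le> n" for j
  proof (cases "j \<le> degree p")
    case True
    with False have "degree x < n - j" by linarith
    then show ?thesis by (simp add: coeff_eq_0)
  next
    case False
    then show ?thesis by (simp add: coeff_eq_0)
  qed
  with False show ?thesis
    by (simp add: poly_scale_def coeff_sum)
qed

definition id_plus_Z :: "('a::comm_ring_1 \<Rightarrow> 'm::ab_group_add \<Rightarrow> 'm) \<Rightarrow> ('m \<Rightarrow> 'm) \<Rightarrow> 'm poly \<Rightarrow> 'm poly" where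
  "id_plus_Z s \<psi> = (\<lambda>x. x + poly_scale s (monom 1 1) (map_poly \<psi> x))"

definition char_P ::
  "('a::comm_ring_1 \<Rightarrow> 'f::ab_group_add \<Rightarrow> 'f) \<Rightarrow> ('e \<Rightarrow> 'f) \<Rightarrow> ('f \<Rightarrow> 'e) \<Rightarrow> 'a poly" where
  "char_P sF \<phi> \<phi>' = det_fgp (poly_scale sF) UNIV (id_plus_Z sF (\<phi> \<circ> \<phi>'))"

section \<open>Determinantal ideals and crossed maps\<close>

text \<open>The ideals of the base ring are its submodules, so \<open>Modules.module.span (*)\<close> is the ideal
  generated by a set.\<close>

definition det_ideal ::
  "('a::comm_ring_1 \<Rightarrow> 'e::plus \<Rightarrow> 'e) \<Rightarrow> ('a \<Rightarrow> 'f::plus \<Rightarrow> 'f) \<Rightarrow> nat \<Rightarrow> ('e \<Rightarrow> 'f) \<Rightarrow> 'a set" where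
  "det_ideal sE sF j \<phi> =
     Modules.module.span (*) {det (endo_mat j (l \<circ> \<phi> \<circ> h)) | l h.
        lin_map sF UNIV (\<cdot>\<^sub>v) (carrier_vec j) l \<and>
        lin_map (\<cdot>\<^sub>v) (carrier_vec j) sE UNIV h}"

definition rank_le ::
  "('a::comm_ring_1 \<Rightarrow> 'e::plus \<Rightarrow> 'e) \<Rightarrow> ('a \<Rightarrow> 'f::plus \<Rightarrow> 'f) \<Rightarrow> nat \<Rightarrow> ('e \<Rightarrow> 'f) \<Rightarrow> bool" where
  "rank_le sE sF k \<phi> \<longleftrightarrow> det_ideal sE sF (k + 1) \<phi> = {0}"

definition ker :: "('m \<Rightarrow> 'n::zero) \<Rightarrow> 'm set" where
  "ker f = {x. f x = 0}"

definition direct_sum_is :: "'m::ab_group_add set \<Rightarrow> 'm set \<Rightarrow> 'm set \<Rightarrow> bool" where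
  "direct_sum_is U V W \<longleftrightarrow> {u + v | u v. u \<in> U \<and> v \<in> V} = W \<and> U \<inter> V = {0}"

definition crossed :: "('e::ab_group_add \<Rightarrow> 'f::ab_group_add) \<Rightarrow> ('f \<Rightarrow> 'e) \<Rightarrow> bool" where
  "crossed \<phi> \<phi>' \<longleftrightarrow>
     direct_sum_is (range \<phi>) (ker \<phi>') UNIV \<and> direct_sum_is (ker \<phi>) (range \<phi>') UNIV"

section \<open>Localization and constant rank\<close>

definition prime_ideal :: "'a::comm_ring_1 set \<Rightarrow> bool" where
  "prime_ideal p \<longleftrightarrow>
     Modules.module.subspace (*) p \<and> p \<noteq> UNIV \<and> (\<forall>a b. a * b \<in> p \<longrightarrow> a \<in> p \<or> b \<in> p)"

text \<open>For a prime ideal \<open>p\<close>, the elements of the localization of \<open>M\<close> at \<open>p\<close> are the classes of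
  fractions with numerator in \<open>M\<close> and denominator outside \<open>p\<close>.  The localization of the ring is the
  case \<open>s = (*)\<close>, \<open>M = UNIV\<close>.\<close>

definition frac_rel ::
  "('a::comm_ring_1 \<Rightarrow> 'm::ab_group_add \<Rightarrow> 'm) \<Rightarrow> 'm set \<Rightarrow> 'a set \<Rightarrow> (('m \<times> 'a) \<times> ('m \<times> 'a)) set" where
  "frac_rel s M p =
     {((x, u), (y, v)). x \<in> M \<and> y \<in> M \<and> u \<notin> p \<and> v \<notin> p \<and> (\<exists>w. w \<notin> p \<and> s w (s v x - s u y) = 0)}"

definition localization ::
  "('a::comm_ring_1 \<Rightarrow> 'm::ab_group_add \<Rightarrow> 'm) \<Rightarrow> 'm set \<Rightarrow> 'a set \<Rightarrow> ('m \<times> 'a) set set" where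
  "localization s M p = (M \<times> (- p)) // frac_rel s M p"

definition loc_add ::
  "('a::comm_ring_1 \<Rightarrow> 'm::ab_group_add \<Rightarrow> 'm) \<Rightarrow> 'm set \<Rightarrow> 'a set \<Rightarrow>
   ('m \<times> 'a) set \<Rightarrow> ('m \<times> 'a) set \<Rightarrow> ('m \<times> 'a) set" where
  "loc_add s M p X Y =
     (\<Union>(x, u)\<in>X. \<Union>(y, v)\<in>Y. frac_rel s M p `` {(s v x + s u y, u * v)})"

definition loc_scale ::
  "('a::comm_ring_1 \<Rightarrow> 'm::ab_group_add \<Rightarrow> 'm) \<Rightarrow> 'm set \<Rightarrow> 'a set \<Rightarrow>
   ('a \<times> 'a) set \<Rightarrow> ('m \<times> 'a) set \<Rightarrow> ('m \<times> 'a) set" where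
  "loc_scale s M p C X =
     (\<Union>(a, t)\<in>C. \<Union>(x, u)\<in>X. frac_rel s M p `` {(s a x, t * u)})"

lemma prime_ideal_compl:
  assumes "prime_ideal p"
  shows "1 \<notin> p" and "u \<notin> p \<Longrightarrow> v \<notin> p \<Longrightarrow> u * v \<notin> p"
proof -
  interpret R: Modules.module "(*) :: 'a \<Rightarrow> 'a \<Rightarrow> 'a"
    by unfold_locales (auto simp: algebra_simps)
  show "u \<notin> p \<Longrightarrow> v \<notin> p \<Longrightarrow> u * v \<notin> p"
    using assms unfolding prime_ideal_def by blast
  show "1 \<notin> p"
  proof
    assume "1 \<in> p"
    then have "x \<in> p" for x
      using assms R.subspace_scale[of p 1 x] unfolding prime_ideal_def by simp
    then show False
      using assms unfolding prime_ideal_def by blast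
  qed
qed

lemma equiv_frac_rel:
  assumes "Modules.module s" and "prime_ideal p"
  shows "equiv (M \<times> (- p)) (frac_rel s M p)"
proof -
  interpret Modules.module s by fact
  note p = prime_ideal_compl[OF assms(2)]
  have trans: "\<exists>w. w \<notin> p \<and> s w (s v x - s u z) = 0"
    if u: "u \<notin> p" "t \<notin> p" "v \<notin> p" "w1 \<notin> p" "w2 \<notin> p"
      and 1: "s w1 (s t x - s u y) = 0" and 2: "s w2 (s v y - s t z) = 0"
    for x y z u t v w1 w2
  proof (intro exI conjI)
    show "w1 * w2 * t \<notin> p" using u p(2) by blast
    have "s (w1 * w2 * t) (s v x - s u z) =
        s (w2 * v) (s w1 (s t x - s u y)) + s (w1 * u) (s w2 (s v y - s t z))"
      by (simp add: algebra_simps)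
    then show "s (w1 * w2 * t) (s v x - s u z) = 0"
      unfolding 1 2 by simp
  qed
  have sym: "s w (s u y - s v x) = 0" if "s w (s v x - s u y) = 0" for w u v x y
    using that by (simp add: scale_right_diff_distrib)
  show ?thesis
  proof (rule equivI)
    show "frac_rel s M p \<subseteq> (M \<times> (- p)) \<times> (M \<times> (- p))"
      by (auto simp: frac_rel_def)
    show "refl_on (M \<times> (- p)) (frac_rel s M p)"
      using p(1) by (auto simp: frac_rel_def refl_on_def)
    show "sym (frac_rel s M p)"
      using sym by (fastforce simp: frac_rel_def sym_def)
    show "trans (frac_rel s M p)"
      using trans unfolding frac_rel_def trans_def by blast
  qed
qed

lemma loc_add_frac:
  assumes "Modules.module s" and "Modules.module.subspace s M" and "prime_ideal p"
    and x: "x \<in> M" "u \<notin> p" and y: "y \<in> M" "v \<notin> p"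
  shows "loc_add s M p (frac_rel s M p `` {(x, u)}) (frac_rel s M p `` {(y, v)}) =
     frac_rel s M p `` {(s v x + s u y, u * v)}"
proof -
  interpret Modules.module s by fact
  note p = prime_ideal_compl[OF assms(3)]
  note eq = equiv_frac_rel[OF assms(1,3), of M]
  have "congruent2 (frac_rel s M p) (frac_rel s M p)
     (\<lambda>(x, u) (y, v). frac_rel s M p `` {(s v x + s u y, u * v)})"
  proof (rule congruent2I', clarsimp, rule equiv_class_eq[OF eq])
    fix x1 u1 x2 u2 y1 v1 y2 v2
    assume 1: "((x1, u1), (x2, u2)) \<in> frac_rel s M p" and 2: "((y1, v1), (y2, v2)) \<in> frac_rel s M p"
    from 1 obtain w1 where w1: "w1 \<notin> p" "s w1 (s u2 x1 - s u1 x2) = 0"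
      by (auto simp: frac_rel_def)
    from 2 obtain w2 where w2: "w2 \<notin> p" "s w2 (s v2 y1 - s v1 y2) = 0"
      by (auto simp: frac_rel_def)
    have "s (w1 * w2) (s (u2 * v2) (s v1 x1 + s u1 y1) - s (u1 * v1) (s v2 x2 + s u2 y2)) =
       s (w2 * v1 * v2) (s w1 (s u2 x1 - s u1 x2)) + s (w1 * u1 * u2) (s w2 (s v2 y1 - s v1 y2))"
      by (simp add: algebra_simps)
    then have "s (w1 * w2) (s (u2 * v2) (s v1 x1 + s u1 y1) - s (u1 * v1) (s v2 x2 + s u2 y2)) = 0"
      unfolding w1 w2 by simp
    then show "((s v1 x1 + s u1 y1, u1 * v1), (s v2 x2 + s u2 y2, u2 * v2)) \<in> frac_rel s M p"
      using 1 2 w1(1) w2(1) p(2) assms(2)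
      by (auto simp: frac_rel_def intro!: subspace_add subspace_scale)
  qed
  from UN_equiv_class2[OF eq eq this, of "(x, u)" "(y, v)"] x y show ?thesis
    by (simp add: loc_add_def case_prod_unfold)
qed

lemma loc_scale_frac:
  assumes "Modules.module s" and "Modules.module.subspace s M" and "prime_ideal p"
    and a: "t \<notin> p" and x: "x \<in> M" "u \<notin> p"
  shows "loc_scale s M p (frac_rel (*) UNIV p `` {(a, t)}) (frac_rel s M p `` {(x, u)}) =
     frac_rel s M p `` {(s a x, t * u)}"
proof -
  interpret Modules.module s by fact
  have R: "Modules.module ((*) :: 'a \<Rightarrow> 'a \<Rightarrow> 'a)"
    by unfold_locales (auto simp: algebra_simps)
  note p = prime_ideal_compl[OF assms(3)]
  note eqR = equiv_frac_rel[OF R assms(3), of UNIV]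
  note eq = equiv_frac_rel[OF assms(1,3), of M]
  have "congruent2 (frac_rel (*) UNIV p) (frac_rel s M p)
     (\<lambda>(a, t) (x, u). frac_rel s M p `` {(s a x, t * u)})"
  proof (rule congruent2I', clarsimp, rule equiv_class_eq[OF eq])
    fix a1 t1 a2 t2 y1 v1 y2 v2
    assume 1: "((a1, t1), (a2, t2)) \<in> frac_rel (*) UNIV p" and 2: "((y1, v1), (y2, v2)) \<in> frac_rel s M p"
    from 1 obtain w1 where w1: "w1 \<notin> p" "w1 * (t2 * a1 - t1 * a2) = 0"
      by (auto simp: frac_rel_def)
    from 2 obtain w2 where w2: "w2 \<notin> p" "s w2 (s v2 y1 - s v1 y2) = 0"
      by (auto simp: frac_rel_def)
    have "s (w1 * w2) (s (t2 * v2) (s a1 y1) - s (t1 * v1) (s a2 y2)) =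
       s (w1 * (t2 * a1 - t1 * a2)) (s (w2 * v2) y1) + s (w1 * t1 * a2) (s w2 (s v2 y1 - s v1 y2))"
      by (simp add: algebra_simps)
    then have "s (w1 * w2) (s (t2 * v2) (s a1 y1) - s (t1 * v1) (s a2 y2)) = 0"
      unfolding w1 w2 by simp
    then show "((s a1 y1, t1 * v1), (s a2 y2, t2 * v2)) \<in> frac_rel s M p"
      using 1 2 w1(1) w2(1) p(2) assms(2)
      by (auto simp: frac_rel_def intro!: subspace_scale)
  qed
  from UN_equiv_class2[OF eqR eq this, of "(a, t)" "(x, u)"] a x show ?thesis
    by (simp add: loc_scale_def case_prod_unfold)
qed

abbreviation "loc_ring p \<equiv> localization (*) UNIV p"
abbreviation "loc_ring_add p \<equiv> loc_add (*) UNIV p"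
abbreviation "loc_ring_mult p \<equiv> loc_scale (*) UNIV p"

text \<open>The localization of \<open>M\<close> at \<open>p\<close> is isomorphic, over the localized ring, to the module of
  \<open>k\<close>-tuples.\<close>

definition free_of_rank_at ::
  "('a::comm_ring_1 \<Rightarrow> 'm::ab_group_add \<Rightarrow> 'm) \<Rightarrow> 'm set \<Rightarrow> nat \<Rightarrow> 'a set \<Rightarrow> bool" where
  "free_of_rank_at s M k p \<longleftrightarrow>
     (\<exists>f. bij_betw f ({..<k} \<rightarrow>\<^sub>E loc_ring p) (localization s M p) \<and>
        (\<forall>c \<in> {..<k} \<rightarrow>\<^sub>E loc_ring p. \<forall>d \<in> {..<k} \<rightarrow>\<^sub>E loc_ring p.
           f (\<lambda>i\<in>{..<k}. loc_ring_add p (c i) (d i)) = loc_add s M p (f c) (f d)) \<and>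
        (\<forall>a \<in> loc_ring p. \<forall>c \<in> {..<k} \<rightarrow>\<^sub>E loc_ring p.
           f (\<lambda>i\<in>{..<k}. loc_ring_mult p a (c i)) = loc_scale s M p a (f c)))"

definition projective_of_rank ::
  "('a::comm_ring_1 \<Rightarrow> 'm::ab_group_add \<Rightarrow> 'm) \<Rightarrow> 'm set \<Rightarrow> nat \<Rightarrow> bool" where
  "projective_of_rank s M k \<longleftrightarrow>
     fg_projective s M \<and> (\<forall>p. prime_ideal p \<longrightarrow> free_of_rank_at s M k p)"

section \<open>The map of condition 3\<close>

definition theta_map ::
  "('a::comm_ring_1 \<Rightarrow> 'e::ab_group_add \<Rightarrow> 'e) \<Rightarrow> (nat \<Rightarrow> 'a) \<Rightarrow> nat \<Rightarrow> ('e \<Rightarrow> 'f) \<Rightarrow> ('f \<Rightarrow> 'e) \<Rightarrow> 'f \<Rightarrow> 'e" where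
  "theta_map sE a k \<phi> \<phi>' y =
     (\<Sum>i<k. sE ((-1) ^ i * a (k - 1 - i)) (\<phi>' (((\<phi> \<circ> \<phi>') ^^ i) y)))"

end

theory Submission
  imports Defs
begin

text \<open>
  Writing \<open>E\<close> and \<open>F\<close> as retracts of free modules turns \<open>\<phi>\<close> and \<open>\<phi>'\<close> into matrices \<open>B\<close> and \<open>C\<close>.
  Then \<open>P\<close> is \<open>det (1 + Z M)\<close> with \<open>M = B C\<close>; that this does not depend on the retract, and hence that
  \<open>det_fgp\<close> has a value at all, is the identity \<open>det (1 + X Y) = det (1 + Y X)\<close>.  The rank conditions
  become the vanishing of the minors of order \<open>k + 1\<close> of \<open>B\<close> and \<open>C\<close>.

  The link between conditions 2 and 3 is the adjugate of \<open>1 + Z M\<close>.  Its coefficients \<open>N j\<close> satisfy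
  \<open>N (j + 1) = a (j + 1) - M N j\<close>, so the two equations on \<open>\<theta>\<close> say exactly that \<open>N k B = 0\<close> and
  \<open>C N k = 0\<close>.
  \<^item> If the minors of \<open>B\<close> of order \<open>k + 1\<close> vanish, Cramer's rule writes an entry of
    \<open>adj (1 + Z M) B\<close> as a determinant whose expansion into principal minors only involves minors of
    \<open>B\<close> times a matrix, and the surviving ones contribute to degrees below \<open>k\<close>; thus \<open>N k B = 0\<close>
    (\<open>minors_vanish_imp_adj_coeff\<close>).
  \<^item> Conversely, if \<open>N k B = 0\<close> and \<open>deg P \<le> k\<close>, then \<open>Q = adj (1 + Z M) B\<close> has degree below \<open>k\<close>.
    By Jacobi's theorem its minors of order \<open>k + 1\<close> are divisible by \<open>P ^ k\<close>, which is impossible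
    for reasons of degree when \<open>a k\<close> is a unit, unless they vanish; and \<open>Q\<close> specializes to \<open>B\<close> at
    \<open>Z = 0\<close> (\<open>adj_coeff_imp_minors_vanish\<close>).

  For condition 1, conditions 2 and 3 make \<open>g = a k ^ -1 \<theta>\<close> a generalized inverse of \<open>\<phi>\<close>, which
  yields the direct sums and exhibits the image of \<open>\<phi>\<close> as a retract of \<open>F\<close>.  At a prime \<open>p\<close>, the unit
  \<open>a k\<close> is a sum of principal minors of order \<open>k\<close> of \<open>M\<close>, so one of them lies outside \<open>p\<close>, and bordering it
  shows that \<open>k\<close> columns of \<open>B C\<close> form a basis of the image after localization
  (\<open>local_basis_range\<close>).  In the other direction a basis of the localized image factors \<open>B\<close> and
  \<open>C\<close> through rank \<open>k\<close> up to a denominator outside \<open>p\<close>, which annihilates the minors of order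
  \<open>k + 1\<close>; and \<open>a k\<close> becomes, up to such a denominator, the determinant of \<open>\<phi> \<phi>'\<close> acting on the
  image, where it is bijective because the maps are crossed (\<open>cond1_imp_cond2\<close>).
\<close>

section \<open>Block-triangular determinants over a commutative ring\<close>

lemma det_block_diag_one_right:
  fixes A :: "'a :: comm_ring_1 mat"
  assumes A: "A \<in> carrier_mat n n"
  shows "det (four_block_mat A (0\<^sub>m n m) (0\<^sub>m m n) (1\<^sub>m m)) = det A"
proof (induction m)
  case 0
  have "four_block_mat A (0\<^sub>m n 0) (0\<^sub>m 0 n) (1\<^sub>m 0) = A"
    using A by (intro eq_matI) auto
  then show ?case by simp
next
  case (Suc m)
  let ?A = "four_block_mat A (0\<^sub>m n m) (0\<^sub>m m n) (1\<^sub>m m)"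
  have "four_block_mat A (0\<^sub>m n (Suc m)) (0\<^sub>m (Suc m) n) (1\<^sub>m (Suc m)) =
      four_block_mat ?A (0\<^sub>m (n + m) 1) (0\<^sub>m 1 (n + m)) (1\<^sub>m 1)"
    using A by (intro eq_matI) auto
  also have "det \<dots> = det ?A * det (1\<^sub>m 1 :: 'a mat)"
    using A by (intro det_four_block_mat_upper_right_zero_col[of _ "n + m"]) auto
  finally show ?case using Suc by simp
qed

lemma det_block_diag_one_left:
  fixes D :: "'a :: comm_ring_1 mat"
  assumes D: "D \<in> carrier_mat m m"
  shows "det (four_block_mat (1\<^sub>m n) (0\<^sub>m n m) (0\<^sub>m m n) D) = det D"
proof (induction n)
  case 0
  have "four_block_mat (1\<^sub>m 0) (0\<^sub>m 0 m) (0\<^sub>m m 0) D = D"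
    using D by (intro eq_matI) auto
  then show ?case by simp
next
  case (Suc n)
  let ?D = "four_block_mat (1\<^sub>m n) (0\<^sub>m n m) (0\<^sub>m m n) D"
  have "four_block_mat (1\<^sub>m (Suc n)) (0\<^sub>m (Suc n) m) (0\<^sub>m m (Suc n)) D =
      four_block_mat (1\<^sub>m 1) (0\<^sub>m 1 (n + m)) (0\<^sub>m (n + m) 1) ?D"
    using D by (intro eq_matI) auto
  also have "det \<dots> = det (1\<^sub>m 1 :: 'a mat) * det ?D"
    using D by (intro det_four_block_mat_lower_left_zero_col[where n="n + m"]) auto
  finally show ?case using Suc by simp
qed

text \<open>
  Eliminating rows would require cancellation, which is not available over a ring with zero divisors.
  Instead the matrix is factored into two block-diagonal matrices and a unipotent one.
\<close>
lemma det_block_upper_right_zero: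
  fixes A :: "'a :: comm_ring_1 mat"
  assumes A: "A \<in> carrier_mat n n" and C: "C \<in> carrier_mat m n" and D: "D \<in> carrier_mat m m"
  shows "det (four_block_mat A (0\<^sub>m n m) C D) = det A * det D"
proof -
  let ?A = "four_block_mat A (0\<^sub>m n m) (0\<^sub>m m n) (1\<^sub>m m)"
  let ?C = "four_block_mat (1\<^sub>m n) (0\<^sub>m n m) C (1\<^sub>m m)"
  let ?D = "four_block_mat (1\<^sub>m n) (0\<^sub>m n m) (0\<^sub>m m n) D"
  have car: "?A \<in> carrier_mat (n + m) (n + m)" "?C \<in> carrier_mat (n + m) (n + m)"
    "?D \<in> carrier_mat (n + m) (n + m)"
    using A D by auto
  have "det ?C = prod_list (diag_mat ?C)"
    using car(2) by (intro det_lower_triangular[where n="n + m"]) auto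
  also have "diag_mat ?C = map (\<lambda>_. 1) [0..<n + m]"
    unfolding diag_mat_def by (intro map_cong) auto
  finally have C1: "det ?C = 1" by (simp add: map_replicate_const)
  have "?C * ?D = four_block_mat (1\<^sub>m n) (0\<^sub>m n m) C D"
    using C D by (subst mult_four_block_mat[of _ n n _ m _ m _ _ n _ m]) auto
  then have "?A * (?C * ?D) = four_block_mat A (0\<^sub>m n m) C D"
    using A C D by (simp, subst mult_four_block_mat[of _ n n _ m _ m _ _ n _ m]) auto
  then have "det (four_block_mat A (0\<^sub>m n m) C D) = det ?A * (det ?C * det ?D)"
    using car by (metis det_mult mult_carrier_mat)
  then show ?thesis
    using C1 by (simp add: det_block_diag_one_right[OF A] det_block_diag_one_left[OF D])
qed

lemma det_block_lower_left_zero: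
  fixes A :: "'a :: comm_ring_1 mat"
  assumes A: "A \<in> carrier_mat n n" and B: "B \<in> carrier_mat n m" and D: "D \<in> carrier_mat m m"
  shows "det (four_block_mat A B (0\<^sub>m m n) D) = det A * det D"
proof -
  have "det (four_block_mat A B (0\<^sub>m m n) D) = det (four_block_mat A B (0\<^sub>m m n) D)\<^sup>T"
    using A D by (intro det_transpose[symmetric, of _ "n + m"]) auto
  also have "(four_block_mat A B (0\<^sub>m m n) D)\<^sup>T = four_block_mat A\<^sup>T (0\<^sub>m n m) B\<^sup>T D\<^sup>T"
    using A B D by (subst transpose_four_block_mat[of _ n n _ m _ m]) auto
  also have "det \<dots> = det A * det D"
    using A B D by (simp add: det_block_upper_right_zero det_transpose)
  finally show ?thesis .
qed

text \<open>
  Both sides are the determinant of the block matrix with rows \<open>(1, - X)\<close> and \<open>(Y, 1)\<close>,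
  cleared to block-triangular form from the left or from the right.
\<close>
lemma det_one_plus_mult_commute:
  fixes X :: "'a :: comm_ring_1 mat"
  assumes X: "X \<in> carrier_mat m n" and Y: "Y \<in> carrier_mat n m"
  shows "det (1\<^sub>m m + X * Y) = det (1\<^sub>m n + Y * X)"
proof -
  let ?K = "four_block_mat (1\<^sub>m m) (- X) Y (1\<^sub>m n)"
  let ?U = "four_block_mat (1\<^sub>m m) X (0\<^sub>m n m) (1\<^sub>m n)"
  have car: "?K \<in> carrier_mat (m + n) (m + n)" "?U \<in> carrier_mat (m + n) (m + n)"
    by auto
  have U: "det ?U = 1"
    using X by (simp add: det_block_lower_left_zero)
  have "?U * ?K = four_block_mat (1\<^sub>m m + X * Y) (0\<^sub>m m n) Y (1\<^sub>m n)"
    using X Y by (subst mult_four_block_mat[of _ m m _ n _ n _ _ m _ n]) auto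
  then have 1: "det ?U * det ?K = det (1\<^sub>m m + X * Y)"
    using X Y det_mult[OF car(2,1)] det_block_upper_right_zero[of "1\<^sub>m m + X * Y" m Y n "1\<^sub>m n"]
    by auto
  have "?K * ?U = four_block_mat (1\<^sub>m m) (0\<^sub>m m n) Y (1\<^sub>m n + Y * X)"
    using X Y by (subst mult_four_block_mat[of _ m m _ n _ n _ _ m _ n])
      (auto simp: comm_add_mat[of _ n n])
  then have 2: "det ?K * det ?U = det (1\<^sub>m n + Y * X)"
    using X Y det_mult[OF car] det_block_upper_right_zero[of "1\<^sub>m m" m Y n "1\<^sub>m n + Y * X"]
    by auto
  show ?thesis using 1 2 U by simp
qed

section \<open>Principal minors\<close>

definition principal_minor :: "'a::comm_ring_1 mat \<Rightarrow> nat set \<Rightarrow> 'a" where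
  "principal_minor M S = (\<Sum>p | p permutes S. signof p * (\<Prod>i\<in>S. M $$ (i, p i)))"

lemma principal_minor_full:
  assumes "M \<in> carrier_mat n n"
  shows "principal_minor M {0..<n} = det M"
  using det_def'[OF assms] by (simp add: principal_minor_def)

lemma principal_minor_smult:
  assumes M: "M \<in> carrier_mat n n" and S: "S \<subseteq> {0..<n}"
  shows "principal_minor (c \<cdot>\<^sub>m M) S = c ^ card S * principal_minor M S"
proof -
  have "(\<Prod>i\<in>S. (c \<cdot>\<^sub>m M) $$ (i, p i)) = c ^ card S * (\<Prod>i\<in>S. M $$ (i, p i))"
    if "p permutes S" for p
  proof -
    have "(\<Prod>i\<in>S. (c \<cdot>\<^sub>m M) $$ (i, p i)) = (\<Prod>i\<in>S. c * M $$ (i, p i))"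
      using M S permutes_in_image[OF that] by (intro prod.cong refl) (auto simp: subset_iff)
    then show ?thesis by (simp add: prod.distrib)
  qed
  then show ?thesis
    by (auto simp: principal_minor_def sum_distrib_left mult_ac intro!: sum.cong)
qed

lemma (in comm_ring_hom) principal_minor_hom:
  assumes M: "M \<in> carrier_mat n n" and S: "S \<subseteq> {0..<n}"
  shows "principal_minor (map_mat hom M) S = hom (principal_minor M S)"
proof -
  have "(\<Prod>i\<in>S. map_mat hom M $$ (i, p i)) = hom (\<Prod>i\<in>S. M $$ (i, p i))" if "p permutes S" for p
    unfolding hom_prod
    using M S permutes_in_image[OF that] by (intro prod.cong refl) (auto simp: subset_iff)
  then show ?thesis
    by (auto simp: principal_minor_def hom_distribs intro!: sum.cong)
qed

text \<open>
  Independent weights \<open>z\<close> on the columns and \<open>d\<close> on the diagonal let one expansion serve both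
  \<open>det (1 + Z M)\<close> and the matrices in which Cramer's rule has replaced a column.
\<close>
lemma det_diag_plus_scaled_cols:
  fixes M :: "'a :: comm_ring_1 mat"
  shows "det (mat n n (\<lambda>(i, j). (if i = j then d i else 0) + M $$ (i, j) * z j)) =
    (\<Sum>S\<in>Pow {0..<n}. (\<Prod>i\<in>S. z i) * (\<Prod>i\<in>{0..<n} - S. d i) * principal_minor M S)"
proof -
  let ?N = "{0..<n}"
  let ?e = "\<lambda>p i. if i = p i then d i else 0"
  let ?t = "\<lambda>S p. signof p * ((\<Prod>i\<in>S. M $$ (i, p i) * z (p i)) * (\<Prod>i\<in>?N - S. ?e p i))"
  have "det (mat n n (\<lambda>(i, j). (if i = j then d i else 0) + M $$ (i, j) * z j)) =
      (\<Sum>p | p permutes ?N. signof p * (\<Prod>i\<in>?N. M $$ (i, p i) * z (p i) + ?e p i))"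
    by (subst det_def'[of _ n]) (auto intro!: sum.cong prod.cong arg_cong2[where f = "(*)"] simp: add.commute)
  also have "\<dots> = (\<Sum>p | p permutes ?N. \<Sum>S\<in>Pow ?N. ?t S p)"
    by (subst prod_add) (auto simp: sum_distrib_left)
  also have "\<dots> = (\<Sum>S\<in>Pow ?N. \<Sum>p | p permutes ?N. ?t S p)"
    by (rule sum.swap)
  also have "\<dots> = (\<Sum>S\<in>Pow ?N. (\<Prod>i\<in>S. z i) * (\<Prod>i\<in>?N - S. d i) * principal_minor M S)"
  proof (intro sum.cong refl)
    fix S assume "S \<in> Pow ?N"
    then have S: "S \<subseteq> ?N" by simp
    \<comment> \<open>Only the permutations fixing the complement of \<open>S\<close> pointwise survive.\<close>
    have "(\<Sum>p | p permutes ?N. ?t S p) = (\<Sum>p | p permutes S. ?t S p)"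
    proof (intro sum.mono_neutral_right ballI)
      show "{p. p permutes S} \<subseteq> {p. p permutes ?N}"
        using S permutes_subset by blast
      fix p assume p: "p \<in> {p. p permutes ?N} - {p. p permutes S}"
      then obtain i where "i \<in> ?N - S" "p i \<noteq> i"
        using permutes_superset[of p ?N S] by blast
      then have "(\<Prod>i\<in>?N - S. ?e p i) = 0"
        by (intro prod_zero) force+
      then show "?t S p = 0" by simp
    qed (simp add: finite_permutations)
    also have "\<dots> = (\<Sum>p | p permutes S. (\<Prod>i\<in>S. z i) * (\<Prod>i\<in>?N - S. d i) *
        (signof p * (\<Prod>i\<in>S. M $$ (i, p i))))"
    proof (intro sum.cong refl)
      fix p assume "p \<in> {p. p permutes S}"
      then have p: "p permutes S" by simp
      have "(\<Prod>i\<in>S. z (p i)) = (\<Prod>i\<in>S. z i)"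
        using prod.permute[OF p, of z] by (simp add: o_def)
      moreover have "(\<Prod>i\<in>?N - S. ?e p i) = (\<Prod>i\<in>?N - S. d i)"
        using permutes_not_in[OF p] by (intro prod.cong) auto
      ultimately show "?t S p = (\<Prod>i\<in>S. z i) * (\<Prod>i\<in>?N - S. d i) *
          (signof p * (\<Prod>i\<in>S. M $$ (i, p i)))"
        by (simp add: prod.distrib mult_ac)
    qed
    finally show "(\<Sum>p | p permutes ?N. ?t S p) =
        (\<Prod>i\<in>S. z i) * (\<Prod>i\<in>?N - S. d i) * principal_minor M S"
      by (simp add: principal_minor_def sum_distrib_left)
  qed
  finally show ?thesis .
qed

text \<open>
  Selecting rows and columns by matrix products brings a principal minor into the shape
  \<open>det (L * M * H)\<close> in which determinantal ideals are defined.
\<close>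
lemma principal_minor_eq_det_mult:
  assumes S: "S \<subseteq> {0..<n}"
  obtains L H where "L \<in> carrier_mat (card S) n" and "H \<in> carrier_mat n (card S)"
    and "\<And>M :: 'a::comm_ring_1 mat. M \<in> carrier_mat n n \<Longrightarrow> principal_minor M S = det (L * M * H)"
proof -
  let ?s = "card S"
  have fin: "finite S" using S finite_subset by blast
  obtain f where f: "bij_betw f {0..<?s} S"
    using ex_bij_betw_nat_finite[OF fin] by blast
  then have inj: "inj_on f {0..<?s}" and fS: "f ` {0..<?s} = S"
    by (auto simp: bij_betw_def)
  have fn: "f i < n" if "i < ?s" for i
    using S fS that by force
  define L :: "'a mat" where "L = mat ?s n (\<lambda>(i, j). if j = f i then 1 else 0)"
  define H :: "'a mat" where "H = mat n ?s (\<lambda>(i, j). if i = f j then 1 else 0)"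
  have L: "L \<in> carrier_mat ?s n" and H: "H \<in> carrier_mat n ?s"
    by (auto simp: L_def H_def)
  have "principal_minor M S = det (L * M * H)" if M: "M \<in> carrier_mat n n" for M :: "'a mat"
  proof -
    have LM: "(L * M) $$ (i, j) = M $$ (f i, j)" if "i < ?s" "j < n" for i j
      using that M fn
        by (simp add: L_def scalar_prod_def if_distrib[of "\<lambda>x. x * _"] sum.delta cong: if_cong)
    have LMH: "(L * M * H) $$ (i, j) = M $$ (f i, f j)" if "i < ?s" "j < ?s" for i j
    proof -
      have "(L * M * H) $$ (i, j) = (\<Sum>l = 0..<n. (L * M) $$ (i, l) * H $$ (l, j))"
        using that L M H by (simp add: scalar_prod_def del: assoc_mult_mat)
      also have "\<dots> = (\<Sum>l = 0..<n. if l = f j then M $$ (f i, f j) else 0)"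
        using that by (intro sum.cong) (auto simp: LM H_def simp del: index_mult_mat)
      finally show ?thesis using fn[OF that(2)] by simp
    qed
    have "L * M * H \<in> carrier_mat ?s ?s"
      using L M H by simp
    then have "det (L * M * H) = (\<Sum>p | p permutes {0..<?s}. signof p * (\<Prod>i\<in>{0..<?s}. M $$ (f i, f (p i))))"
      by (subst det_def'[of _ ?s])
        (auto intro!: sum.cong prod.cong arg_cong2[where f = "(*)"] simp: LMH permutes_in_image simp del: index_mult_mat assoc_mult_mat)
    also have "\<dots> = principal_minor M S"
      unfolding principal_minor_def
    proof (rule sum.reindex_bij_witness[where j = "map_permutation {0..<?s} f"
          and i = "map_permutation S (inv_into {0..<?s} f)"])
      have inv: "bij_betw (inv_into {0..<?s} f) S {0..<?s}"
        using f by (rule bij_betw_inv_into)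
      fix p assume "p \<in> {p. p permutes {0..<?s}}"
      then have p: "p permutes {0..<?s}" by simp
      have ap: "map_permutation {0..<?s} f p (f i) = f (p i)" if "i < ?s" for i
        using that inj by (auto simp: map_permutation_def restrict_id_def)
      show "map_permutation {0..<?s} f p \<in> {p. p permutes S}"
        using map_permutation_permutes[OF f p] by simp
      show "map_permutation S (inv_into {0..<?s} f) (map_permutation {0..<?s} f p) = p"
      proof -
        have "map_permutation S (inv_into {0..<?s} f) (map_permutation {0..<?s} f p) =
            map_permutation {0..<?s} (inv_into {0..<?s} f \<circ> f) p"
          by (rule map_permutation_compose[OF f]) (use inv in \<open>auto simp: bij_betw_def\<close>)
        also have "\<dots> = map_permutation {0..<?s} id p"
          by (rule map_permutation_cong) (use p inj in \<open>auto simp: inj_on_def\<close>)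
        finally show ?thesis using p by simp
      qed
      show "signof (map_permutation {0..<?s} f p) * (\<Prod>i\<in>S. M $$ (i, map_permutation {0..<?s} f p i)) =
         signof p * (\<Prod>i\<in>{0..<?s}. M $$ (f i, f (p i)))"
        using p inj by (subst fS[symmetric]) (simp add: prod.reindex ap sign_map_permutation)
    next
      fix q assume "q \<in> {p. p permutes S}"
      then have q: "q permutes S" by simp
      have inv: "bij_betw (inv_into {0..<?s} f) S {0..<?s}"
        using f by (rule bij_betw_inv_into)
      show "map_permutation S (inv_into {0..<?s} f) q \<in> {p. p permutes {0..<?s}}"
        using map_permutation_permutes[OF inv q] by simp
      have "map_permutation {0..<?s} f (map_permutation S (inv_into {0..<?s} f) q) =
          map_permutation S (f \<circ> inv_into {0..<?s} f) q"
        by (rule map_permutation_compose[OF inv]) (use inj q in \<open>auto simp: inv\<close>)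
      also have "\<dots> = map_permutation S id q"
        by (rule map_permutation_cong) (use q f in \<open>auto simp: bij_betw_inv_into_right inj_on_def\<close>)
      finally show "map_permutation {0..<?s} f (map_permutation S (inv_into {0..<?s} f) q) = q"
        using q by simp
    qed
    finally show ?thesis by simp
  qed
  then show ?thesis using L H that by blast
qed

section \<open>The polynomial det (1 + Z M) and the adjugate of 1 + Z M\<close>

definition const_mat :: "'a::comm_ring_1 mat \<Rightarrow> 'a poly mat" where
  "const_mat M = map_mat (\<lambda>a. [:a:]) M"

lemma const_poly_hom: "comm_ring_hom (\<lambda>a :: 'a :: comm_ring_1. [:a:])"
  by unfold_locales (auto simp: one_pCons)

lemma coeff_0_hom: "comm_ring_hom (\<lambda>p :: 'a :: comm_ring_1 poly. coeff p 0)"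
  by unfold_locales (auto simp: coeff_mult)

lemma const_mat_carrier [simp]: "const_mat M \<in> carrier_mat m n \<longleftrightarrow> M \<in> carrier_mat m n"
  by (simp add: const_mat_def)

lemma const_mat_index [simp]:
  "i < dim_row M \<Longrightarrow> j < dim_col M \<Longrightarrow> const_mat M $$ (i, j) = [:M $$ (i, j):]"
  "dim_row (const_mat M) = dim_row M" "dim_col (const_mat M) = dim_col M"
  by (simp_all add: const_mat_def)

definition one_plus_Z :: "'a::comm_ring_1 mat \<Rightarrow> 'a poly mat" where
  "one_plus_Z M = 1\<^sub>m (dim_row M) + monom 1 1 \<cdot>\<^sub>m const_mat M"

text \<open>
  The reversed characteristic polynomial of \<open>- M\<close>, also known as the Fredholm determinant.
\<close>
definition fredholm :: "'a::comm_ring_1 mat \<Rightarrow> 'a poly" where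
  "fredholm M = det (one_plus_Z M)"

lemma one_plus_Z_carrier: "M \<in> carrier_mat n n \<Longrightarrow> one_plus_Z M \<in> carrier_mat n n"
  by (simp add: one_plus_Z_def)

lemma coeff_fredholm:
  assumes M: "M \<in> carrier_mat n n"
  shows "coeff (fredholm M) l = (\<Sum>S | S \<subseteq> {0..<n} \<and> card S = l. principal_minor M S)"
proof -
  interpret c: comm_ring_hom "\<lambda>a :: 'a. [:a:]" by (rule const_poly_hom)
  have "one_plus_Z M = mat n n (\<lambda>(i, j). (if i = j then 1 else 0) + const_mat M $$ (i, j) * monom 1 1)"
    using M by (intro eq_matI) (auto simp: one_plus_Z_def mult.commute)
  then have "fredholm M = (\<Sum>S\<in>Pow {0..<n}. monom 1 1 ^ card S * principal_minor (const_mat M) S)"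
    by (simp add: fredholm_def det_diag_plus_scaled_cols)
  also have "\<dots> = (\<Sum>S\<in>Pow {0..<n}. monom (principal_minor M S) (card S))"
    using M by (intro sum.cong)
      (auto simp: const_mat_def c.principal_minor_hom[of _ n] monom_power smult_monom)
  finally have "coeff (fredholm M) l =
      (\<Sum>S\<in>Pow {0..<n}. if card S = l then principal_minor M S else 0)"
    by (simp add: coeff_sum)
  also have "\<dots> = (\<Sum>S | S \<subseteq> {0..<n} \<and> card S = l. principal_minor M S)"
    by (subst sum.inter_filter[symmetric]) (auto intro!: sum.cong)
  finally show ?thesis .
qed

lemma coeff_0_fredholm:
  assumes M: "M \<in> carrier_mat n n"
  shows "coeff (fredholm M) 0 = 1"
proof -
  have "{S. S \<subseteq> {0..<n} \<and> card S = 0} = {{}}"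
    using finite_subset[of _ "{0..<n}"] by (auto simp: card_eq_0_iff)
  then show ?thesis
    by (simp add: coeff_fredholm[OF M] principal_minor_def)
qed

lemma coeff_fredholm_full:
  assumes M: "M \<in> carrier_mat n n"
  shows "coeff (fredholm M) n = det M"
proof -
  have "{S. S \<subseteq> {0..<n} \<and> card S = n} = {{0..<n}}"
    using card_subset_eq[of "{0..<n}"] by auto
  then show ?thesis
    by (simp add: coeff_fredholm[OF M] principal_minor_full[OF M])
qed

lemma coeff_fredholm_smult:
  assumes M: "M \<in> carrier_mat n n"
  shows "coeff (fredholm (c \<cdot>\<^sub>m M)) l = c ^ l * coeff (fredholm M) l"
  using M by (simp add: coeff_fredholm[of _ n] sum_distrib_left principal_minor_smult)

lemma const_mat_mult:
  assumes "X \<in> carrier_mat m n" "Y \<in> carrier_mat n r"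
  shows "const_mat (X * Y) = const_mat X * const_mat Y"
proof -
  interpret c: comm_ring_hom "\<lambda>a :: 'a. [:a:]" by (rule const_poly_hom)
  show ?thesis using c.mat_hom_mult[OF assms] by (simp add: const_mat_def)
qed

lemma fredholm_mult_commute:
  assumes X: "X \<in> carrier_mat m n" and Y: "Y \<in> carrier_mat n m"
  shows "fredholm (X * Y) = fredholm (Y * X)"
proof -
  let ?Z = "monom 1 1 :: 'a poly"
  have "fredholm (X * Y) = det (1\<^sub>m m + (?Z \<cdot>\<^sub>m const_mat X) * const_mat Y)"
    using X Y
      by (simp add: fredholm_def one_plus_Z_def const_mat_mult mult_smult_assoc_mat[of _ m n _ m])
  also have "\<dots> = det (1\<^sub>m n + const_mat Y * (?Z \<cdot>\<^sub>m const_mat X))"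
    using X Y by (intro det_one_plus_mult_commute) auto
  also have "const_mat Y * (?Z \<cdot>\<^sub>m const_mat X) = ?Z \<cdot>\<^sub>m const_mat (Y * X)"
    using X Y by (simp add: const_mat_mult mult_smult_distrib[of _ n m _ n])
  finally show ?thesis using X Y by (simp add: fredholm_def one_plus_Z_def)
qed

lemma fredholm_transpose:
  assumes M: "M \<in> carrier_mat n n"
  shows "fredholm M\<^sup>T = fredholm M"
proof -
  have "one_plus_Z M\<^sup>T = (one_plus_Z M)\<^sup>T"
    using M by (intro eq_matI) (auto simp: one_plus_Z_def)
  then show ?thesis
    using det_transpose[OF one_plus_Z_carrier[OF M]] by (simp add: fredholm_def)
qed

text \<open>
  The coefficients of the adjugate of \<open>1 + Z M\<close>, given by the recurrence that results from
  comparing coefficients in \<open>(1 + Z M) adj (1 + Z M) = det (1 + Z M)\<close>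
  (see \<open>coeff_adj_one_plus_Z\<close>).
\<close>
primrec adj_coeff :: "'a::comm_ring_1 mat \<Rightarrow> nat \<Rightarrow> 'a mat" where
  "adj_coeff M 0 = 1\<^sub>m (dim_row M)"
| "adj_coeff M (Suc j) = coeff (fredholm M) (Suc j) \<cdot>\<^sub>m 1\<^sub>m (dim_row M) - M * adj_coeff M j"

lemma adj_coeff_carrier: "M \<in> carrier_mat n n \<Longrightarrow> adj_coeff M j \<in> carrier_mat n n"
  by (induction j) auto

lemma coeff_adj_one_plus_Z:
  assumes M: "M \<in> carrier_mat n n" and ij: "i < n" "j < n"
  shows "coeff (adj_mat (one_plus_Z M) $$ (i, j)) l = adj_coeff M l $$ (i, j)"
proof -
  let ?R = "adj_mat (one_plus_Z M)"
  note R = adj_mat(1)[OF one_plus_Z_carrier[OF M]]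
  have "one_plus_Z M * ?R = ?R + monom 1 1 \<cdot>\<^sub>m (const_mat M * ?R)"
    using M R
      by (simp add: one_plus_Z_def add_mult_distrib_mat[of _ n n] mult_smult_assoc_mat[of _ n n _ n])
  then have eq: "?R + monom 1 1 \<cdot>\<^sub>m (const_mat M * ?R) = fredholm M \<cdot>\<^sub>m 1\<^sub>m n"
    using adj_mat(2)[OF one_plus_Z_carrier[OF M]] by (simp add: fredholm_def)
  have entry: "?R $$ (i, j) + monom 1 1 * (\<Sum>t = 0..<n. [:M $$ (i, t):] * ?R $$ (t, j)) =
      (if i = j then fredholm M else 0)" if "i < n" "j < n" for i j
    using arg_cong[OF eq, of "\<lambda>X. X $$ (i, j)"] that M R
    by (simp add: scalar_prod_def)
  have coeff_R: "coeff (?R $$ (i, j)) l + (case l of 0 \<Rightarrow> 0 |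
      Suc l' \<Rightarrow> \<Sum>t = 0..<n. M $$ (i, t) * coeff (?R $$ (t, j)) l') =
      (if i = j then coeff (fredholm M) l else 0)" if "i < n" "j < n" for i j l
    using arg_cong[OF entry[OF that], of "\<lambda>p. coeff p l"]
    by (cases l) (simp_all add: coeff_monom_mult coeff_sum split: if_splits)
  show ?thesis using ij
  proof (induction l arbitrary: i j)
    case 0
    then show ?case using coeff_R[of i j 0] M by (simp add: coeff_0_fredholm[OF M])
  next
    case (Suc l)
    then show ?case
      using coeff_R[of i j "Suc l"] M adj_coeff_carrier[OF M, of l]
      by (simp add: scalar_prod_def algebra_simps)
  qed
qed

lemma adj_coeff_commute:
  assumes M: "M \<in> carrier_mat n n"
  shows "M * adj_coeff M j = adj_coeff M j * M"
proof (induction j)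
  case 0
  then show ?case using M by simp
next
  case (Suc j)
  note N = adj_coeff_carrier[OF M, of j]
  have MM: "M * (M * adj_coeff M j) = M * (adj_coeff M j * M)"
    by (simp only: Suc)
  have "M * adj_coeff M (Suc j) = coeff (fredholm M) (Suc j) \<cdot>\<^sub>m M - M * (M * adj_coeff M j)"
    using M N by (simp add: mult_minus_distrib_mat[of _ n n _ n] mult_smult_distrib[of _ n n _ n])
  also have "\<dots> = adj_coeff M (Suc j) * M"
    using M N
      by (simp add: MM minus_mult_distrib_mat[of _ n n _ _ n] mult_smult_assoc_mat[of _ n n _ n])
  finally show ?case .
qed

lemma adj_coeff_transpose:
  assumes M: "M \<in> carrier_mat n n"
  shows "adj_coeff M\<^sup>T j = (adj_coeff M j)\<^sup>T"
proof (induction j)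
  case 0
  then show ?case using M by simp
next
  case (Suc j)
  note N = adj_coeff_carrier[OF M, of j]
  have "M\<^sup>T * (adj_coeff M j)\<^sup>T = (M * adj_coeff M j)\<^sup>T"
    using M N by (simp add: adj_coeff_commute[OF M] transpose_mult[of _ n n _ n])
  then show ?case
    using Suc M N by (intro eq_matI) (auto simp: fredholm_transpose[OF M] simp del: index_mult_mat(1))
qed

section \<open>Matrices with vanishing minors\<close>

text \<open>
  The vanishing of the determinantal ideal of order \<open>k + 1\<close>, quantified over all \<open>L\<close> and \<open>H\<close> as in
  \<open>det_ideal\<close> rather than over submatrices.
\<close>
definition minors_vanish :: "nat \<Rightarrow> 'a::comm_ring_1 mat \<Rightarrow> bool" where
  "minors_vanish k B \<longleftrightarrow>
    (\<forall>L\<in>carrier_mat (k + 1) (dim_row B). \<forall>H\<in>carrier_mat (dim_col B) (k + 1). det (L * B * H) = 0)"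

lemma minors_vanish_mult:
  fixes B Y :: "'a :: comm_ring_1 mat"
  assumes "minors_vanish k B" and B: "B \<in> carrier_mat m n" and Y: "Y \<in> carrier_mat n r"
  shows "minors_vanish k (B * Y)"
  unfolding minors_vanish_def
proof (intro ballI)
  fix L H :: "'a mat" assume "L \<in> carrier_mat (k + 1) (dim_row (B * Y))" and "H \<in> carrier_mat (dim_col (B * Y)) (k + 1)"
  then have L: "L \<in> carrier_mat (k + 1) m" and H: "H \<in> carrier_mat r (k + 1)"
    using B Y by auto
  have "L * (B * Y) = L * B * Y"
    using assoc_mult_mat[OF L B Y] by simp
  moreover have "L * B * Y * H = L * B * (Y * H)"
    by (rule assoc_mult_mat[OF mult_carrier_mat[OF L B] Y H])
  moreover have "Y * H \<in> carrier_mat n (k + 1)"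
    using Y H by simp
  ultimately show "det (L * (B * Y) * H) = 0"
    using assms(1) L B unfolding minors_vanish_def by (metis carrier_matD)
qed

text \<open>
  Laplace expansion along a row: the cofactors are again of the form \<open>det (L' * B * H')\<close>.
\<close>
lemma minors_vanish_larger:
  assumes "minors_vanish k B" and B: "B \<in> carrier_mat m n" and "k < j"
    and "L \<in> carrier_mat j m" and "H \<in> carrier_mat n j"
  shows "det (L * B * H) = 0"
  using assms(3-5)
proof (induction j arbitrary: L H)
  case 0
  then show ?case by simp
next
  case (Suc j)
  note L = Suc.prems(2) and H = Suc.prems(3)
  show ?case
  proof (cases "k < j")
    case False
    then have "Suc j = k + 1" using Suc.prems(1) by simp
    then show ?thesis using assms(1) L H B unfolding minors_vanish_def by (metis carrier_matD)
  next
    case True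
    have LBH: "L * B * H \<in> carrier_mat (Suc j) (Suc j)" using L B H by simp
    have "cofactor (L * B * H) 0 c = 0" if c: "c < Suc j" for c
    proof -
      define L' where "L' = mat j m (\<lambda>(a, b). L $$ (Suc a, b))"
      define H' where "H' = mat n j (\<lambda>(a, b). H $$ (a, if b < c then b else Suc b))"
      have L': "L' \<in> carrier_mat j m" and H': "H' \<in> carrier_mat n j"
        by (auto simp: L'_def H'_def)
      have LB: "(L' * B) $$ (a, b) = (L * B) $$ (Suc a, b)" if "a < j" "b < n" for a b
        using that L B by (simp add: L'_def scalar_prod_def)
      have "mat_delete (L * B * H) 0 c = L' * B * H'"
      proof (rule eq_matI)
        fix a b assume "a < dim_row (L' * B * H')" "b < dim_col (L' * B * H')"
        then have ab: "a < j" "b < j" using L' H' by auto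
        define b' where "b' = (if b < c then b else Suc b)"
        have b': "b' < Suc j" using ab by (auto simp: b'_def)
        have "mat_delete (L * B * H) 0 c $$ (a, b) = (L * B * H) $$ (Suc a, b')"
          using ab L B H by (simp add: mat_delete_def b'_def del: assoc_mult_mat)
        also have "\<dots> = (\<Sum>t = 0..<n. (L * B) $$ (Suc a, t) * H $$ (t, b'))"
          using ab b' L B H by (simp add: scalar_prod_def del: assoc_mult_mat)
        also have "\<dots> = (\<Sum>t = 0..<n. (L' * B) $$ (a, t) * H' $$ (t, b))"
          using ab by (intro sum.cong) (auto simp: LB H'_def b'_def simp del: index_mult_mat)
        also have "\<dots> = (L' * B * H') $$ (a, b)"
          using ab L' B H' by (simp add: scalar_prod_def del: assoc_mult_mat)
        finally show "mat_delete (L * B * H) 0 c $$ (a, b) = (L' * B * H') $$ (a, b)" .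
      qed (use L B H L' H' in auto)
      then show ?thesis
        using Suc.IH[OF True L' H'] by (simp add: cofactor_def)
    qed
    then show ?thesis
      by (subst laplace_expansion_row[OF LBH, of 0]) auto
  qed
qed

lemma principal_minor_eq_0:
  assumes "minors_vanish k M" and M: "M \<in> carrier_mat n n" and "S \<subseteq> {0..<n}" and "k < card S"
  shows "principal_minor M S = 0"
  using principal_minor_eq_det_mult[OF assms(3)] minors_vanish_larger[OF assms(1) M assms(4)] M
  by metis

lemma degree_fredholm_le:
  assumes "minors_vanish k M" and M: "M \<in> carrier_mat n n"
  shows "degree (fredholm M) \<le> k"
  by (intro degree_le) (auto simp: coeff_fredholm[OF M] principal_minor_eq_0[OF assms] intro!: sum.neutral)

lemma adj_mat_mult_index:
  assumes A: "A \<in> carrier_mat n n" and b: "b \<in> carrier_vec n" and i: "i < n"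
  shows "(\<Sum>l = 0..<n. adj_mat A $$ (i, l) * b $ l) = det (replace_col A b i)"
proof -
  have "replace_col A b i \<in> carrier_mat n n" using A by (simp add: replace_col_def)
  then have "det (replace_col A b i) = (\<Sum>l<n. replace_col A b i $$ (l, i) * cofactor (replace_col A b i) l i)"
    using i by (rule laplace_expansion_column)
  also have "\<dots> = (\<Sum>l<n. adj_mat A $$ (i, l) * b $ l)"
  proof (intro sum.cong refl)
    fix l assume "l \<in> {..<n}"
    then have l: "l < n" by simp
    have "mat_delete (replace_col A b i) l i = mat_delete A l i"
      using A i l by (intro eq_matI) (auto simp: mat_delete_def replace_col_def)
    then show "replace_col A b i $$ (l, i) * cofactor (replace_col A b i) l i = adj_mat A $$ (i, l) * b $ l"
      using A i l by (simp add: cofactor_def adj_mat_def replace_col_def)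
  qed
  finally show ?thesis by (simp add: atLeast0LessThan)
qed

lemma coeff_adj_one_plus_Z_mult:
  assumes M: "M \<in> carrier_mat m m" and B: "B \<in> carrier_mat m n" and ij: "i < m" "j < n"
  shows "coeff ((adj_mat (one_plus_Z M) * const_mat B) $$ (i, j)) l = (adj_coeff M l * B) $$ (i, j)"
  using ij B adj_mat(1)[OF one_plus_Z_carrier[OF M]] adj_coeff_carrier[OF M, of l]
  by (simp add: scalar_prod_def coeff_sum coeff_adj_one_plus_Z[OF M] mult.commute)

text \<open>
  In the expansion of the Cramer determinant a set \<open>S\<close> of columns contributes in degree
  \<open>card S - 1\<close>, because the replaced column carries no factor \<open>Z\<close>; and only sets with at most \<open>k\<close>
  elements contribute.  So nothing is left in degree \<open>k\<close>.
\<close>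
lemma minors_vanish_imp_adj_coeff:
  fixes B :: "'a :: comm_ring_1 mat"
  assumes rk: "minors_vanish k B" and B: "B \<in> carrier_mat m n" and Y: "Y \<in> carrier_mat n m"
  shows "adj_coeff (B * Y) k * B = 0\<^sub>m m n"
proof (rule eq_matI)
  interpret c: comm_ring_hom "\<lambda>a :: 'a. [:a:]" by (rule const_poly_hom)
  let ?M = "B * Y"
  have M: "?M \<in> carrier_mat m m" using B Y by simp
  note A = one_plus_Z_carrier[OF M]
  fix i j assume "i < dim_row (0\<^sub>m m n :: 'a mat)" "j < dim_col (0\<^sub>m m n :: 'a mat)"
  then have ij: "i < m" "j < n" by auto
  define Y' where "Y' = mat n m (\<lambda>(a, c). if c = i then (if a = j then 1 else 0) else Y $$ (a, c))"
  define z :: "nat \<Rightarrow> 'a poly" where "z = (\<lambda>l. if l = i then 1 else monom 1 1)"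
  define d :: "nat \<Rightarrow> 'a poly" where "d = (\<lambda>l. if l = i then 0 else 1)"
  have Y': "Y' \<in> carrier_mat n m" by (simp add: Y'_def)
  have M': "B * Y' \<in> carrier_mat m m" using B Y' by simp
  have rk': "minors_vanish k (B * Y')" by (rule minors_vanish_mult[OF rk B Y'])
  have BY'i: "(B * Y') $$ (a, i) = B $$ (a, j)" if "a < m" for a
  proof -
    have "(B * Y') $$ (a, i) = (\<Sum>t = 0..<n. B $$ (a, t) * Y' $$ (t, i))"
      using that ij B Y' by (simp add: scalar_prod_def)
    also have "\<dots> = (\<Sum>t = 0..<n. if t = j then B $$ (a, j) else 0)"
      using ij by (intro sum.cong) (auto simp: Y'_def)
    finally show ?thesis using ij by simp
  qed
  have BY': "(B * Y') $$ (a, c) = (B * Y) $$ (a, c)" if "a < m" "c < m" "c \<noteq> i" for a c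
    using that B Y by (auto simp: scalar_prod_def Y'_def intro!: sum.cong)
  \<comment> \<open>By Cramer's rule the entry is the determinant of \<open>1 + Z M\<close> with a column of \<open>B\<close> put in
    place of column \<open>i\<close>; that matrix is diagonal plus \<open>B Y'\<close> with scaled columns.\<close>
  have repl: "replace_col (one_plus_Z ?M) (col (const_mat B) j) i =
      mat m m (\<lambda>(a, c). (if a = c then d a else 0) + const_mat (B * Y') $$ (a, c) * z c)"
    using B Y Y' ij
    by (intro eq_matI) (auto simp: replace_col_def one_plus_Z_def d_def z_def BY'i BY' mult.commute
        simp del: index_mult_mat(1))
  have "(adj_coeff ?M k * B) $$ (i, j) = coeff ((adj_mat (one_plus_Z ?M) * const_mat B) $$ (i, j)) k"
    by (rule coeff_adj_one_plus_Z_mult[OF M B ij, symmetric])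
  also have "(adj_mat (one_plus_Z ?M) * const_mat B) $$ (i, j) =
      det (replace_col (one_plus_Z ?M) (col (const_mat B) j) i)"
    using ij B adj_mat(1)[OF A]
      by (subst adj_mat_mult_index[OF A, symmetric]) (auto simp: scalar_prod_def)
  also have "\<dots> = (\<Sum>S\<in>Pow {0..<m}. (\<Prod>l\<in>S. z l) * (\<Prod>l\<in>{0..<m} - S. d l) *
      principal_minor (const_mat (B * Y')) S)"
    unfolding repl by (rule det_diag_plus_scaled_cols)
  also have "coeff \<dots> k = 0"
    unfolding coeff_sum
  proof (intro sum.neutral ballI)
    fix S assume "S \<in> Pow {0..<m}"
    then have S: "S \<subseteq> {0..<m}" and fin: "finite S" using finite_subset by auto
    have pm: "principal_minor (const_mat (B * Y')) S = [:principal_minor (B * Y') S:]"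
      unfolding const_mat_def by (rule c.principal_minor_hom[OF M' S])
    consider "k < card S" | "i \<notin> S" | "i \<in> S" "card S \<le> k" by linarith
    then show "coeff ((\<Prod>l\<in>S. z l) * (\<Prod>l\<in>{0..<m} - S. d l) * principal_minor (const_mat (B * Y')) S) k = 0"
    proof cases
      case 1
      then show ?thesis by (simp add: pm principal_minor_eq_0[OF rk' M' S])
    next
      case 2
      then have "(\<Prod>l\<in>{0..<m} - S. d l) = 0"
        using ij by (intro prod_zero) (auto simp: d_def)
      then show ?thesis by simp
    next
      case 3
      have "(\<Prod>l\<in>S. z l) = z i * (\<Prod>l\<in>S - {i}. z l)"
        using fin 3(1) by (rule prod.remove)
      also have "\<dots> = (\<Prod>l\<in>S - {i}. monom 1 1)"
        by (auto simp: z_def intro!: prod.cong)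
      also have "\<dots> = monom 1 (card S - 1)"
        using 3(1) fin by (simp add: monom_power)
      finally have z: "(\<Prod>l\<in>S. z l) = monom 1 (card S - 1)" .
      have d: "(\<Prod>l\<in>{0..<m} - S. d l) = 1"
        using 3 by (intro prod.neutral) (auto simp: d_def)
      have "card S \<noteq> 0" using 3(1) fin by auto
      then have "card S - 1 \<noteq> k" using 3(2) by linarith
      then show ?thesis by (simp add: z d pm smult_monom)
    qed
  qed
  finally show "(adj_coeff ?M k * B) $$ (i, j) = 0\<^sub>m m n $$ (i, j)"
    using ij by simp
qed (use B Y adj_coeff_carrier[of "B * Y" m k] in auto)

lemma coeff_mult_add:
  fixes p q :: "'a :: comm_semiring_0 poly"
  assumes "degree p \<le> m" and "degree q \<le> n"
  shows "coeff (p * q) (m + n) = coeff p m * coeff q n"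
proof -
  have "coeff (p * q) (m + n) = (\<Sum>i\<le>m + n. if i = m then coeff p m * coeff q n else 0)"
    unfolding coeff_mult
  proof (intro sum.cong refl)
    fix i assume "i \<in> {..m + n}"
    then consider "i = m" | "degree p < i" | "degree q < m + n - i"
      using assms by force
    then show "coeff p i * coeff q (m + n - i) = (if i = m then coeff p m * coeff q n else 0)"
      using assms by cases (auto simp: coeff_eq_0)
  qed
  then show ?thesis by simp
qed

text \<open>
  This replaces multiplicativity of the degree, which fails over a general ring: when
  \<open>coeff P k\<close> is a unit, the coefficient computed here is nonzero unless \<open>c = 0\<close>.
\<close>
lemma unit_lead_mult_coeff:
  fixes P c :: "'a :: comm_ring_1 poly"
  assumes "degree P \<le> k"
  shows "coeff (P ^ r * c) (k * r + degree c) = coeff P k ^ r * lead_coeff c"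
proof (induction r)
  case 0
  then show ?case by simp
next
  case (Suc r)
  have le: "degree (P ^ r * c) \<le> k * r + degree c"
    using degree_mult_le[of "P ^ r" c] degree_power_le[of P r] assms
    by (meson add_le_mono1 le_trans mult_le_mono1)
  have "coeff (P * (P ^ r * c)) (k + (k * r + degree c)) = coeff P k * coeff (P ^ r * c) (k * r + degree c)"
    by (rule coeff_mult_add[OF assms le])
  then show ?case using Suc by (simp add: algebra_simps)
qed

text \<open>
  With \<open>Q = adj (1 + Z M) B\<close>, the block matrix \<open>K\<close> below yields
  \<open>det K * P ^ (k + 1) = P * det (L Q H)\<close>.  The entries of \<open>Q\<close> have degree below \<open>k\<close>, so the
  right-hand side has degree below \<open>k (k + 1)\<close>, and both sides must be zero.  The constant term of
  \<open>det (L Q H)\<close> is \<open>det (L B H)\<close>.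
\<close>
lemma adj_coeff_imp_minors_vanish:
  fixes M B :: "'a :: comm_ring_1 mat"
  assumes M: "M \<in> carrier_mat m m" and B: "B \<in> carrier_mat m n"
    and deg: "degree (fredholm M) \<le> k" and unit: "coeff (fredholm M) k dvd 1"
    and ann: "adj_coeff M k * B = 0\<^sub>m m n"
  shows "minors_vanish k B"
  unfolding minors_vanish_def
proof (intro ballI)
  interpret e: comm_ring_hom "\<lambda>p :: 'a poly. coeff p 0" by (rule coeff_0_hom)
  let ?P = "fredholm M" and ?A = "one_plus_Z M" and ?s = "k + 1"
  fix L H :: "'a mat" assume "L \<in> carrier_mat ?s (dim_row B)" and "H \<in> carrier_mat (dim_col B) ?s"
  then have L: "L \<in> carrier_mat ?s m" and H: "H \<in> carrier_mat n ?s" using B by auto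
  note A = one_plus_Z_carrier[OF M]
  note R = adj_mat(1)[OF A]
  have no_zero_div: "c = 0" if "degree (?P ^ r * c) < k * r + degree c" for r c
  proof (rule ccontr)
    assume "c \<noteq> 0"
    have zero: "coeff ?P k ^ r * lead_coeff c = 0"
      using unit_lead_mult_coeff[OF deg, of r c] that by (simp add: coeff_eq_0)
    obtain u where u: "1 = coeff ?P k * u" using unit by (rule dvdE)
    have "lead_coeff c = (coeff ?P k * u) ^ r * lead_coeff c"
      by (simp flip: u)
    also have "\<dots> = u ^ r * (coeff ?P k ^ r * lead_coeff c)"
      by (simp add: power_mult_distrib mult_ac)
    also have "\<dots> = 0" unfolding zero by simp
    finally show False using \<open>c \<noteq> 0\<close> by simp
  qed
  define Q where "Q = adj_mat ?A * const_mat B"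
  have Q: "Q \<in> carrier_mat m n" using R B by (simp add: Q_def)
  have ann': "adj_coeff M l * B = 0\<^sub>m m n" if "k \<le> l" for l
    using that
  proof (induction l rule: dec_induct)
    case base
    then show ?case by (rule ann)
  next
    case (step l)
    note N = adj_coeff_carrier[OF M, of l]
    have Ml: "(M * adj_coeff M l) * B = 0\<^sub>m m n"
      using M B N step.IH by (simp add: assoc_mult_mat[of _ m m _ m _ n])
    have "adj_coeff M (Suc l) * B = coeff ?P (Suc l) \<cdot>\<^sub>m B - M * adj_coeff M l * B"
      using M N B
        by (simp add: minus_mult_distrib_mat[of _ m m _ _ n] mult_smult_assoc_mat[of _ m m _ n] del: assoc_mult_mat)
    moreover have "coeff ?P (Suc l) = 0" using step.hyps deg by (simp add: coeff_eq_0)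
    ultimately show ?case unfolding Ml using B by (intro eq_matI) auto
  qed
  have degQ: "coeff (Q $$ (i, j)) l = 0" if "i < m" "j < n" "k \<le> l" for i j l
    using that coeff_adj_one_plus_Z_mult[OF M B that(1,2), of l] by (simp add: Q_def ann')
  define W where "W = const_mat L * Q * const_mat H"
  have W: "W \<in> carrier_mat ?s ?s" using L Q H by (simp add: W_def)
  have W_index: "W $$ (i, j) = (\<Sum>b = 0..<n. (\<Sum>a = 0..<m. [:L $$ (i, a):] * Q $$ (a, b)) * [:H $$ (b, j):])"
    if "i < ?s" "j < ?s" for i j
    using that L Q H by (simp add: W_def scalar_prod_def del: assoc_mult_mat)
  have coeffW: "coeff (W $$ (i, j)) l = 0" if "i < ?s" "j < ?s" "k \<le> l" for i j l
    using that by (simp add: W_index coeff_sum degQ mult.commute[of _ "[:_:]"])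
  \<comment> \<open>Jacobi's theorem on the minors of the adjugate, in a form free of divisions.\<close>
  define K where "K = four_block_mat ?A (- (const_mat B * const_mat H)) (const_mat L) (0\<^sub>m ?s ?s)"
  have BH: "const_mat B * const_mat H \<in> carrier_mat m ?s" using B H by simp
  have K: "K \<in> carrier_mat (m + ?s) (m + ?s)" unfolding K_def
    by (rule four_block_carrier_mat) (use A in auto)
  have "?A * (Q * const_mat H) = (?A * adj_mat ?A) * (const_mat B * const_mat H)"
    unfolding Q_def using A R B H
    by (simp add: assoc_mult_mat[of _ m m _ n _ ?s] assoc_mult_mat[of _ m m _ m _ ?s])
  also have "\<dots> = ?P \<cdot>\<^sub>m (const_mat B * const_mat H)"
    using BH by (simp add: adj_mat(2)[OF A] fredholm_def mult_smult_assoc_mat[of _ m m _ ?s] left_mult_one_mat[OF BH])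
  finally have AQH: "?A * (Q * const_mat H) = ?P \<cdot>\<^sub>m (const_mat B * const_mat H)" .
  have "K * four_block_mat (1\<^sub>m m) (Q * const_mat H) (0\<^sub>m ?s m) (?P \<cdot>\<^sub>m 1\<^sub>m ?s) =
      four_block_mat ?A (0\<^sub>m m ?s) (const_mat L) W"
    unfolding K_def
  proof (subst mult_four_block_mat[of _ m m _ ?s _ ?s _ _ m _ ?s], goal_cases)
    case 9
    have nBH: "- (const_mat B * const_mat H) \<in> carrier_mat m ?s"
      using BH by simp
    have "- (const_mat B * const_mat H) * (?P \<cdot>\<^sub>m 1\<^sub>m ?s) = ?P \<cdot>\<^sub>m - (const_mat B * const_mat H)"
      using right_mult_one_mat[OF nBH] mult_smult_distrib[OF nBH one_carrier_mat] by metis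
    then have "?A * (Q * const_mat H) + - (const_mat B * const_mat H) * (?P \<cdot>\<^sub>m 1\<^sub>m ?s) = 0\<^sub>m m ?s"
      unfolding AQH using BH B H by (intro eq_matI) auto
    then show ?case using A B BH L Q H by (simp add: W_def assoc_mult_mat[of _ ?s m _ n _ ?s])
  qed (use A BH L Q H in auto)
  then have "det K * det (four_block_mat (1\<^sub>m m) (Q * const_mat H) (0\<^sub>m ?s m) (?P \<cdot>\<^sub>m 1\<^sub>m ?s)) =
      det (four_block_mat ?A (0\<^sub>m m ?s) (const_mat L) W)"
    using K by (subst det_mult[symmetric, of _ "m + ?s"]) auto
  then have main: "det K * ?P ^ ?s = ?P * det W"
    using A Q H L W by (simp add: det_block_lower_left_zero det_block_upper_right_zero fredholm_def)
  have "det W = 0"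
  proof (cases k)
    case 0
    then have "W = 0\<^sub>m 1 1" using W coeffW by (intro eq_matI) (auto intro!: poly_eqI)
    then show ?thesis by simp
  next
    case (Suc k')
    have "degree (W $$ (i, j)) \<le> k'" if "i < ?s" "j < ?s" for i j
      using coeffW[OF that] Suc by (intro degree_le) auto
    then have "degree (det W) \<le> k' * ?s" using W by (rule degree_det_le)
    then have "degree (?P * det W) \<le> k + k' * ?s"
      using degree_mult_le[of ?P "det W"] deg by linarith
    also have "\<dots> < k * ?s"
      unfolding Suc by simp
    finally have "degree (?P ^ ?s * det K) < k * ?s + degree (det K)"
      unfolding main[symmetric] mult.commute[of "det K"] by linarith
    then have "det K = 0" by (rule no_zero_div)
    then have "?P ^ 1 * det W = 0" using main by simp
    moreover have "k > 0" using Suc by simp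
    ultimately show ?thesis using no_zero_div[of 1 "det W"] by simp
  qed
  moreover have "map_mat (\<lambda>p. coeff p 0) W = L * B * H"
  proof (rule eq_matI)
    fix i j assume "i < dim_row (L * B * H)" "j < dim_col (L * B * H)"
    then have ij: "i < ?s" "j < ?s" using L H by auto
    have "coeff (Q $$ (a, b)) 0 = B $$ (a, b)" if "a < m" "b < n" for a b
      using that coeff_adj_one_plus_Z_mult[OF M B that, of 0] M B by (simp add: Q_def)
    then have "coeff (W $$ (i, j)) 0 = (\<Sum>b = 0..<n. (\<Sum>a = 0..<m. L $$ (i, a) * B $$ (a, b)) * H $$ (b, j))"
      using ij by (simp add: W_index coeff_sum mult.commute[of _ "[:_:]"] mult.commute[of _ "H $$ _"])
    then show "map_mat (\<lambda>p. coeff p 0) W $$ (i, j) = (L * B * H) $$ (i, j)"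
      using ij W L B H by (simp add: scalar_prod_def del: assoc_mult_mat)
  qed (use W L H in auto)
  ultimately show "det (L * B * H) = 0"
    using e.hom_det[of W] by simp
qed

section \<open>Linear maps as matrices and retracts of free modules\<close>

lemma module_ring: "Modules.module ((*) :: 'a::comm_ring_1 \<Rightarrow> 'a \<Rightarrow> 'a)"
  by unfold_locales (auto simp: algebra_simps)

lemma lin_mapI:
  assumes "\<And>x. x \<in> M \<Longrightarrow> f x \<in> N" "\<And>x y. x \<in> M \<Longrightarrow> y \<in> M \<Longrightarrow> f (x + y) = f x + f y"
    "\<And>a x. x \<in> M \<Longrightarrow> f (s a x) = t a (f x)"
  shows "lin_map s M t N f"
  using assms by (auto simp: lin_map_def)

lemma lin_mapD:
  assumes "lin_map s M t N f"
  shows "x \<in> M \<Longrightarrow> f x \<in> N" "x \<in> M \<Longrightarrow> y \<in> M \<Longrightarrow> f (x + y) = f x + f y"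
    "x \<in> M \<Longrightarrow> f (s a x) = t a (f x)"
  using assms by (auto simp: lin_map_def)

lemma lin_map_comp: "lin_map t N u P g \<Longrightarrow> lin_map s M t N f \<Longrightarrow> lin_map s M u P (g \<circ> f)"
  by (auto simp: lin_map_def Pi_iff)

lemma module_hom_lin_map: "module_hom s t f \<Longrightarrow> lin_map s UNIV t UNIV f"
  by (auto simp: lin_map_def module_hom.add module_hom.scale)

lemma lin_map_index:
  "lin_map s M (\<cdot>\<^sub>v) (carrier_vec m) f \<Longrightarrow> i < m \<Longrightarrow> lin_map s M (*) UNIV (\<lambda>v. f v $ i)"
  by (auto simp: lin_map_def Pi_iff)

lemma lin_map_vec_expand:
  fixes s :: "'a::comm_ring_1 \<Rightarrow> 'm::ab_group_add \<Rightarrow> 'm"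
  assumes s: "Modules.module s" and f: "lin_map (\<cdot>\<^sub>v) (carrier_vec n) s UNIV f" and v: "v \<in> carrier_vec n"
  shows "f v = (\<Sum>j<n. s (v $ j) (f (unit_vec n j)))"
proof -
  interpret Modules.module s by fact
  let ?v = "\<lambda>r. vec n (\<lambda>i. if i < r then v $ i else 0)"
  have "f (?v r) = (\<Sum>j<r. s (v $ j) (f (unit_vec n j)))" if "r \<le> n" for r
    using that
  proof (induction r)
    case 0
    have "?v 0 = 0 \<cdot>\<^sub>v 0\<^sub>v n" by (intro eq_vecI) auto
    then show ?case using lin_mapD(3)[OF f, of "0\<^sub>v n" 0] by simp
  next
    case (Suc r)
    have "?v (Suc r) = ?v r + v $ r \<cdot>\<^sub>v unit_vec n r"
      using Suc.prems by (intro eq_vecI) (auto simp: less_Suc_eq)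
    then have "f (?v (Suc r)) = f (?v r) + s (v $ r) (f (unit_vec n r))"
      using lin_mapD(2,3)[OF f] by simp
    then show ?case using Suc by simp
  qed
  from this[of n] have "f (?v n) = (\<Sum>j<n. s (v $ j) (f (unit_vec n j)))" by simp
  moreover have "?v n = v" using v by (intro eq_vecI) auto
  ultimately show ?thesis by simp
qed

definition lmat :: "nat \<Rightarrow> nat \<Rightarrow> ('a::comm_ring_1 vec \<Rightarrow> 'a vec) \<Rightarrow> 'a mat" where
  "lmat m n f = mat m n (\<lambda>(i, j). f (unit_vec n j) $ i)"

lemma endo_mat_lmat: "endo_mat n = lmat n n"
  by (auto simp: endo_mat_def lmat_def)

lemma lmat_carrier [simp]: "lmat m n f \<in> carrier_mat m n"
  by (simp add: lmat_def)

lemma lmat_mult_vec: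
  assumes f: "lin_map (\<cdot>\<^sub>v) (carrier_vec n) (\<cdot>\<^sub>v) (carrier_vec m) f" and v: "v \<in> carrier_vec n"
  shows "lmat m n f *\<^sub>v v = f v"
proof (rule eq_vecI)
  have fv: "f v \<in> carrier_vec m" by (rule lin_mapD(1)[OF f v])
  fix i assume "i < dim_vec (f v)"
  then have i: "i < m" using fv by simp
  show "(lmat m n f *\<^sub>v v) $ i = f v $ i"
    using i v lin_map_vec_expand[OF module_ring lin_map_index[OF f i] v]
    by (simp add: lmat_def scalar_prod_def atLeast0LessThan mult.commute)
qed (use lin_mapD(1)[OF f v] in \<open>auto simp: lmat_def\<close>)

lemma lmat_comp:
  assumes f: "lin_map (\<cdot>\<^sub>v) (carrier_vec n) (\<cdot>\<^sub>v) (carrier_vec m) f"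
    and g: "lin_map (\<cdot>\<^sub>v) (carrier_vec r) (\<cdot>\<^sub>v) (carrier_vec n) g"
  shows "lmat m r (f \<circ> g) = lmat m n f * lmat n r g"
proof (rule eq_matI)
  fix i j assume "i < dim_row (lmat m n f * lmat n r g)" "j < dim_col (lmat m n f * lmat n r g)"
  then have ij: "i < m" "j < r" by (auto simp: lmat_def)
  have gj: "g (unit_vec r j) \<in> carrier_vec n" by (rule lin_mapD(1)[OF g]) simp
  have "col (lmat n r g) j = g (unit_vec r j)"
    using ij gj by (intro eq_vecI) (auto simp: lmat_def)
  then have "(lmat m n f * lmat n r g) $$ (i, j) = (lmat m n f *\<^sub>v g (unit_vec r j)) $ i"
    using ij by (simp add: lmat_def)
  then show "lmat m r (f \<circ> g) $$ (i, j) = (lmat m n f * lmat n r g) $$ (i, j)"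
    using ij by (simp add: lmat_mult_vec[OF f gj]) (simp add: lmat_def)
qed (auto simp: lmat_def)

lemma lin_map_mult_mat_vec:
  fixes A :: "'a::comm_ring_1 mat"
  assumes A: "A \<in> carrier_mat m n"
  shows "lin_map (\<cdot>\<^sub>v) (carrier_vec n) (\<cdot>\<^sub>v) (carrier_vec m) ((*\<^sub>v) A)"
proof (rule lin_mapI)
  fix a and x :: "'a vec" assume "x \<in> carrier_vec n"
  then show "A *\<^sub>v (a \<cdot>\<^sub>v x) = a \<cdot>\<^sub>v (A *\<^sub>v x)"
    using A by (intro eq_vecI) auto
qed (use A in \<open>auto simp: mult_add_distrib_mat_vec\<close>)

lemma lmat_mult_mat_vec:
  assumes A: "A \<in> carrier_mat m n"
  shows "lmat m n ((*\<^sub>v) A) = A"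
  using A by (intro eq_matI) (auto simp: lmat_def)

text \<open>
  Compared with \<open>fgp_iso\<close>, the complement is left implicit (it is the kernel of \<open>\<pi>\<close>), which is what
  computations with matrices need.
\<close>
definition free_retract ::
  "('a::comm_ring_1 \<Rightarrow> 'm::ab_group_add \<Rightarrow> 'm) \<Rightarrow> 'm set \<Rightarrow> nat \<Rightarrow> ('m \<Rightarrow> 'a vec) \<Rightarrow> ('a vec \<Rightarrow> 'm) \<Rightarrow> bool" where
  "free_retract s M n \<iota> \<pi> \<longleftrightarrow>
     lin_map s M (\<cdot>\<^sub>v) (carrier_vec n) \<iota> \<and> lin_map (\<cdot>\<^sub>v) (carrier_vec n) s M \<pi> \<and> (\<forall>x\<in>M. \<pi> (\<iota> x) = x)"

lemma free_retractD:
  assumes "free_retract s M n \<iota> \<pi>"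
  shows "lin_map s M (\<cdot>\<^sub>v) (carrier_vec n) \<iota>" "lin_map (\<cdot>\<^sub>v) (carrier_vec n) s M \<pi>"
    "x \<in> M \<Longrightarrow> \<pi> (\<iota> x) = x"
  using assms by (auto simp: free_retract_def)

lemma fgp_iso_imp_free_retract:
  assumes iso: "fgp_iso s UNIV n N \<sigma>"
  defines "\<iota> \<equiv> \<lambda>x. \<sigma> (x, 0\<^sub>v n)" and "\<pi> \<equiv> \<lambda>v. fst (inv_into (UNIV \<times> N) \<sigma> v)"
  shows "free_retract s UNIV n \<iota> \<pi>"
    and "v \<in> carrier_vec n \<Longrightarrow>
      (\<sigma> \<circ> map_prod \<psi> id \<circ> inv_into (UNIV \<times> N) \<sigma>) v = v + \<iota> (\<psi> (\<pi> v) - \<pi> v)"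
proof -
  have N: "0\<^sub>v n \<in> N" "\<And>x y. x \<in> N \<Longrightarrow> y \<in> N \<Longrightarrow> x + y \<in> N" "\<And>a x. x \<in> N \<Longrightarrow> a \<cdot>\<^sub>v x \<in> N" "N \<subseteq> carrier_vec n"
    using iso by (auto simp: fgp_iso_def submodule_vec_def)
  have lin: "lin_map (\<lambda>a (x, y). (s a x, a \<cdot>\<^sub>v y)) (UNIV \<times> N) (\<cdot>\<^sub>v) (carrier_vec n) \<sigma>"
    and bij: "bij_betw \<sigma> (UNIV \<times> N) (carrier_vec n)"
    using iso by (auto simp: fgp_iso_def)
  have add: "\<sigma> (x + x', y + y') = \<sigma> (x, y) + \<sigma> (x', y')" if "y \<in> N" "y' \<in> N" for x x' y y'
    using lin_mapD(2)[OF lin, of "(x, y)" "(x', y')"] that by simp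
  have scale: "\<sigma> (s a x, a \<cdot>\<^sub>v y) = a \<cdot>\<^sub>v \<sigma> (x, y)" if "y \<in> N" for a x y
    using lin_mapD(3)[OF lin, of "(x, y)" a] that by simp
  have inv: "inv_into (UNIV \<times> N) \<sigma> (\<sigma> (x, y)) = (x, y)" if "y \<in> N" for x y
    using that bij by (simp add: bij_betw_def)
  have \<sigma>: "\<sigma> (x, y) \<in> carrier_vec n" if "y \<in> N" for x y
    using lin_mapD(1)[OF lin, of "(x, y)"] that by simp
  have obt: "\<exists>x y. y \<in> N \<and> v = \<sigma> (x, y)" if "v \<in> carrier_vec n" for v
    using that bij by (force simp: bij_betw_def)
  have zero: "a \<cdot>\<^sub>v 0\<^sub>v n = 0\<^sub>v n" for a :: 'a
    by (intro eq_vecI) auto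
  show "free_retract s UNIV n \<iota> \<pi>"
    unfolding free_retract_def
  proof (intro conjI lin_mapI ballI)
    fix v w :: "'a vec" and a assume "v \<in> carrier_vec n"
    then obtain x y where v: "y \<in> N" "v = \<sigma> (x, y)" using obt by blast
    show "\<pi> (a \<cdot>\<^sub>v v) = s a (\<pi> v)"
      unfolding v(2) scale[OF v(1), symmetric] \<pi>_def by (simp add: inv v N)
    assume "w \<in> carrier_vec n"
    then obtain x' y' where w: "y' \<in> N" "w = \<sigma> (x', y')" using obt by blast
    show "\<pi> (v + w) = \<pi> v + \<pi> w"
      unfolding v(2) w(2) add[OF v(1) w(1), symmetric] \<pi>_def by (simp add: inv v w N)
  next
    fix x y a
    show "\<iota> (x + y) = \<iota> x + \<iota> y" "\<iota> (s a x) = a \<cdot>\<^sub>v \<iota> x"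
      using add[of "0\<^sub>v n" "0\<^sub>v n" x y] scale[of "0\<^sub>v n" a x] N
        by (simp_all add: \<iota>_def zero)
  qed (use \<sigma> N inv in \<open>auto simp: \<iota>_def \<pi>_def\<close>)
  assume "v \<in> carrier_vec n"
  then obtain x y where v: "y \<in> N" "v = \<sigma> (x, y)" using obt by blast
  have "\<sigma> (x + (\<psi> x - x), y + 0\<^sub>v n) = \<sigma> (x, y) + \<sigma> (\<psi> x - x, 0\<^sub>v n)"
    by (rule add) (use v N in auto)
  moreover have "y + 0\<^sub>v n = y" using v N(4) by auto
  ultimately show "(\<sigma> \<circ> map_prod \<psi> id \<circ> inv_into (UNIV \<times> N) \<sigma>) v = v + \<iota> (\<psi> (\<pi> v) - \<pi> v)"
    by (simp add: v inv \<iota>_def \<pi>_def)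
qed

lemma free_retract_imp_fgp_iso:
  fixes s :: "'a::comm_ring_1 \<Rightarrow> 'm::ab_group_add \<Rightarrow> 'm"
  assumes r: "free_retract s M n \<iota> \<pi>"
  shows "fgp_iso s M n {v \<in> carrier_vec n. \<pi> v = 0} (\<lambda>(x, y). \<iota> x + y)"
proof -
  note i = lin_mapD[OF free_retractD(1)[OF r]] and p = lin_mapD[OF free_retractD(2)[OF r]]
    and pi = free_retractD(3)[OF r]
  have p0: "\<pi> (0\<^sub>v n) = 0"
    using p(2)[of "0\<^sub>v n" "0\<^sub>v n"] by simp
  have "a \<cdot>\<^sub>v 0\<^sub>v n = 0\<^sub>v n" for a :: 'a
    by (intro eq_vecI) auto
  then have s0: "s a 0 = 0" for a
    using p(3)[of "0\<^sub>v n" a] p0 by simp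
  have pdiff: "\<pi> (v + (- 1) \<cdot>\<^sub>v w) = \<pi> v - \<pi> w" if "v \<in> carrier_vec n" "w \<in> carrier_vec n" for v w :: "'a vec"
  proof -
    have "w + (- 1) \<cdot>\<^sub>v w = 0\<^sub>v n" using that by (intro eq_vecI) auto
    then have "\<pi> w + \<pi> ((- 1) \<cdot>\<^sub>v w) = 0"
      using p(2)[of w "(- 1) \<cdot>\<^sub>v w"] p0 that by simp
    then show ?thesis using p(2)[of v "(- 1) \<cdot>\<^sub>v w"] that
      by (simp add: eq_neg_iff_add_eq_0 add.commute)
  qed
  let ?N = "{v \<in> carrier_vec n. \<pi> v = 0}"
  have "bij_betw (\<lambda>(x, y). \<iota> x + y) (M \<times> ?N) (carrier_vec n)"
  proof (rule bij_betw_byWitness[where f' = "\<lambda>v. (\<pi> v, v + (- 1) \<cdot>\<^sub>v \<iota> (\<pi> v))"])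
    show "\<forall>a\<in>M \<times> ?N. (\<lambda>v. (\<pi> v, v + (- 1) \<cdot>\<^sub>v \<iota> (\<pi> v))) ((\<lambda>(x, y). \<iota> x + y) a) = a"
    proof clarsimp
      fix x y assume xy: "x \<in> M" "y \<in> carrier_vec n" "\<pi> y = 0"
      then have "\<pi> (\<iota> x + y) = x" using i(1) p(2) pi by simp
      moreover have "\<iota> x + y + (- 1) \<cdot>\<^sub>v \<iota> x = y"
        using i(1)[OF xy(1)] xy by (intro eq_vecI) auto
      ultimately show "\<pi> (\<iota> x + y) = x \<and> \<iota> x + y + - 1 \<cdot>\<^sub>v \<iota> (\<pi> (\<iota> x + y)) = y"
        by simp
    qed
    show "\<forall>v\<in>carrier_vec n. (\<lambda>(x, y). \<iota> x + y) (\<pi> v, v + (- 1) \<cdot>\<^sub>v \<iota> (\<pi> v)) = v"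
    proof clarsimp
      fix v :: "'a vec" assume v: "v \<in> carrier_vec n"
      show "\<iota> (\<pi> v) + (v + - 1 \<cdot>\<^sub>v \<iota> (\<pi> v)) = v"
        using v i(1)[OF p(1)[OF v]] by (intro eq_vecI) auto
    qed
    show "(\<lambda>(x, y). \<iota> x + y) ` (M \<times> ?N) \<subseteq> carrier_vec n"
      using i(1) by auto
    show "(\<lambda>v. (\<pi> v, v + (- 1) \<cdot>\<^sub>v \<iota> (\<pi> v))) ` carrier_vec n \<subseteq> M \<times> ?N"
      using i(1) p(1) pi by (auto simp: pdiff)
  qed
  moreover have "lin_map (\<lambda>a (x, y). (s a x, a \<cdot>\<^sub>v y)) (M \<times> ?N) (\<cdot>\<^sub>v) (carrier_vec n) (\<lambda>(x, y). \<iota> x + y)"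
  proof (rule lin_mapI; clarsimp)
    fix x y assume xy: "x \<in> M" "y \<in> carrier_vec n" "\<pi> y = 0"
    show "\<iota> x + y \<in> carrier_vec n" using xy i(1) by simp
    show "\<iota> (s a x) + a \<cdot>\<^sub>v y = a \<cdot>\<^sub>v (\<iota> x + y)" for a
      using xy i(1,3) by (simp add: smult_add_distrib_vec[of _ n])
    fix x' y' assume xy': "x' \<in> M" "y' \<in> carrier_vec n" "\<pi> y' = 0"
    show "\<iota> (x + x') + (y + y') = \<iota> x + y + (\<iota> x' + y')"
      using xy xy' i(1)[of x] i(1)[of x'] by (intro eq_vecI) (auto simp: i(2))
  qed
  moreover have "submodule_vec n ?N"
    using p p0 s0 by (auto simp: submodule_vec_def)
  ultimately show ?thesis by (simp add: fgp_iso_def)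
qed

text \<open>
  For two retracts, the matrices of \<open>\<psi> - 1\<close> are \<open>X Y\<close> and \<open>Y X\<close> with \<open>X\<close> the matrix of
  \<open>\<iota> (\<psi> - 1) \<pi>'\<close> and \<open>Y\<close> that of \<open>\<iota>' \<pi>\<close>, so the determinants agree and the definite description in
  \<open>det_fgp\<close> denotes.
\<close>
lemma det_fgp_eq:
  assumes r: "free_retract s UNIV n \<iota> \<pi>" and diff: "lin_map s UNIV s UNIV (\<lambda>x. \<psi> x - x)"
  shows "det_fgp s UNIV \<psi> = det (1\<^sub>m n + lmat n n (\<lambda>v. \<iota> (\<psi> (\<pi> v) - \<pi> v)))"
proof -
  let ?D = "\<lambda>n \<iota> \<pi>. det (1\<^sub>m n + lmat n n (\<lambda>v. \<iota> (\<psi> (\<pi> v) - \<pi> v)))"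
  have indep: "?D n' \<iota>' \<pi>' = ?D n \<iota> \<pi>" if r': "free_retract s UNIV n' \<iota>' \<pi>'" for n' \<iota>' \<pi>'
  proof -
    note i = free_retractD(1)[OF r] and p = free_retractD(2)[OF r]
      and i' = free_retractD(1)[OF r'] and p' = free_retractD(2)[OF r']
    let ?X = "lmat n n' (\<iota> \<circ> ((\<lambda>x. \<psi> x - x) \<circ> \<pi>'))" and ?Y = "lmat n' n (\<iota>' \<circ> \<pi>)"
    have X: "lin_map (\<cdot>\<^sub>v) (carrier_vec n') (\<cdot>\<^sub>v) (carrier_vec n) (\<iota> \<circ> ((\<lambda>x. \<psi> x - x) \<circ> \<pi>'))"
      and Y: "lin_map (\<cdot>\<^sub>v) (carrier_vec n) (\<cdot>\<^sub>v) (carrier_vec n') (\<iota>' \<circ> \<pi>)"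
      by (intro lin_map_comp[OF i] lin_map_comp[OF diff] p' lin_map_comp[OF i'] p)+
    have "lmat n n (\<lambda>v. \<iota> (\<psi> (\<pi> v) - \<pi> v)) = ?X * ?Y"
      by (subst lmat_comp[OF X Y, symmetric]) (simp add: o_def free_retractD(3)[OF r'])
    moreover have "lmat n' n' (\<lambda>v. \<iota>' (\<psi> (\<pi>' v) - \<pi>' v)) = ?Y * ?X"
      by (subst lmat_comp[OF Y X, symmetric]) (simp add: o_def free_retractD(3)[OF r])
    ultimately show ?thesis
      by (simp add: det_one_plus_mult_commute[of ?X n n' ?Y])
  qed
  have formula: "det (endo_mat n' (\<sigma> \<circ> map_prod \<psi> id \<circ> inv_into (UNIV \<times> N) \<sigma>)) = ?D n \<iota> \<pi>"
    if iso: "fgp_iso s UNIV n' N \<sigma>" for n' N \<sigma>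
  proof -
    define \<iota>' where "\<iota>' = (\<lambda>x. \<sigma> (x, 0\<^sub>v n'))"
    define \<pi>' where "\<pi>' = (\<lambda>v. fst (inv_into (UNIV \<times> N) \<sigma> v))"
    note R = fgp_iso_imp_free_retract[OF iso, folded \<iota>'_def \<pi>'_def]
    have "endo_mat n' (\<sigma> \<circ> map_prod \<psi> id \<circ> inv_into (UNIV \<times> N) \<sigma>) =
        1\<^sub>m n' + lmat n' n' (\<lambda>v. \<iota>' (\<psi> (\<pi>' v) - \<pi>' v))"
    proof (rule eq_matI)
      fix i j
      assume "i < dim_row (1\<^sub>m n' + lmat n' n' (\<lambda>v. \<iota>' (\<psi> (\<pi>' v) - \<pi>' v)))"
        and "j < dim_col (1\<^sub>m n' + lmat n' n' (\<lambda>v. \<iota>' (\<psi> (\<pi>' v) - \<pi>' v)))"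
      then have ij: "i < n'" "j < n'" by (auto simp: lmat_def)
      let ?e = "unit_vec n' j"
      have "endo_mat n' (\<sigma> \<circ> map_prod \<psi> id \<circ> inv_into (UNIV \<times> N) \<sigma>) $$ (i, j) =
          (?e + \<iota>' (\<psi> (\<pi>' ?e) - \<pi>' ?e)) $ i"
        using ij R(2)[of ?e \<psi>] by (simp add: endo_mat_def \<iota>'_def \<pi>'_def)
      also have "\<dots> = (1\<^sub>m n' + lmat n' n' (\<lambda>v. \<iota>' (\<psi> (\<pi>' v) - \<pi>' v))) $$ (i, j)"
        using ij lin_mapD(1)[OF free_retractD(1)[OF R(1)], of "\<psi> (\<pi>' ?e) - \<pi>' ?e"]
        by (simp add: lmat_def)
      finally show "endo_mat n' (\<sigma> \<circ> map_prod \<psi> id \<circ> inv_into (UNIV \<times> N) \<sigma>) $$ (i, j) =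
          (1\<^sub>m n' + lmat n' n' (\<lambda>v. \<iota>' (\<psi> (\<pi>' v) - \<pi>' v))) $$ (i, j)" .
    qed (auto simp: endo_mat_def lmat_def)
    then show ?thesis using indep[OF R(1)] by simp
  qed
  show ?thesis
    unfolding det_fgp_def
  proof (rule the_equality)
    note iso = free_retract_imp_fgp_iso[OF r]
    show "\<exists>n' N \<sigma>. fgp_iso s UNIV n' N \<sigma> \<and>
        ?D n \<iota> \<pi> = det (endo_mat n' (\<sigma> \<circ> map_prod \<psi> id \<circ> inv_into (UNIV \<times> N) \<sigma>))"
      by (intro exI conjI) (rule iso, rule formula[OF iso, symmetric])
  next
    fix d assume "\<exists>n' N \<sigma>. fgp_iso s UNIV n' N \<sigma> \<and>
        d = det (endo_mat n' (\<sigma> \<circ> map_prod \<psi> id \<circ> inv_into (UNIV \<times> N) \<sigma>))"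
    then obtain n' N \<sigma> where "fgp_iso s UNIV n' N \<sigma>"
      and "d = det (endo_mat n' (\<sigma> \<circ> map_prod \<psi> id \<circ> inv_into (UNIV \<times> N) \<sigma>))"
      by (elim exE conjE)
    then show "d = ?D n \<iota> \<pi>" using formula by simp
  qed
qed

lemma minors_vanish_transpose:
  fixes B :: "'a :: comm_ring_1 mat"
  assumes "minors_vanish k B" and B: "B \<in> carrier_mat m n"
  shows "minors_vanish k B\<^sup>T"
  unfolding minors_vanish_def
proof (intro ballI)
  fix L H :: "'a mat" assume "L \<in> carrier_mat (k + 1) (dim_row B\<^sup>T)" and "H \<in> carrier_mat (dim_col B\<^sup>T) (k + 1)"
  then have L: "L \<in> carrier_mat (k + 1) n" and H: "H \<in> carrier_mat m (k + 1)" using B by auto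
  have BT: "B\<^sup>T \<in> carrier_mat n m" using B by simp
  have "(L * B\<^sup>T * H)\<^sup>T = H\<^sup>T * (L * B\<^sup>T)\<^sup>T"
    by (rule transpose_mult[OF mult_carrier_mat[OF L BT] H])
  also have "(L * B\<^sup>T)\<^sup>T = B * L\<^sup>T"
    using transpose_mult[OF L BT] by simp
  also have "H\<^sup>T * (B * L\<^sup>T) = H\<^sup>T * B * L\<^sup>T"
    using assoc_mult_mat[of "H\<^sup>T" "k + 1" m B n "L\<^sup>T" "k + 1"] H B L by simp
  finally have eq: "(L * B\<^sup>T * H)\<^sup>T = H\<^sup>T * B * L\<^sup>T" .
  have "det (H\<^sup>T * B * L\<^sup>T) = 0"
    using assms L H unfolding minors_vanish_def by auto
  then show "det (L * B\<^sup>T * H) = 0"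
    using det_transpose[of "L * B\<^sup>T * H" "k + 1"] eq mult_carrier_mat[OF mult_carrier_mat[OF L BT] H]
      by simp
qed

text \<open>
  The condition on \<open>C\<close> is the condition on \<open>B\<close> for the transposed pair \<open>C\<^sup>T, B\<^sup>T\<close>.
\<close>
lemma minors_vanish_iff_adj_coeff:
  fixes B C :: "'a :: comm_ring_1 mat"
  assumes B: "B \<in> carrier_mat m n" and C: "C \<in> carrier_mat n m"
    and unit: "coeff (fredholm (B * C)) k dvd 1"
  shows "minors_vanish k B \<and> minors_vanish k C \<longleftrightarrow>
    degree (fredholm (B * C)) \<le> k \<and> adj_coeff (B * C) k * B = 0\<^sub>m m n \<and> C * adj_coeff (B * C) k = 0\<^sub>m n m"
    (is "?rank \<longleftrightarrow> ?deg \<and> ?annB \<and> ?annC")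
proof -
  let ?M = "B * C"
  have M: "?M \<in> carrier_mat m m" using B C by simp
  have MT: "?M\<^sup>T \<in> carrier_mat m m" using M by simp
  have BT: "B\<^sup>T \<in> carrier_mat n m" and CT: "C\<^sup>T \<in> carrier_mat m n" using B C by auto
  note N = adj_coeff_carrier[OF M, of k]
  have "(C * adj_coeff ?M k)\<^sup>T = adj_coeff ?M\<^sup>T k * C\<^sup>T"
    using transpose_mult[OF C N] by (simp add: adj_coeff_transpose[OF M])
  then have annT: "?annC \<longleftrightarrow> adj_coeff ?M\<^sup>T k * C\<^sup>T = 0\<^sub>m m n"
    by (metis transpose_transpose zero_transpose_mat)
  show ?thesis
  proof
    assume rk: ?rank
    have "minors_vanish k ?M" using minors_vanish_mult[OF _ B C] rk by simp
    then have ?deg using M by (rule degree_fredholm_le)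
    moreover have ?annB using minors_vanish_imp_adj_coeff[OF _ B C] rk by simp
    moreover have "adj_coeff (C\<^sup>T * B\<^sup>T) k * C\<^sup>T = 0\<^sub>m m n"
      using minors_vanish_imp_adj_coeff[OF _ CT BT] minors_vanish_transpose[OF _ C] rk by simp
    ultimately show "?deg \<and> ?annB \<and> ?annC"
      using annT transpose_mult[OF B C] by simp
  next
    assume ann: "?deg \<and> ?annB \<and> ?annC"
    have "minors_vanish k B"
      using ann unit by (intro adj_coeff_imp_minors_vanish[OF M B]) auto
    moreover have "minors_vanish k C\<^sup>T"
      using ann unit annT
        by (intro adj_coeff_imp_minors_vanish[OF MT CT]) (auto simp: fredholm_transpose[OF M])
    ultimately show ?rank
      using minors_vanish_transpose[OF _ CT, of k] by simp
  qed
qed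

lemma lin_map_0:
  fixes f :: "'m::ab_group_add \<Rightarrow> 'n::ab_group_add"
  shows "lin_map s UNIV t UNIV f \<Longrightarrow> f 0 = 0"
  using lin_mapD(2)[of s UNIV t UNIV f 0 0] by simp

lemma lin_map_sum:
  fixes f :: "'m::ab_group_add \<Rightarrow> 'n::ab_group_add"
  assumes f: "lin_map s UNIV t UNIV f"
  shows "f (sum g A) = (\<Sum>x\<in>A. f (g x))"
  by (induction A rule: infinite_finite_induct) (simp_all add: lin_map_0[OF f] lin_mapD(2)[OF f])

lemma lin_map_diff:
  fixes f :: "'m::ab_group_add \<Rightarrow> 'n::ab_group_add"
  assumes f: "lin_map s UNIV t UNIV f"
  shows "f (x - y) = f x - f y"
  using lin_mapD(2)[OF f, of "x - y" y] by simp

lemma coeff_poly_scale_Z: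
  assumes "Modules.module s"
  shows "coeff (poly_scale s (monom 1 1) x) l = (case l of 0 \<Rightarrow> 0 | Suc l' \<Rightarrow> coeff x l')"
proof -
  interpret Modules.module s by fact
  have "s (coeff (monom 1 1) j) y = (if j = 1 then y else 0)" for j y
    by simp
  then show ?thesis
    by (cases l) (simp_all add: coeff_poly_scale[OF assms] sum.delta)
qed

text \<open>
  The extension of \<open>\<iota>\<close> to polynomials acts on coefficients, but its value is a vector of polynomials
  rather than a polynomial with vector coefficients.
\<close>
definition embed_poly :: "nat \<Rightarrow> ('m \<Rightarrow> 'a::zero vec) \<Rightarrow> 'm::zero poly \<Rightarrow> 'a poly vec" where
  "embed_poly n \<iota> x = vec n (\<lambda>i. map_poly (\<lambda>y. \<iota> y $ i) x)"

definition project_poly ::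
  "('a::comm_ring_1 \<Rightarrow> 'm::ab_group_add \<Rightarrow> 'm) \<Rightarrow> nat \<Rightarrow> ('a vec \<Rightarrow> 'm) \<Rightarrow> 'a poly vec \<Rightarrow> 'm poly" where
  "project_poly s n \<pi> v = (\<Sum>i<n. map_poly (\<lambda>a. s a (\<pi> (unit_vec n i))) (v $ i))"

lemma free_retract_poly:
  fixes s :: "'a::comm_ring_1 \<Rightarrow> 'm::ab_group_add \<Rightarrow> 'm"
  assumes s: "Modules.module s" and r: "free_retract s UNIV n \<iota> \<pi>"
  shows "free_retract (poly_scale s) UNIV n (embed_poly n \<iota>) (project_poly s n \<pi>)"
    and "i < n \<Longrightarrow> coeff (embed_poly n \<iota> x $ i) l = \<iota> (coeff x l) $ i"
    and "coeff (project_poly s n \<pi> v) l = \<pi> (vec n (\<lambda>i. coeff (v $ i) l))"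
proof -
  let ?\<iota> = "embed_poly n \<iota>" and ?\<pi> = "project_poly s n \<pi>"
  interpret Modules.module s by fact
  note i = free_retractD(1)[OF r] and p = free_retractD(2)[OF r]
  note ii = lin_map_index[OF i]
  have ci: "coeff (?\<iota> x $ i) l = \<iota> (coeff x l) $ i" if "i < n" for i x l
    using that lin_map_0[OF ii[OF that]] by (simp add: embed_poly_def coeff_map_poly)
  have cp': "coeff (?\<pi> v) l = (\<Sum>i<n. s (coeff (v $ i) l) (\<pi> (unit_vec n i)))" for v l
    by (simp add: project_poly_def coeff_sum coeff_map_poly)
  then have cp: "coeff (?\<pi> v) l = \<pi> (vec n (\<lambda>i. coeff (v $ i) l))" for v l
    by (subst lin_map_vec_expand[OF s p]) auto
  have dim: "?\<iota> x \<in> carrier_vec n" for x by (simp add: embed_poly_def)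
  show "i < n \<Longrightarrow> coeff (?\<iota> x $ i) l = \<iota> (coeff x l) $ i" by (rule ci)
  show "coeff (?\<pi> v) l = \<pi> (vec n (\<lambda>i. coeff (v $ i) l))" by (rule cp)
  show "free_retract (poly_scale s) UNIV n ?\<iota> ?\<pi>"
    unfolding free_retract_def
  proof (intro conjI lin_mapI ballI)
    fix x y show "?\<iota> (x + y) = ?\<iota> x + ?\<iota> y"
    proof (rule eq_vecI)
      fix i assume "i < dim_vec (?\<iota> x + ?\<iota> y)"
      then have "i < n" using dim[of y] by simp
      then show "?\<iota> (x + y) $ i = (?\<iota> x + ?\<iota> y) $ i"
        using dim[of y] by (intro poly_eqI) (simp add: ci lin_mapD(2)[OF ii])
    qed (simp add: embed_poly_def)
  next
    fix q x show "?\<iota> (poly_scale s q x) = q \<cdot>\<^sub>v ?\<iota> x"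
    proof (rule eq_vecI)
      fix i assume "i < dim_vec (q \<cdot>\<^sub>v ?\<iota> x)"
      then have "i < n" using dim[of x] by simp
      then show "?\<iota> (poly_scale s q x) $ i = (q \<cdot>\<^sub>v ?\<iota> x) $ i"
        using dim[of x]
        by (intro poly_eqI) (simp add: ci coeff_poly_scale[OF s] coeff_mult lin_map_sum[OF ii] lin_mapD(3)[OF ii])
    qed (simp add: embed_poly_def)
  next
    fix v w :: "'a poly vec" assume "v \<in> carrier_vec n" "w \<in> carrier_vec n"
    then show "?\<pi> (v + w) = ?\<pi> v + ?\<pi> w"
      by (intro poly_eqI) (simp add: cp' scale_left_distrib sum.distrib)
  next
    fix q and v :: "'a poly vec" assume v: "v \<in> carrier_vec n"
    show "?\<pi> (q \<cdot>\<^sub>v v) = poly_scale s q (?\<pi> v)"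
    proof (rule poly_eqI)
      fix l
      have "coeff (?\<pi> (q \<cdot>\<^sub>v v)) l = (\<Sum>i<n. \<Sum>j\<le>l. s (coeff q j * coeff (v $ i) (l - j)) (\<pi> (unit_vec n i)))"
        using v by (simp add: cp' coeff_mult scale_sum_left)
      also have "\<dots> = (\<Sum>j\<le>l. s (coeff q j) (\<Sum>i<n. s (coeff (v $ i) (l - j)) (\<pi> (unit_vec n i))))"
        by (subst sum.swap) (simp add: scale_sum_right)
      finally show "coeff (?\<pi> (q \<cdot>\<^sub>v v)) l = coeff (poly_scale s q (?\<pi> v)) l"
        by (simp add: coeff_poly_scale[OF s] cp')
    qed
  next
    fix x show "?\<pi> (?\<iota> x) = x"
    proof (rule poly_eqI)
      fix l
      have "vec n (\<lambda>i. coeff (?\<iota> x $ i) l) = \<iota> (coeff x l)"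
        using lin_mapD(1)[OF i, of "coeff x l"] by (intro eq_vecI) (auto simp: ci)
      then show "coeff (?\<pi> (?\<iota> x)) l = coeff x l"
        by (simp add: cp free_retractD(3)[OF r])
    qed
  qed (use dim in auto)
qed

lemma lin_map_id_plus_Z:
  fixes s :: "'a::comm_ring_1 \<Rightarrow> 'm::ab_group_add \<Rightarrow> 'm"
  assumes s: "Modules.module s" and w: "lin_map s UNIV s UNIV w"
  shows "lin_map (poly_scale s) UNIV (poly_scale s) UNIV (\<lambda>x. id_plus_Z s w x - x)"
    and "coeff (id_plus_Z s w x - x) l = (case l of 0 \<Rightarrow> 0 | Suc l' \<Rightarrow> w (coeff x l'))"
proof -
  interpret Modules.module s by fact
  show cf: "coeff (id_plus_Z s w x - x) l = (case l of 0 \<Rightarrow> 0 | Suc l' \<Rightarrow> w (coeff x l'))" for x l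
    by (simp add: id_plus_Z_def coeff_poly_scale_Z[OF s, unfolded One_nat_def] coeff_map_poly lin_map_0[OF w] split: nat.split)
  show "lin_map (poly_scale s) UNIV (poly_scale s) UNIV (\<lambda>x. id_plus_Z s w x - x)"
  proof (rule lin_mapI)
    fix x y show "id_plus_Z s w (x + y) - (x + y) = id_plus_Z s w x - x + (id_plus_Z s w y - y)"
      by (rule poly_eqI) (simp add: cf lin_mapD(2)[OF w] del: coeff_diff split: nat.split)
  next
    fix q x
    show "id_plus_Z s w (poly_scale s q x) - poly_scale s q x = poly_scale s q (id_plus_Z s w x - x)"
    proof (rule poly_eqI)
      fix l show "coeff (id_plus_Z s w (poly_scale s q x) - poly_scale s q x) l =
          coeff (poly_scale s q (id_plus_Z s w x - x)) l"
        by (cases l) (simp_all add: cf coeff_poly_scale[OF s] lin_map_sum[OF w] lin_mapD(3)[OF w] Suc_diff_le del: coeff_diff)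
    qed
  qed simp
qed

lemma char_P_eq_fredholm:
  fixes s :: "'a::comm_ring_1 \<Rightarrow> 'm::ab_group_add \<Rightarrow> 'm"
  assumes s: "Modules.module s" and r: "free_retract s UNIV n \<iota> \<pi>"
    and w: "lin_map s UNIV s UNIV (\<phi> \<circ> \<phi>')"
  shows "char_P s \<phi> \<phi>' = fredholm (lmat n n (\<iota> \<circ> (\<phi> \<circ> \<phi>' \<circ> \<pi>)))"
proof -
  interpret Modules.module s by fact
  note R = free_retract_poly[OF s r]
  let ?\<iota> = "embed_poly n \<iota>" and ?\<pi> = "project_poly s n \<pi>"
  let ?w = "\<phi> \<circ> \<phi>'"
  have p0: "\<pi> (0\<^sub>v n) = 0"
    using lin_mapD(2)[OF free_retractD(2)[OF r], of "0\<^sub>v n" "0\<^sub>v n"] by simp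
  have "lmat n n (\<lambda>v. ?\<iota> (id_plus_Z s ?w (?\<pi> v) - ?\<pi> v)) =
      monom 1 1 \<cdot>\<^sub>m const_mat (lmat n n (\<iota> \<circ> (?w \<circ> \<pi>)))"
  proof (rule eq_matI)
    fix i j
    assume "i < dim_row (monom 1 1 \<cdot>\<^sub>m const_mat (lmat n n (\<iota> \<circ> (?w \<circ> \<pi>))))"
      and "j < dim_col (monom 1 1 \<cdot>\<^sub>m const_mat (lmat n n (\<iota> \<circ> (?w \<circ> \<pi>))))"
    then have ij: "i < n" "j < n" by (auto simp: lmat_def)
    have proj: "coeff (?\<pi> (unit_vec n j)) l = (if l = 0 then \<pi> (unit_vec n j) else 0)" for l
    proof -
      have "vec n (\<lambda>i. coeff (unit_vec n j $ i) l) = (if l = 0 then unit_vec n j else 0\<^sub>v n :: 'a vec)"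
        using ij by (intro eq_vecI) (auto simp: unit_vec_def)
      then show ?thesis by (simp add: R(3) p0)
    qed
    have "coeff (?\<iota> (id_plus_Z s ?w (?\<pi> (unit_vec n j)) - ?\<pi> (unit_vec n j)) $ i) l =
        coeff (monom 1 1 * [:\<iota> (?w (\<pi> (unit_vec n j))) $ i:]) l" for l
      using ij lin_map_0[OF lin_map_index[OF free_retractD(1)[OF r] ij(1)]] lin_map_0[OF w]
      by (auto simp: R(2) lin_map_id_plus_Z(2)[OF s w] proj coeff_monom_mult coeff_pCons
          simp del: coeff_diff split: nat.split)
    then show "lmat n n (\<lambda>v. ?\<iota> (id_plus_Z s ?w (?\<pi> v) - ?\<pi> v)) $$ (i, j) =
        (monom 1 1 \<cdot>\<^sub>m const_mat (lmat n n (\<iota> \<circ> (?w \<circ> \<pi>)))) $$ (i, j)"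
      using ij by (intro poly_eqI) (simp add: lmat_def)
  qed (auto simp: lmat_def)
  then show ?thesis
    unfolding char_P_def fredholm_def one_plus_Z_def
    by (subst det_fgp_eq[OF R(1) lin_map_id_plus_Z(1)[OF s w]]) (simp add: lmat_def)
qed

section \<open>Determinantal ideals and the map of condition 3 in matrix form\<close>

lemma rank_le_iff_minors_vanish:
  fixes sE :: "'a::comm_ring_1 \<Rightarrow> 'e::ab_group_add \<Rightarrow> 'e" and sF :: "'a \<Rightarrow> 'f::ab_group_add \<Rightarrow> 'f"
  assumes rE: "free_retract sE UNIV n \<iota>E \<pi>E" and rF: "free_retract sF UNIV m \<iota>F \<pi>F"
    and f: "lin_map sE UNIV sF UNIV f"
  shows "rank_le sE sF k f \<longleftrightarrow> minors_vanish k (lmat m n (\<iota>F \<circ> (f \<circ> \<pi>E)))"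
proof -
  interpret R: Modules.module "(*) :: 'a \<Rightarrow> 'a \<Rightarrow> 'a" by (rule module_ring)
  note iE = free_retractD(1)[OF rE] and pE = free_retractD(2)[OF rE]
    and iF = free_retractD(1)[OF rF] and pF = free_retractD(2)[OF rF]
  let ?s = "k + 1" and ?B = "lmat m n (\<iota>F \<circ> (f \<circ> \<pi>E))"
  let ?D = "{det (endo_mat ?s (l \<circ> f \<circ> h)) | l h.
    lin_map sF UNIV (\<cdot>\<^sub>v) (carrier_vec ?s) l \<and> lin_map (\<cdot>\<^sub>v) (carrier_vec ?s) sE UNIV h}"
  have B: "lin_map (\<cdot>\<^sub>v) (carrier_vec n) (\<cdot>\<^sub>v) (carrier_vec m) (\<iota>F \<circ> (f \<circ> \<pi>E))"
    by (intro lin_map_comp[OF iF] lin_map_comp[OF f] pE)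
  have "rank_le sE sF k f \<longleftrightarrow> R.span ?D = {0}"
    by (simp add: rank_le_def det_ideal_def)
  also have "\<dots> \<longleftrightarrow> ?D \<subseteq> {0}"
    using R.span_superset[of ?D] R.span_minimal[of ?D "{0}"] R.subspace_single_0 R.span_zero[of ?D]
      by blast
  also have "\<dots> \<longleftrightarrow> minors_vanish k ?B"
  proof
    assume D: "?D \<subseteq> {0}"
    show "minors_vanish k ?B"
      unfolding minors_vanish_def
    proof (intro ballI)
      fix L H :: "'a mat" assume "L \<in> carrier_mat ?s (dim_row ?B)" and "H \<in> carrier_mat (dim_col ?B) ?s"
      then have L: "L \<in> carrier_mat ?s m" and H: "H \<in> carrier_mat n ?s" by (auto simp: lmat_def)
      note l = lin_map_mult_mat_vec[OF L] and h = lin_map_mult_mat_vec[OF H]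
      have "L * ?B * H = lmat ?s m ((*\<^sub>v) L) * ?B * lmat n ?s ((*\<^sub>v) H)"
        using L H by (simp only: lmat_mult_mat_vec)
      also have "\<dots> = lmat ?s ?s (((*\<^sub>v) L \<circ> (\<iota>F \<circ> (f \<circ> \<pi>E))) \<circ> (*\<^sub>v) H)"
        by (simp only: lmat_comp[OF l B] lmat_comp[OF lin_map_comp[OF l B] h])
      also have "\<dots> = endo_mat ?s (((*\<^sub>v) L \<circ> \<iota>F) \<circ> f \<circ> (\<pi>E \<circ> (*\<^sub>v) H))"
        by (simp add: endo_mat_lmat o_assoc)
      finally have eq: "L * ?B * H = endo_mat ?s (((*\<^sub>v) L \<circ> \<iota>F) \<circ> f \<circ> (\<pi>E \<circ> (*\<^sub>v) H))" .
      have "det (L * ?B * H) \<in> ?D"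
        unfolding eq
        by (intro CollectI exI conjI) (rule refl, rule lin_map_comp[OF l iF], rule lin_map_comp[OF pE h])
      then show "det (L * ?B * H) = 0" using D by auto
    qed
  next
    assume mv: "minors_vanish k ?B"
    show "?D \<subseteq> {0}"
    proof
      fix d assume "d \<in> ?D"
      then obtain l h where d: "d = det (endo_mat ?s (l \<circ> f \<circ> h))"
        and l: "lin_map sF UNIV (\<cdot>\<^sub>v) (carrier_vec ?s) l" and h: "lin_map (\<cdot>\<^sub>v) (carrier_vec ?s) sE UNIV h"
        by blast
      let ?L = "lmat ?s m (l \<circ> \<pi>F)" and ?H = "lmat n ?s (\<iota>E \<circ> h)"
      note lp = lin_map_comp[OF l pF] and ih = lin_map_comp[OF iE h]
      have "?L * ?B * ?H = lmat ?s ?s ((l \<circ> \<pi>F) \<circ> (\<iota>F \<circ> (f \<circ> \<pi>E)) \<circ> (\<iota>E \<circ> h))"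
        by (simp only: lmat_comp[OF lp B] lmat_comp[OF lin_map_comp[OF lp B] ih])
      also have "(l \<circ> \<pi>F) \<circ> (\<iota>F \<circ> (f \<circ> \<pi>E)) \<circ> (\<iota>E \<circ> h) = l \<circ> f \<circ> h"
        using free_retractD(3)[OF rE] free_retractD(3)[OF rF] by (simp add: fun_eq_iff)
      finally have "?L * ?B * ?H = lmat ?s ?s (l \<circ> f \<circ> h)" .
      then have "d = det (?L * ?B * ?H)" by (simp only: d endo_mat_lmat)
      then show "d \<in> {0}"
        using mv unfolding minors_vanish_def by (simp add: lmat_def)
    qed
  qed
  finally show ?thesis .
qed

text \<open>
  With \<open>w = \<phi> \<phi>'\<close>, this is \<open>\<theta>\<close> before its outermost \<open>\<phi>'\<close> is applied; unlike \<open>\<theta>\<close> it satisfies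
  a recurrence, the one of \<open>adj_coeff\<close>.
\<close>
definition horner_map ::
  "('a::comm_ring_1 \<Rightarrow> 'm::ab_group_add \<Rightarrow> 'm) \<Rightarrow> (nat \<Rightarrow> 'a) \<Rightarrow> ('m \<Rightarrow> 'm) \<Rightarrow> nat \<Rightarrow> 'm \<Rightarrow> 'm" where
  "horner_map s a w k y = (\<Sum>i<k. s ((-1) ^ i * a (k - 1 - i)) ((w ^^ i) y))"

lemma horner_map_0 [simp]: "horner_map s a w 0 y = 0"
  by (simp add: horner_map_def)

lemma horner_map_Suc:
  assumes s: "Modules.module s" and w: "lin_map s UNIV s UNIV w"
  shows "horner_map s a w (Suc k) y = s (a k) y - w (horner_map s a w k y)"
proof -
  interpret Modules.module s by fact
  have "horner_map s a w (Suc k) y =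
      s (a k) y + (\<Sum>i<k. s ((-1) ^ Suc i * a (k - Suc i)) (w ((w ^^ i) y)))"
    by (simp only: horner_map_def sum.lessThan_Suc_shift) simp
  also have "(\<Sum>i<k. s ((-1) ^ Suc i * a (k - Suc i)) (w ((w ^^ i) y))) = - w (horner_map s a w k y)"
    by (simp add: horner_map_def lin_map_sum[OF w] lin_mapD(3)[OF w] sum_negf)
  finally show ?thesis by simp
qed

lemma lin_map_horner_map:
  assumes s: "Modules.module s" and w: "lin_map s UNIV s UNIV w"
  shows "lin_map s UNIV s UNIV (horner_map s a w k)"
proof (induction k)
  case 0
  interpret Modules.module s by fact
  show ?case by (intro lin_mapI) auto
next
  case (Suc k)
  interpret Modules.module s by fact
  note h = lin_mapD[OF Suc] and w' = lin_mapD[OF w]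
  show ?case
    by (intro lin_mapI)
      (simp_all add: horner_map_Suc[OF s w] h w' algebra_simps scale_right_diff_distrib)
qed

lemma theta_map_eq:
  assumes f: "lin_map sF UNIV sE UNIV \<phi>'"
  shows "theta_map sE a k \<phi> \<phi>' y = \<phi>' (horner_map sF a (\<phi> \<circ> \<phi>') k y)"
  by (simp add: theta_map_def horner_map_def lin_map_sum[OF f] lin_mapD(3)[OF f])

lemma lmat_smult_minus:
  assumes "\<And>v. f v \<in> carrier_vec m" and "\<And>v. g v \<in> carrier_vec m"
  shows "lmat m n (\<lambda>v. c \<cdot>\<^sub>v f v - g v) = c \<cdot>\<^sub>m lmat m n f - lmat m n g"
proof -
  have "dim_vec (f v) = m" "dim_vec (g v) = m" for v
    using carrier_vecD[OF assms(1)] carrier_vecD[OF assms(2)] by simp_all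
  then show ?thesis by (intro eq_matI) (auto simp: lmat_def)
qed

lemma lin_map_vec_diff:
  fixes s :: "'a::comm_ring_1 \<Rightarrow> 'm::ab_group_add \<Rightarrow> 'm"
  assumes i: "lin_map s UNIV (\<cdot>\<^sub>v) (carrier_vec m) \<iota>"
  shows "\<iota> (x - y) = \<iota> x - \<iota> y"
proof (rule eq_vecI)
  have d: "dim_vec (\<iota> z) = m" for z
    using lin_mapD(1)[OF i, of z] by simp
  fix j assume "j < dim_vec (\<iota> x - \<iota> y)"
  then have "j < m" by (simp add: d)
  then show "\<iota> (x - y) $ j = (\<iota> x - \<iota> y) $ j"
    using lin_map_diff[OF lin_map_index[OF i \<open>j < m\<close>]] by (simp add: d)
qed (simp add: carrier_vecD[OF lin_mapD(1)[OF i UNIV_I]])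

text \<open>
  The coefficients of the adjugate act on the free module, the maps \<open>horner_map\<close> on the retract.
  They do not correspond on the nose, since \<open>N 0 = 1\<close> is not \<open>\<iota> \<pi>\<close>, but they do after
  multiplication by a matrix that factors through the retract.
\<close>
lemma adj_coeff_mult_lmat:
  fixes s :: "'a::comm_ring_1 \<Rightarrow> 'm::ab_group_add \<Rightarrow> 'm"
  assumes s: "Modules.module s" and r: "free_retract s UNIV m \<iota> \<pi>" and w: "lin_map s UNIV s UNIV w"
    and f: "lin_map (\<cdot>\<^sub>v) (carrier_vec n) s UNIV f"
  defines "M \<equiv> lmat m m (\<iota> \<circ> (w \<circ> \<pi>))"
  shows "adj_coeff M j * lmat m n (\<iota> \<circ> f) =
    lmat m n (\<iota> \<circ> (horner_map s (coeff (fredholm M)) w (Suc j) \<circ> f))"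
proof (induction j)
  case 0
  interpret Modules.module s by fact
  have "coeff (fredholm M) 0 = 1" unfolding M_def by (rule coeff_0_fredholm[OF lmat_carrier])
  then have "horner_map s (coeff (fredholm M)) w (Suc 0) = id"
    by (simp add: fun_eq_iff horner_map_def)
  then show ?case by (simp add: M_def left_mult_one_mat[of _ m n] lmat_def)
next
  case (Suc j)
  let ?h = "horner_map s (coeff (fredholm M)) w (Suc j)" and ?a = "coeff (fredholm M) (Suc j)"
  note i = free_retractD(1)[OF r] and p = free_retractD(2)[OF r]
  have M: "M \<in> carrier_mat m m" and F: "lmat m n (\<iota> \<circ> f) \<in> carrier_mat m n"
    by (simp_all add: M_def)
  note N = adj_coeff_carrier[OF M, of j]
  have hf: "lin_map (\<cdot>\<^sub>v) (carrier_vec n) s UNIV (?h \<circ> f)"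
    by (rule lin_map_comp[OF lin_map_horner_map[OF s w] f])
  have "adj_coeff M (Suc j) * lmat m n (\<iota> \<circ> f) = ?a \<cdot>\<^sub>m lmat m n (\<iota> \<circ> f) - M * (adj_coeff M j * lmat m n (\<iota> \<circ> f))"
    using M N F
      by (simp add: minus_mult_distrib_mat[of _ m m _ _ n] mult_smult_assoc_mat[of _ m m _ n] left_mult_one_mat[OF F]
        assoc_mult_mat[of _ m m _ m _ n])
  also have "M * (adj_coeff M j * lmat m n (\<iota> \<circ> f)) = lmat m n ((\<iota> \<circ> (w \<circ> \<pi>)) \<circ> (\<iota> \<circ> (?h \<circ> f)))"
    unfolding Suc unfolding M_def
    by (rule lmat_comp[symmetric, OF lin_map_comp[OF i lin_map_comp[OF w p]] lin_map_comp[OF i hf[unfolded M_def]]])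
  also have "(\<iota> \<circ> (w \<circ> \<pi>)) \<circ> (\<iota> \<circ> (?h \<circ> f)) = \<iota> \<circ> (w \<circ> (?h \<circ> f))"
    by (simp add: fun_eq_iff free_retractD(3)[OF r])
  also have "?a \<cdot>\<^sub>m lmat m n (\<iota> \<circ> f) - lmat m n (\<iota> \<circ> (w \<circ> (?h \<circ> f))) =
      lmat m n (\<lambda>v. ?a \<cdot>\<^sub>v (\<iota> \<circ> f) v - (\<iota> \<circ> (w \<circ> (?h \<circ> f))) v)"
    by (rule lmat_smult_minus[symmetric]) (use lin_mapD(1)[OF i] in auto)
  also have "(\<lambda>v. ?a \<cdot>\<^sub>v (\<iota> \<circ> f) v - (\<iota> \<circ> (w \<circ> (?h \<circ> f))) v) =
      \<iota> \<circ> (horner_map s (coeff (fredholm M)) w (Suc (Suc j)) \<circ> f)"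
    by (simp add: fun_eq_iff horner_map_Suc[OF s w, of _ "Suc j"] lin_map_vec_diff[OF i] lin_mapD(3)[OF i])
  finally show ?case .
qed

lemma lmat_mult_adj_coeff:
  fixes s :: "'a::comm_ring_1 \<Rightarrow> 'm::ab_group_add \<Rightarrow> 'm"
  assumes s: "Modules.module s" and r: "free_retract s UNIV m \<iota> \<pi>" and w: "lin_map s UNIV s UNIV w"
    and g: "lin_map s UNIV (\<cdot>\<^sub>v) (carrier_vec n) g"
  defines "M \<equiv> lmat m m (\<iota> \<circ> (w \<circ> \<pi>))"
  shows "lmat n m (g \<circ> \<pi>) * adj_coeff M j =
    lmat n m (g \<circ> (horner_map s (coeff (fredholm M)) w (Suc j) \<circ> \<pi>))"
  using g
proof (induction j arbitrary: g)
  case 0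
  interpret Modules.module s by fact
  have "coeff (fredholm M) 0 = 1" unfolding M_def by (rule coeff_0_fredholm[OF lmat_carrier])
  then have "horner_map s (coeff (fredholm M)) w (Suc 0) = id"
    by (simp add: fun_eq_iff horner_map_def)
  then show ?case by (simp add: M_def right_mult_one_mat[of _ n m] lmat_def)
next
  case (Suc j)
  let ?h = "horner_map s (coeff (fredholm M)) w (Suc j)" and ?a = "coeff (fredholm M) (Suc j)"
  note i = free_retractD(1)[OF r] and p = free_retractD(2)[OF r]
  have M: "M \<in> carrier_mat m m" and G: "lmat n m (g \<circ> \<pi>) \<in> carrier_mat n m"
    by (simp_all add: M_def)
  note N = adj_coeff_carrier[OF M, of j]
  have gw: "lin_map s UNIV (\<cdot>\<^sub>v) (carrier_vec n) (g \<circ> w)"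
    by (rule lin_map_comp[OF Suc.prems w])
  have "lmat n m (g \<circ> \<pi>) * adj_coeff M (Suc j) = ?a \<cdot>\<^sub>m lmat n m (g \<circ> \<pi>) - lmat n m (g \<circ> \<pi>) * M * adj_coeff M j"
    using M N G
      by (simp add: mult_minus_distrib_mat[of _ n m _ m] mult_smult_distrib[of _ n m _ m] right_mult_one_mat[OF G] assoc_mult_mat[of _ n m _ m _ m])
  also have "lmat n m (g \<circ> \<pi>) * M = lmat n m ((g \<circ> \<pi>) \<circ> (\<iota> \<circ> (w \<circ> \<pi>)))"
    unfolding M_def
    by (rule lmat_comp[symmetric, OF lin_map_comp[OF Suc.prems p] lin_map_comp[OF i lin_map_comp[OF w p]]])
  also have "(g \<circ> \<pi>) \<circ> (\<iota> \<circ> (w \<circ> \<pi>)) = (g \<circ> w) \<circ> \<pi>"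
    by (simp add: fun_eq_iff free_retractD(3)[OF r])
  also have "lmat n m ((g \<circ> w) \<circ> \<pi>) * adj_coeff M j = lmat n m ((g \<circ> w) \<circ> (?h \<circ> \<pi>))"
    by (rule Suc.IH[OF gw])
  also have "?a \<cdot>\<^sub>m lmat n m (g \<circ> \<pi>) - lmat n m ((g \<circ> w) \<circ> (?h \<circ> \<pi>)) =
      lmat n m (\<lambda>v. ?a \<cdot>\<^sub>v (g \<circ> \<pi>) v - ((g \<circ> w) \<circ> (?h \<circ> \<pi>)) v)"
    by (rule lmat_smult_minus[symmetric]) (use lin_mapD(1)[OF Suc.prems] in auto)
  also have "(\<lambda>v. ?a \<cdot>\<^sub>v (g \<circ> \<pi>) v - ((g \<circ> w) \<circ> (?h \<circ> \<pi>)) v) =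
      g \<circ> (horner_map s (coeff (fredholm M)) w (Suc (Suc j)) \<circ> \<pi>)"
    by (simp add: fun_eq_iff horner_map_Suc[OF s w, of _ "Suc j"] lin_map_vec_diff[OF Suc.prems] lin_mapD(3)[OF Suc.prems])
  finally show ?case .
qed

lemma lmat_eq_0_iff:
  fixes sE :: "'a::comm_ring_1 \<Rightarrow> 'e::ab_group_add \<Rightarrow> 'e" and sF :: "'a \<Rightarrow> 'f::ab_group_add \<Rightarrow> 'f"
  assumes rE: "free_retract sE UNIV n \<iota>E \<pi>E" and rF: "free_retract sF UNIV m \<iota>F \<pi>F"
    and f: "lin_map sE UNIV sF UNIV f"
  shows "lmat m n (\<iota>F \<circ> (f \<circ> \<pi>E)) = 0\<^sub>m m n \<longleftrightarrow> (\<forall>x. f x = 0)"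
proof -
  note iE = free_retractD(1)[OF rE] and pE = free_retractD(2)[OF rE]
    and iF = free_retractD(1)[OF rF] and pF = free_retractD(2)[OF rF]
  have i0: "\<iota>F 0 = 0\<^sub>v m"
    using lin_map_0[OF lin_map_index[OF iF]] lin_mapD(1)[OF iF, of 0] by (intro eq_vecI) auto
  have p0: "\<pi>F (0\<^sub>v m) = 0"
    using free_retractD(3)[OF rF, of 0] by (simp add: i0)
  have lin: "lin_map (\<cdot>\<^sub>v) (carrier_vec n) (\<cdot>\<^sub>v) (carrier_vec m) (\<iota>F \<circ> (f \<circ> \<pi>E))"
    by (intro lin_map_comp[OF iF] lin_map_comp[OF f] pE)
  show ?thesis
  proof
    assume zero: "lmat m n (\<iota>F \<circ> (f \<circ> \<pi>E)) = 0\<^sub>m m n"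
    show "\<forall>x. f x = 0"
    proof
      fix x
      have x: "\<iota>E x \<in> carrier_vec n" by (rule lin_mapD(1)[OF iE]) simp
      have "0\<^sub>m m n *\<^sub>v \<iota>E x = 0\<^sub>v m"
        using x by (intro eq_vecI) auto
      then have "\<iota>F (f x) = 0\<^sub>v m"
        using lmat_mult_vec[OF lin x] by (simp add: zero free_retractD(3)[OF rE])
      then have "\<pi>F (\<iota>F (f x)) = 0" by (simp add: p0)
      then show "f x = 0" by (simp add: free_retractD(3)[OF rF])
    qed
  next
    assume "\<forall>x. f x = 0"
    then show "lmat m n (\<iota>F \<circ> (f \<circ> \<pi>E)) = 0\<^sub>m m n"
      by (intro eq_matI) (auto simp: lmat_def i0)
  qed
qed

section \<open>Local bases and localizations\<close>

lemma prime_ideal_prod_notin: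
  assumes p: "prime_ideal p" and "\<And>i. i \<in> A \<Longrightarrow> f i \<notin> p"
  shows "prod f A \<notin> p"
  using assms(2)
  by (induction A rule: infinite_finite_induct) (auto simp: prime_ideal_compl[OF p])

lemma prime_ideal_power_notin:
  assumes p: "prime_ideal p" and "u \<notin> p"
  shows "u ^ n \<notin> p"
  using assms(2) by (induction n) (auto simp: prime_ideal_compl[OF p])

lemma prime_ideal_dvd_notin:
  fixes p :: "'a::comm_ring_1 set"
  assumes p: "prime_ideal p" and "b \<notin> p" and "a dvd b"
  shows "a \<notin> p"
proof
  interpret R: Modules.module "(*) :: 'a \<Rightarrow> 'a \<Rightarrow> 'a" by (rule module_ring)
  assume "a \<in> p"
  then have "c * a \<in> p" for c
    using R.subspace_scale p unfolding prime_ideal_def by blast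
  then show False using assms(2,3) by (metis dvdE mult.commute)
qed

locale localized_module = Modules.module s
  for s :: "'a::comm_ring_1 \<Rightarrow> 'm::ab_group_add \<Rightarrow> 'm" +
  fixes M :: "'m set" and p :: "'a set"
  assumes M: "subspace M" and p: "prime_ideal p"
begin

abbreviation frac :: "'m \<Rightarrow> 'a \<Rightarrow> ('m \<times> 'a) set" where
  "frac x u \<equiv> frac_rel s M p `` {(x, u)}"

lemma module_axiom: "Modules.module s" by unfold_locales

lemmas p1 = prime_ideal_compl(1)[OF p] and pmult = prime_ideal_compl(2)[OF p]

lemma frac_eq_iff:
  assumes "x \<in> M" "y \<in> M" "u \<notin> p" "v \<notin> p"
  shows "frac x u = frac y v \<longleftrightarrow> (\<exists>w. w \<notin> p \<and> s w (s v x - s u y) = 0)"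
proof -
  have "frac x u = frac y v \<longleftrightarrow> ((x, u), (y, v)) \<in> frac_rel s M p"
    using assms by (intro eq_equiv_class_iff[OF equiv_frac_rel[OF module_axiom p]]) auto
  then show ?thesis using assms by (simp add: frac_rel_def)
qed

lemma frac_in: "x \<in> M \<Longrightarrow> u \<notin> p \<Longrightarrow> frac x u \<in> localization s M p"
  unfolding localization_def by (intro quotientI) auto

lemma frac_cases:
  assumes "X \<in> localization s M p"
  obtains x u where "x \<in> M" "u \<notin> p" "X = frac x u"
  using assms unfolding localization_def by (elim quotientE) auto

lemma frac_cancel:
  assumes "x \<in> M" "u \<notin> p" "c \<notin> p"
  shows "frac (s c x) (c * u) = frac x u"
proof -
  have "s 1 (s u (s c x) - s (c * u) x) = 0"
    by (simp add: mult.commute)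
  then show ?thesis
    using assms M p1 pmult by (subst frac_eq_iff) (auto intro: subspace_scale)
qed

lemma frac_add:
  assumes "x \<in> M" "u \<notin> p" "y \<in> M" "v \<notin> p"
  shows "loc_add s M p (frac x u) (frac y v) = frac (s v x + s u y) (u * v)"
  using loc_add_frac[OF module_axiom M p assms] .

lemma common_denominator:
  fixes k :: nat
  assumes "\<And>i. i < k \<Longrightarrow> X i \<in> localization s M p"
  shows "\<exists>x T. T \<notin> p \<and> (\<forall>i<k. x i \<in> M \<and> X i = frac (x i) T)"
proof -
  have "\<forall>i. \<exists>xu. i < k \<longrightarrow> fst xu \<in> M \<and> snd xu \<notin> p \<and> X i = frac (fst xu) (snd xu)"
    using assms by (metis frac_cases fst_conv snd_conv)
  then obtain g where g: "\<And>i. i < k \<Longrightarrow> fst (g i) \<in> M \<and> snd (g i) \<notin> p \<and> X i = frac (fst (g i)) (snd (g i))"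
    by metis
  define T where "T = (\<Prod>i<k. snd (g i))"
  define c where "c = (\<lambda>i. \<Prod>j\<in>{..<k} - {i}. snd (g j))"
  have T: "T \<notin> p"
    unfolding T_def using g by (intro prime_ideal_prod_notin[OF p]) auto
  have c: "c i \<notin> p" if "i < k" for i
    unfolding c_def using g by (intro prime_ideal_prod_notin[OF p]) auto
  have "T = c i * snd (g i)" if "i < k" for i
    unfolding T_def c_def using that by (subst prod.remove[of "{..<k}" i]) (auto simp: mult.commute)
  then have "X i = frac (s (c i) (fst (g i))) T" if "i < k" for i
    using g[OF that] c[OF that] that by (simp add: frac_cancel)
  moreover have "s (c i) (fst (g i)) \<in> M" if "i < k" for i
    using g[OF that] M by (auto intro: subspace_scale)
  ultimately show ?thesis using T
    by (intro exI[of _ "\<lambda>i. s (c i) (fst (g i))"] exI[of _ T]) auto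
qed

end

lemma localized_ring:
  assumes "prime_ideal (p :: 'a::comm_ring_1 set)"
  shows "localized_module ((*) :: 'a \<Rightarrow> 'a \<Rightarrow> 'a) UNIV p"
proof -
  interpret R: Modules.module "(*) :: 'a \<Rightarrow> 'a \<Rightarrow> 'a" by (rule module_ring)
  show ?thesis by unfold_locales (use assms in auto)
qed

text \<open>
  A basis of the localization at \<open>p\<close> given
    by numerators in \<open>M\<close>, expressed without fractions.
\<close>
definition local_basis ::
  "('a::comm_ring_1 \<Rightarrow> 'm::ab_group_add \<Rightarrow> 'm) \<Rightarrow> 'm set \<Rightarrow> nat \<Rightarrow> 'a set \<Rightarrow> (nat \<Rightarrow> 'm) \<Rightarrow> bool" where
  "local_basis s M k p x \<longleftrightarrow>
     (\<forall>i<k. x i \<in> M) \<and>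
     (\<forall>y\<in>M. \<exists>w b. w \<notin> p \<and> s w y = (\<Sum>i<k. s (b i) (x i))) \<and>
     (\<forall>b. (\<Sum>i<k. s (b i) (x i)) = 0 \<longrightarrow> (\<exists>w. w \<notin> p \<and> (\<forall>i<k. w * b i = 0)))"

context localized_module
begin

interpretation R: localized_module "(*) :: 'a \<Rightarrow> 'a \<Rightarrow> 'a" UNIV p
  by (rule localized_ring[OF p])

lemma loc_scale_frac':
  assumes "t \<notin> p" "x \<in> M" "u \<notin> p"
  shows "loc_scale s M p (R.frac a t) (frac x u) = frac (s a x) (t * u)"
  using loc_scale_frac[OF module_axiom M p assms] .

lemma ring_scale_frac:
  assumes "t \<notin> p" "u \<notin> p"
  shows "loc_ring_mult p (R.frac a t) (R.frac b u) = R.frac (a * b) (t * u)"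
  by (rule loc_scale_frac[OF R.module_axiom R.M p assms(1) UNIV_I assms(2)])

lemma ring_add_frac:
  assumes "t \<notin> p" "u \<notin> p"
  shows "loc_ring_add p (R.frac a t) (R.frac b u) = R.frac (u * a + t * b) (t * u)"
  by (rule R.frac_add) (use assms in auto)

lemma ring_frac_cancel: "u \<notin> p \<Longrightarrow> c \<notin> p \<Longrightarrow> R.frac (c * a) (c * u) = R.frac a u"
  by (rule R.frac_cancel) auto

lemma comb_in: "(\<And>i. i < k \<Longrightarrow> x i \<in> M) \<Longrightarrow> (\<Sum>i<k. s (b i) (x i)) \<in> M"
  using M by (auto intro!: subspace_sum subspace_scale)

text \<open>
  From right to left this makes the map from tuples of fractions to fractions in \<open>M\<close> well defined,
  from left to right it makes it injective.
\<close>
lemma comb_eq_iff: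
  assumes bas: "local_basis s M k p x" and T: "T \<notin> p" "T' \<notin> p"
  shows "frac (\<Sum>i<k. s (b i) (x i)) T = frac (\<Sum>i<k. s (b' i) (x i)) T' \<longleftrightarrow>
    (\<forall>i<k. R.frac (b i) T = R.frac (b' i) T')" (is "?l \<longleftrightarrow> ?r")
proof -
  have x: "\<And>i. i < k \<Longrightarrow> x i \<in> M" using bas by (simp add: local_basis_def)
  have diff: "s w (s T' (\<Sum>i<k. s (b i) (x i)) - s T (\<Sum>i<k. s (b' i) (x i))) =
      (\<Sum>i<k. s (w * (T' * b i - T * b' i)) (x i))" for w
    by (simp add: scale_right_diff_distrib scale_left_diff_distrib right_diff_distrib scale_sum_right sum_subtractf)
  show ?thesis
  proof
    assume ?l
    then obtain w where w: "w \<notin> p" "(\<Sum>i<k. s (w * (T' * b i - T * b' i)) (x i)) = 0"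
      using frac_eq_iff[OF comb_in[of k x, OF x] comb_in[of k x, OF x] T] by (auto simp: diff)
    have indep: "\<And>b. (\<Sum>i<k. s (b i) (x i)) = 0 \<Longrightarrow> \<exists>w. w \<notin> p \<and> (\<forall>i<k. w * b i = 0)"
      using bas by (simp add: local_basis_def)
    obtain w' where w': "w' \<notin> p" "\<forall>i<k. w' * (w * (T' * b i - T * b' i)) = 0"
      using indep[OF w(2)] by blast
    have W: "w' * w \<notin> p" using w(1) w'(1) by (rule pmult[rotated])
    show ?r
    proof (intro allI impI)
      fix i assume "i < k"
      then have "(w' * w) * (T' * b i - T * b' i) = 0"
        using w'(2) by (simp only: mult.assoc)
      then show "R.frac (b i) T = R.frac (b' i) T'"
        using R.frac_eq_iff[OF UNIV_I UNIV_I T] W by blast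
    qed
  next
    assume ?r
    then have "\<forall>i. \<exists>w. i < k \<longrightarrow> w \<notin> p \<and> w * (T' * b i - T * b' i) = 0"
      using R.frac_eq_iff[OF UNIV_I UNIV_I T] by blast
    from choice[OF this] obtain w where w: "\<And>i. i < k \<Longrightarrow> w i \<notin> p \<and> w i * (T' * b i - T * b' i) = 0"
      by blast
    define W where "W = (\<Prod>i<k. w i)"
    have "W \<notin> p" unfolding W_def using w by (intro prime_ideal_prod_notin[OF p]) auto
    moreover have "W * (T' * b i - T * b' i) = 0" if "i < k" for i
    proof -
      have "W = (\<Prod>j\<in>{..<k} - {i}. w j) * w i"
        unfolding W_def using that by (subst prod.remove[of "{..<k}" i]) (auto simp: mult.commute)
      then show ?thesis using w[OF that] by (simp add: mult.assoc)
    qed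
    ultimately show ?l
      using frac_eq_iff[OF comb_in[of k x, OF x] comb_in[of k x, OF x] T] by (auto simp: diff)
  qed
qed

lemma local_basis_imp_free:
  assumes bas: "local_basis s M k p x"
  shows "free_of_rank_at s M k p"
proof -
  have x: "\<And>i. i < k \<Longrightarrow> x i \<in> M" using bas by (simp add: local_basis_def)
  let ?C = "{..<k} \<rightarrow>\<^sub>E loc_ring p"
  let ?comb = "\<lambda>b. \<Sum>i<k. s (b i) (x i)"
  define f where "f = (\<lambda>c. THE X. \<exists>b T. T \<notin> p \<and> (\<forall>i<k. c i = R.frac (b i) T) \<and> X = frac (?comb b) T)"
  have f: "f c = frac (?comb b) T" if "T \<notin> p" "\<And>i. i < k \<Longrightarrow> c i = R.frac (b i) T" for c b T
    unfolding f_def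
  proof (rule the_equality)
    show "\<exists>b' T'. T' \<notin> p \<and> (\<forall>i<k. c i = R.frac (b' i) T') \<and> frac (?comb b) T = frac (?comb b') T'"
      using that by blast
    fix X assume "\<exists>b' T'. T' \<notin> p \<and> (\<forall>i<k. c i = R.frac (b' i) T') \<and> X = frac (?comb b') T'"
    then obtain b' T' where b': "T' \<notin> p" "\<forall>i<k. c i = R.frac (b' i) T'" "X = frac (?comb b') T'"
      by blast
    have "frac (?comb b') T' = frac (?comb b) T"
      using that b' by (subst comb_eq_iff[OF bas]) auto
    then show "X = frac (?comb b) T" using b' by simp
  qed
  have obt: "\<exists>b T. T \<notin> p \<and> (\<forall>i<k. c i = R.frac (b i) T)" if "c \<in> ?C" for c
  proof -
    have "\<And>i. i < k \<Longrightarrow> c i \<in> loc_ring p" using that by auto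
    from R.common_denominator[of k c, OF this] show ?thesis by blast
  qed
  have "inj_on f ?C"
  proof (rule inj_onI)
    fix c d assume c: "c \<in> ?C" and d: "d \<in> ?C" and eq: "f c = f d"
    obtain b T where b: "T \<notin> p" "\<forall>i<k. c i = R.frac (b i) T" using obt[OF c] by blast
    obtain b' T' where b': "T' \<notin> p" "\<forall>i<k. d i = R.frac (b' i) T'" using obt[OF d]
      by blast
    have "frac (?comb b) T = frac (?comb b') T'"
      using eq f[of T c b] f[of T' d b'] b b' by simp
    then have "\<forall>i<k. R.frac (b i) T = R.frac (b' i) T'"
      by (subst (asm) comb_eq_iff[OF bas b(1) b'(1)])
    then show "c = d"
      using b b' by (intro PiE_ext[OF c d]) auto
  qed
  moreover have "f ` ?C = localization s M p"
  proof
    show "f ` ?C \<subseteq> localization s M p"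
    proof
      fix X assume "X \<in> f ` ?C"
      then obtain c where c: "c \<in> ?C" "X = f c" by blast
      obtain b T where b: "T \<notin> p" "\<forall>i<k. c i = R.frac (b i) T" using obt[OF c(1)]
        by blast
      then show "X \<in> localization s M p"
        using c f[of T c b] comb_in[of k x b] x frac_in by simp
    qed
    show "localization s M p \<subseteq> f ` ?C"
    proof
      fix X assume "X \<in> localization s M p"
      then obtain y u where y: "y \<in> M" "u \<notin> p" "X = frac y u" by (rule frac_cases)
      obtain w b where w: "w \<notin> p" "s w y = ?comb b"
        using bas y(1) unfolding local_basis_def by blast
      let ?c = "\<lambda>i\<in>{..<k}. R.frac (b i) (w * u)"
      have "f ?c = frac (?comb b) (w * u)"
        by (rule f) (use w y pmult in auto)
      also have "\<dots> = X" unfolding w(2)[symmetric] y(3) by (rule frac_cancel) (use y w in auto)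
      finally have "X = f ?c" ..
      moreover have "?c \<in> ?C" using w y pmult by (auto intro!: R.frac_in)
      ultimately show "X \<in> f ` ?C" by blast
    qed
  qed
  ultimately have "bij_betw f ?C (localization s M p)" by (simp add: bij_betw_def)
  moreover have "f (\<lambda>i\<in>{..<k}. loc_ring_add p (c i) (d i)) = loc_add s M p (f c) (f d)"
    if c: "c \<in> ?C" and d: "d \<in> ?C" for c d
  proof -
    obtain b T where b: "T \<notin> p" "\<forall>i<k. c i = R.frac (b i) T" using obt[OF c] by blast
    obtain b' T' where b': "T' \<notin> p" "\<forall>i<k. d i = R.frac (b' i) T'" using obt[OF d]
      by blast
    have "f (\<lambda>i\<in>{..<k}. loc_ring_add p (c i) (d i)) = frac (?comb (\<lambda>i. T' * b i + T * b' i)) (T * T')"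
      by (rule f) (use b b' pmult in \<open>auto simp: ring_add_frac\<close>)
    also have "?comb (\<lambda>i. T' * b i + T * b' i) = s T' (?comb b) + s T (?comb b')"
      by (simp add: scale_sum_right scale_left_distrib sum.distrib)
    also have "frac (s T' (?comb b) + s T (?comb b')) (T * T') = loc_add s M p (f c) (f d)"
      using b b' f[of T c b] f[of T' d b'] comb_in[of k x, OF x] by (simp add: frac_add)
    finally show ?thesis .
  qed
  moreover have "f (\<lambda>i\<in>{..<k}. loc_ring_mult p a (c i)) = loc_scale s M p a (f c)"
    if a: "a \<in> loc_ring p" and c: "c \<in> ?C" for a c
  proof -
    obtain b T where b: "T \<notin> p" "\<forall>i<k. c i = R.frac (b i) T" using obt[OF c] by blast
    obtain a0 t where a0: "t \<notin> p" "a = R.frac a0 t" using R.frac_cases[OF a] by blast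
    have "f (\<lambda>i\<in>{..<k}. loc_ring_mult p a (c i)) = frac (?comb (\<lambda>i. a0 * b i)) (t * T)"
      by (rule f) (use b a0 pmult in \<open>auto simp: ring_scale_frac\<close>)
    also have "?comb (\<lambda>i. a0 * b i) = s a0 (?comb b)"
      by (simp add: scale_sum_right)
    also have "frac (s a0 (?comb b)) (t * T) = loc_scale s M p a (f c)"
      using b a0 f[of T c b] comb_in[of k x, OF x] by (simp add: loc_scale_frac')
    finally show ?thesis .
  qed
  ultimately show ?thesis unfolding free_of_rank_at_def by blast
qed

text \<open>
  The images of the unit vectors are brought to a common denominator \<open>u\<close>; their numerators form
  the local basis.  The isomorphism is known to respect sums of two terms only, so it is evaluated on a
  tuple by adding one coordinate at a time.
\<close>
lemma free_imp_local_basis: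
  assumes "free_of_rank_at s M k p"
  obtains x where "local_basis s M k p x"
proof -
  let ?C = "{..<k} \<rightarrow>\<^sub>E loc_ring p"
  from assms obtain f where bij: "bij_betw f ?C (localization s M p)"
    and add': "\<forall>c\<in>?C. \<forall>d\<in>?C. f (\<lambda>i\<in>{..<k}. loc_ring_add p (c i) (d i)) = loc_add s M p (f c) (f d)"
    and scale': "\<forall>a\<in>loc_ring p. \<forall>c\<in>?C. f (\<lambda>i\<in>{..<k}. loc_ring_mult p a (c i)) = loc_scale s M p a (f c)"
    unfolding free_of_rank_at_def by (elim exE conjE)
  note add = bspec[OF bspec[OF add']] and scale = bspec[OF bspec[OF scale']]
  let ?e = "\<lambda>j. \<lambda>i\<in>{..<k}. R.frac (if i = j then 1 else 0) 1"
  have e: "?e j \<in> ?C" for j using p1 by (auto intro!: R.frac_in)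
  have fC: "f c \<in> localization s M p" if "c \<in> ?C" for c
    using bij that by (auto simp: bij_betw_def)
  obtain u x where u: "u \<notin> p" and x: "\<And>i. i < k \<Longrightarrow> x i \<in> M" and fe: "\<And>i. i < k \<Longrightarrow> f (?e i) = frac (x i) u"
    using common_denominator[of k "\<lambda>i. f (?e i)", OF fC[OF e]] by blast
  let ?comb = "\<lambda>b. \<Sum>i<k. s (b i) (x i)"
  have zeroM: "0 \<in> M" using M by (rule subspace_0)
  have frac0: "frac 0 u = frac 0 v" if "u \<notin> p" "v \<notin> p" for u v
    using that zeroM p1 by (subst frac_eq_iff) auto
  have Rfrac0: "R.frac 0 u = R.frac 0 v" if "u \<notin> p" "v \<notin> p" for u v
    using that p1 by (subst R.frac_eq_iff) auto
  have f_comb: "f (\<lambda>i\<in>{..<k}. R.frac (b i) T) = frac (?comb b) (T * u)" if T: "T \<notin> p" for b T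
  proof -
    have Tu: "T * u \<notin> p" using T u pmult by blast
    let ?c = "\<lambda>j. \<lambda>i\<in>{..<k}. R.frac (if i < j then b i else 0) T"
    have c: "?c j \<in> ?C" for j using T by (auto intro!: R.frac_in)
    have "f (?c j) = frac (\<Sum>i<j. s (b i) (x i)) (T * u)" if "j \<le> k" for j
      using that
    proof (induction j)
      case 0
      obtain y v where y: "y \<in> M" "v \<notin> p" "f (?c 0) = frac y v"
        by (rule frac_cases[OF fC[OF c[of 0]]])
      have "?c 0 = (\<lambda>i\<in>{..<k}. loc_ring_mult p (R.frac 0 1) (?c 0 i))"
        using T p1 by (intro ext) (auto simp: ring_scale_frac)
      from trans[OF arg_cong[of _ _ f, OF this] scale[OF R.frac_in[OF UNIV_I p1] c[of 0]]]
      have "f (?c 0) = loc_scale s M p (R.frac 0 1) (f (?c 0))" .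
      also have "\<dots> = frac 0 v" using y p1 by (simp add: loc_scale_frac')
      also have "\<dots> = frac 0 (T * u)" by (rule frac0[OF y(2) Tu])
      finally show ?case by (simp only: lessThan_0 sum.empty)
    next
      case (Suc j)
      then have j: "j < k" by simp
      let ?d = "\<lambda>i\<in>{..<k}. loc_ring_mult p (R.frac (b j) T) (?e j i)"
      have bT: "R.frac (b j) T \<in> loc_ring p" using T by (auto intro!: R.frac_in)
      have d: "?d i = R.frac (if i = j then b j else 0) T" if "i < k" for i
        using that T p1 by (simp add: ring_scale_frac)
      then have dC: "?d \<in> ?C" using T by (auto intro!: R.frac_in simp: ring_scale_frac p1)
      have "?c (Suc j) = (\<lambda>i\<in>{..<k}. loc_ring_add p (?c j i) (?d i))"
      proof
        fix i show "?c (Suc j) i = (\<lambda>i\<in>{..<k}. loc_ring_add p (?c j i) (?d i)) i"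
        proof (cases "i < k")
          case True
          have "loc_ring_add p (?c j i) (?d i) =
              R.frac (T * (if i < j then b i else 0) + T * (if i = j then b j else 0)) (T * T)"
            unfolding d[OF True] using True T by (simp add: ring_add_frac)
          also have "T * (if i < j then b i else 0) + T * (if i = j then b j else 0) =
              T * (if i < Suc j then b i else 0)"
            by auto
          also have "R.frac (T * (if i < Suc j then b i else 0)) (T * T) = ?c (Suc j) i"
            using True T by (simp add: ring_frac_cancel)
          finally show ?thesis using True by simp
        qed simp
      qed
      from trans[OF arg_cong[of _ _ f, OF this] add[OF c[of j] dC]]
      have "f (?c (Suc j)) = loc_add s M p (f (?c j)) (f ?d)" .
      also have "f ?d = loc_scale s M p (R.frac (b j) T) (f (?e j))"
        by (rule scale[OF bT e])
      also have "\<dots> = frac (s (b j) (x j)) (T * u)"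
        using fe[OF j] T u x[OF j] by (simp add: loc_scale_frac')
      also have "f (?c j) = frac (\<Sum>i<j. s (b i) (x i)) (T * u)"
        by (rule Suc.IH) (use Suc.prems in simp)
      also have "loc_add s M p \<dots> (frac (s (b j) (x j)) (T * u)) =
          frac (s (T * u) (\<Sum>i<Suc j. s (b i) (x i))) ((T * u) * (T * u))"
        using Tu x j M
          by (subst frac_add) (auto intro!: subspace_sum subspace_scale simp: scale_right_distrib)
      also have "\<dots> = frac (\<Sum>i<Suc j. s (b i) (x i)) (T * u)"
        by (rule frac_cancel[OF comb_in Tu Tu]) (use x Suc.prems in auto)
      finally show ?case .
    qed
    from this[of k] have "f (?c k) = frac (?comb b) (T * u)" by simp
    moreover have "?c k = (\<lambda>i\<in>{..<k}. R.frac (b i) T)" by (rule restrict_ext) simp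
    ultimately show ?thesis by (simp only:)
  qed
  have "local_basis s M k p x"
    unfolding local_basis_def
  proof (intro conjI allI impI ballI)
    fix y assume y: "y \<in> M"
    then have "frac y 1 \<in> f ` ?C"
      using bij frac_in[OF y p1] by (simp add: bij_betw_def)
    then obtain c where c: "c \<in> ?C" "frac y 1 = f c" by blast
    have "\<And>i. i < k \<Longrightarrow> c i \<in> loc_ring p" using c(1) by auto
    from R.common_denominator[of k c, OF this]
    obtain b T where b: "T \<notin> p" "\<And>i. i < k \<Longrightarrow> c i = R.frac (b i) T" by blast
    have "(\<lambda>i\<in>{..<k}. R.frac (b i) T) \<in> ?C"
      using b(1) by (auto intro!: R.frac_in)
    then have "c = (\<lambda>i\<in>{..<k}. R.frac (b i) T)"
      by (rule PiE_ext[OF c(1)]) (simp add: b(2))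
    then have "frac y 1 = frac (?comb b) (T * u)"
      using c(2) f_comb[OF b(1), of b] by (simp only:)
    moreover have Tu: "T * u \<notin> p" by (rule pmult[OF b(1) u])
    ultimately obtain w where w: "w \<notin> p" "s w (s (T * u) y - s 1 (?comb b)) = 0"
      using frac_eq_iff[OF y comb_in[of k x b, OF x] p1 Tu] by blast
    then have "s (w * (T * u)) y = (\<Sum>i<k. s (w * b i) (x i))"
      by (simp add: scale_right_diff_distrib scale_sum_right)
    moreover have "w * (T * u) \<notin> p" by (rule pmult[OF w(1) Tu])
    ultimately show "\<exists>w b. w \<notin> p \<and> s w y = ?comb b"
      by (intro exI[of _ "w * (T * u)"] exI[of _ "\<lambda>i. w * b i"] conjI)
  next
    fix b assume zero: "?comb b = 0"
    have "inj_on f ?C" using bij by (simp only: bij_betw_def)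
    moreover have "f (\<lambda>i\<in>{..<k}. R.frac (b i) 1) = f (\<lambda>i\<in>{..<k}. R.frac 0 1)"
      using f_comb[OF p1, of b] f_comb[OF p1, of "\<lambda>_. 0"]
        by (simp only: zero scale_zero_left sum.neutral_const)
    moreover have "(\<lambda>i\<in>{..<k}. R.frac (b i) 1) \<in> ?C" "(\<lambda>i\<in>{..<k}. R.frac 0 1) \<in> ?C"
      using p1 by (auto intro!: R.frac_in)
    ultimately have eq: "(\<lambda>i\<in>{..<k}. R.frac (b i) 1) = (\<lambda>i\<in>{..<k}. R.frac 0 1)"
      by (rule inj_onD)
    have "R.frac (b i) 1 = R.frac 0 1" if "i < k" for i
      using fun_cong[OF eq, of i] that by simp
    then have ex: "\<exists>w. w \<notin> p \<and> w * (1 * b i - 1 * 0) = 0" if "i < k" for i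
      using R.frac_eq_iff[OF UNIV_I UNIV_I p1 p1, of "b i" 0] that by blast
    then have "\<forall>i. \<exists>w. i < k \<longrightarrow> w \<notin> p \<and> w * b i = 0"
      using ex by auto
    from choice[OF this] obtain w where w: "\<And>i. i < k \<Longrightarrow> w i \<notin> p \<and> w i * b i = 0"
      by blast
    have "(\<Prod>i<k. w i) \<notin> p" using w by (intro prime_ideal_prod_notin[OF p]) auto
    moreover have "(\<Prod>i<k. w i) * b i = 0" if "i < k" for i
      using that w[OF that] by (subst prod.remove[of "{..<k}" i]) (auto simp: mult_ac)
    ultimately show "\<exists>w. w \<notin> p \<and> (\<forall>i<k. w * b i = 0)" by blast
  qed (use x in auto)
  then show ?thesis by (rule that)
qed

end

text \<open>
  A maximal element among the ideals that contain \<open>I\<close> but not \<open>1\<close>, from Zorn's lemma, is prime.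
\<close>
lemma prime_ideal_above:
  fixes I :: "'a::comm_ring_1 set"
  assumes I: "Modules.module.subspace (*) I" and "1 \<notin> I"
  obtains p where "prime_ideal p" and "I \<subseteq> p"
proof -
  interpret R: Modules.module "(*) :: 'a \<Rightarrow> 'a \<Rightarrow> 'a" by (rule module_ring)
  let ?A = "{J. R.subspace J \<and> 1 \<notin> J \<and> I \<subseteq> J}"
  have "\<exists>m\<in>?A. \<forall>J\<in>?A. m \<subseteq> J \<longrightarrow> J = m"
  proof (rule subset_Zorn_nonempty)
    show "?A \<noteq> {}" using assms by blast
    fix \<C> assume ne: "\<C> \<noteq> {}" and ch: "subset.chain ?A \<C>"
    have mem: "\<And>J. J \<in> \<C> \<Longrightarrow> J \<in> ?A" and lin: "\<And>J K. J \<in> \<C> \<Longrightarrow> K \<in> \<C> \<Longrightarrow> J \<subseteq> K \<or> K \<subseteq> J"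
      using ch by (auto simp: subset.chain_def)
    have "R.subspace (\<Union>\<C>)"
    proof (rule R.subspaceI)
      show "0 \<in> \<Union>\<C>" using ne mem R.subspace_0 by blast
      show "x + y \<in> \<Union>\<C>" if xy: "x \<in> \<Union>\<C>" "y \<in> \<Union>\<C>" for x y
      proof -
        obtain J K where "J \<in> \<C>" "x \<in> J" "K \<in> \<C>" "y \<in> K" using xy by blast
        then show ?thesis using lin[of J K] mem R.subspace_add by blast
      qed
      show "c * x \<in> \<Union>\<C>" if "x \<in> \<Union>\<C>" for c x
        using that mem R.subspace_scale by blast
    qed
    then show "\<Union>\<C> \<in> ?A" using ne mem by blast
  qed
  then obtain p where pA: "p \<in> ?A" and pmax: "\<forall>J\<in>?A. p \<subseteq> J \<longrightarrow> J = p"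
    by (elim bexE)
  then have p: "R.subspace p" "1 \<notin> p" "I \<subseteq> p" by auto
  have max: "J = p" if "R.subspace J" "1 \<notin> J" "p \<subseteq> J" for J
  proof -
    have "J \<in> ?A" using that p(3) by blast
    then show ?thesis using pmax that(3) by blast
  qed
  have one: "\<exists>x c. x \<in> p \<and> 1 = x + c * a" if "a \<notin> p" for a
  proof (rule ccontr)
    assume no: "\<not> ?thesis"
    let ?J = "{x + c * a | x c. x \<in> p}"
    have "R.subspace ?J"
    proof (rule R.subspaceI)
      show "0 \<in> ?J" using R.subspace_0[OF p(1)] by (auto intro!: exI[of _ 0])
      show "x + y \<in> ?J" if xy: "x \<in> ?J" "y \<in> ?J" for x y
      proof -
        obtain x' c y' d where "x' \<in> p" "x = x' + c * a" "y' \<in> p" "y = y' + d * a" using xy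
          by blast
        then have "x + y = (x' + y') + (c + d) * a" "x' + y' \<in> p"
          using R.subspace_add[OF p(1)] by (auto simp: algebra_simps)
        then show ?thesis by blast
      qed
      show "e * x \<in> ?J" if x: "x \<in> ?J" for e x
      proof -
        obtain x' c where x': "x' \<in> p" "x = x' + c * a" using x by blast
        have "e * x = e * x' + (e * c) * a" by (simp only: x'(2) distrib_left mult.assoc)
        moreover have "e * x' \<in> p" by (rule R.subspace_scale[OF p(1) x'(1)])
        ultimately show ?thesis by blast
      qed
    qed
    moreover have "p \<subseteq> ?J"
    proof
      fix x assume "x \<in> p"
      moreover have "x = x + 0 * a" by simp
      ultimately show "x \<in> ?J" by blast
    qed
    moreover have "1 \<notin> ?J" using no by blast
    ultimately have "?J = p" using max by blast
    moreover have "0 + 1 * a \<in> ?J" using R.subspace_0[OF p(1)] by blast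
    ultimately show False using that by simp
  qed
  have "a \<in> p \<or> b \<in> p" if ab: "a * b \<in> p" for a b
  proof (rule ccontr)
    assume neg: "\<not> ?thesis"
    then obtain x c where x: "x \<in> p" "1 = x + c * a" using one by blast
    have "b = (x + c * a) * b" by (simp only: x(2)[symmetric] mult_1_left)
    also have "\<dots> = b * x + c * (a * b)"
      by (simp only: distrib_right mult.assoc mult.commute[of x b])
    finally have "b = b * x + c * (a * b)" .
    moreover have "b * x + c * (a * b) \<in> p"
      using R.subspace_add[OF p(1)] R.subspace_scale[OF p(1)] x(1) ab by blast
    ultimately show False using neg by simp
  qed
  then have "prime_ideal p" using p unfolding prime_ideal_def by blast
  then show ?thesis using p(3) that by blast
qed

section \<open>Local factorizations\<close>

text \<open>
  Adjoining a unit row to \<open>L\<close> and a unit column to \<open>G\<close> turns \<open>D\<close> into a matrix of order \<open>k + 1\<close>, whose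
  determinant vanishes; eliminating the new row expresses this through the Schur complement of \<open>D\<close>.
  The factor \<open>det D\<close> on both sides is the price for eliminating with the adjugate
  instead of an inverse.
\<close>
lemma minors_vanish_bordered:
  fixes B :: "'a :: comm_ring_1 mat"
  assumes rk: "minors_vanish k B" and B: "B \<in> carrier_mat m n"
    and L: "L \<in> carrier_mat k m" and G: "G \<in> carrier_mat n k"
  defines "D \<equiv> L * B * G"
  shows "(det D * det D) \<cdot>\<^sub>m B = det D \<cdot>\<^sub>m (B * G * (adj_mat D * (L * B)))"
proof (rule eq_matI)
  have D: "D \<in> carrier_mat k k" and LB: "L * B \<in> carrier_mat k n" and BG: "B * G \<in> carrier_mat m k"
    using L B G by (simp_all add: D_def)
  note adj = adj_mat[OF D]
  have aLB: "adj_mat D * (L * B) \<in> carrier_mat k n" by (rule mult_carrier_mat[OF adj(1) LB])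
  have R: "B * G * (adj_mat D * (L * B)) \<in> carrier_mat m n" by (rule mult_carrier_mat[OF BG aLB])
  fix i j assume "i < dim_row (det D \<cdot>\<^sub>m (B * G * (adj_mat D * (L * B))))"
    and "j < dim_col (det D \<cdot>\<^sub>m (B * G * (adj_mat D * (L * B))))"
  then have ij: "i < m" "j < n" using R by (auto simp del: index_mult_mat)
  define L' where "L' = mat (k + 1) m (\<lambda>(a, b). if a < k then L $$ (a, b) else if b = i then 1 else 0)"
  define G' where "G' = mat n (k + 1) (\<lambda>(a, b). if b < k then G $$ (a, b) else if a = j then 1 else 0)"
  define x where "x = mat k 1 (\<lambda>(a, _). (L * B) $$ (a, j))"
  define y where "y = mat 1 k (\<lambda>(_, c). (B * G) $$ (i, c))"
  define b where "b = mat 1 1 (\<lambda>_. B $$ (i, j))"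
  have L': "L' \<in> carrier_mat (k + 1) m" and G': "G' \<in> carrier_mat n (k + 1)"
    and x: "x \<in> carrier_mat k 1" and y: "y \<in> carrier_mat 1 k" and b: "b \<in> carrier_mat 1 1"
    by (simp_all add: L'_def G'_def x_def y_def b_def)
  have L'B: "(L' * B) $$ (a, c) = (if a < k then (L * B) $$ (a, c) else B $$ (i, c))" if "a < k + 1" "c < n" for a c
  proof -
    have "(L' * B) $$ (a, c) = (\<Sum>t = 0..<m. L' $$ (a, t) * B $$ (t, c))"
      using that L' B by (simp add: scalar_prod_def)
    also have "\<dots> = (\<Sum>t = 0..<m. if a < k then L $$ (a, t) * B $$ (t, c) else if t = i then B $$ (i, c) else 0)"
      using that by (intro sum.cong) (auto simp: L'_def)
    finally show ?thesis using that ij L B by (simp add: scalar_prod_def)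
  qed
  have BG': "(B * G') $$ (a, c) = (if c < k then (B * G) $$ (a, c) else B $$ (a, j))" if "a < m" "c < k + 1" for a c
  proof -
    have "(B * G') $$ (a, c) = (\<Sum>t = 0..<n. B $$ (a, t) * G' $$ (t, c))"
      using that G' B by (simp add: scalar_prod_def)
    also have "\<dots> = (\<Sum>t = 0..<n. if c < k then B $$ (a, t) * G $$ (t, c) else if t = j then B $$ (a, j) else 0)"
      using that by (intro sum.cong) (auto simp: G'_def)
    finally show ?thesis using that ij G B by (simp add: scalar_prod_def)
  qed
  have D_index: "D $$ (a, c) = (\<Sum>t = 0..<n. (L * B) $$ (a, t) * G $$ (t, c))" if "a < k" "c < k" for a c
    unfolding D_def using that LB G
      by (subst index_mult_mat) (auto simp: scalar_prod_def simp del: index_mult_mat assoc_mult_mat)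
  have "L' * B * G' = four_block_mat D x y b"
  proof (rule eq_matI)
    fix a c assume "a < dim_row (four_block_mat D x y b)" "c < dim_col (four_block_mat D x y b)"
    then have ac: "a < k + 1" "c < k + 1" using D b by auto
    have "(L' * B * G') $$ (a, c) = (\<Sum>t = 0..<n. (L' * B) $$ (a, t) * G' $$ (t, c))"
      using ac L' B G' by (simp add: scalar_prod_def del: assoc_mult_mat)
    also have "\<dots> = (\<Sum>t = 0..<n. (if a < k then (L * B) $$ (a, t) else B $$ (i, t)) *
        (if c < k then G $$ (t, c) else if t = j then 1 else 0))"
      using ac by (intro sum.cong) (auto simp: L'B G'_def simp del: index_mult_mat)
    also have "\<dots> = four_block_mat D x y b $$ (a, c)"
    proof (cases "c < k")
      case True
      have "(\<Sum>t = 0..<n. B $$ (i, t) * G $$ (t, c)) = (B * G) $$ (i, c)"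
        using True ij B G by (simp add: scalar_prod_def)
      then show ?thesis
        using ac True D x y b by (simp add: D_index y_def del: index_mult_mat)
    next
      case False
      then have c: "c = k" using ac by simp
      have "(\<Sum>t = 0..<n. (if a < k then (L * B) $$ (a, t) else B $$ (i, t)) * (if t = j then 1 else 0)) =
          (\<Sum>t = 0..<n. if t = j then (if a < k then (L * B) $$ (a, j) else B $$ (i, j)) else 0)"
        by (intro sum.cong) auto
      then show ?thesis
        using ac c ij D x y b by (simp add: x_def b_def del: index_mult_mat)
    qed
    finally show "(L' * B * G') $$ (a, c) = four_block_mat D x y b $$ (a, c)" .
  qed (use L' G' D b in auto)
  then have det0: "det (four_block_mat D x y b) = 0"
    using rk L' G' B unfolding minors_vanish_def by (metis carrier_matD)
  define z where "z = adj_mat D * x"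
  have z: "z \<in> carrier_mat k 1" unfolding z_def by (rule mult_carrier_mat[OF adj(1) x])
  have Dz: "D * z = det D \<cdot>\<^sub>m x"
  proof -
    have "D * z = (D * adj_mat D) * x" unfolding z_def
      by (rule assoc_mult_mat[OF D adj(1) x, symmetric])
    also have "\<dots> = det D \<cdot>\<^sub>m (1\<^sub>m k * x)"
      unfolding adj(2) by (rule mult_smult_assoc_mat[OF one_carrier_mat x])
    finally show ?thesis using left_mult_one_mat[OF x] by simp
  qed
  have nz: "- z \<in> carrier_mat k 1" and d1: "det D \<cdot>\<^sub>m 1\<^sub>m 1 \<in> carrier_mat 1 1"
    using z by auto
  have Dnz: "D * (- z) + x * (det D \<cdot>\<^sub>m 1\<^sub>m 1) = 0\<^sub>m k 1"
  proof -
    have "D * (- z) = - (D * z)" using D z by simp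
    moreover have "x * (det D \<cdot>\<^sub>m 1\<^sub>m 1) = det D \<cdot>\<^sub>m x"
      using mult_smult_distrib[OF x one_carrier_mat] right_mult_one_mat[OF x] by metis
    ultimately show ?thesis unfolding Dz using x by (intro eq_matI) auto
  qed
  let ?e = "y * (- z) + b * (det D \<cdot>\<^sub>m 1\<^sub>m 1)"
  have e: "?e \<in> carrier_mat 1 1" using y nz b d1 by auto
  have K: "four_block_mat D x y b \<in> carrier_mat (k + 1) (k + 1)"
    by (rule four_block_carrier_mat[OF D b])
  have U: "four_block_mat (1\<^sub>m k) (- z) (0\<^sub>m 1 k) (det D \<cdot>\<^sub>m 1\<^sub>m 1) \<in> carrier_mat (k + 1) (k + 1)"
    by (rule four_block_carrier_mat[OF one_carrier_mat d1])
  have "four_block_mat D x y b * four_block_mat (1\<^sub>m k) (- z) (0\<^sub>m 1 k) (det D \<cdot>\<^sub>m 1\<^sub>m 1) =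
      four_block_mat (D * 1\<^sub>m k + x * 0\<^sub>m 1 k) (D * (- z) + x * (det D \<cdot>\<^sub>m 1\<^sub>m 1)) (y * 1\<^sub>m k + b * 0\<^sub>m 1 k) ?e"
    by (rule mult_four_block_mat[OF D x y b one_carrier_mat nz zero_carrier_mat d1])
  also have "D * 1\<^sub>m k + x * 0\<^sub>m 1 k = D" using D x by simp
  also have "y * 1\<^sub>m k + b * 0\<^sub>m 1 k = y" using y b by simp
  also note Dnz
  finally have "det (four_block_mat D x y b) * det (four_block_mat (1\<^sub>m k) (- z) (0\<^sub>m 1 k) (det D \<cdot>\<^sub>m 1\<^sub>m 1)) =
      det (four_block_mat D (0\<^sub>m k 1) y ?e)"
    by (simp only: det_mult[OF K U, symmetric])
  then have "det D * det ?e = 0"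
    by (simp only: det0 mult_zero_left det_block_upper_right_zero[OF D y e])
  moreover have "det ?e = ?e $$ (0, 0)" by (rule det_single[OF e])
  moreover have "?e $$ (0, 0) = det D * B $$ (i, j) - (y * z) $$ (0, 0)"
    using y z b d1 by (simp add: b_def scalar_prod_def sum_negf mult.commute)
  moreover have "(y * z) $$ (0, 0) = (B * G * (adj_mat D * (L * B))) $$ (i, j)"
  proof -
    have "z $$ (c, 0) = (adj_mat D * (L * B)) $$ (c, j)" if "c < k" for c
    proof -
      have "z $$ (c, 0) = (\<Sum>t = 0..<k. adj_mat D $$ (c, t) * x $$ (t, 0))"
        unfolding z_def using that adj(1) x by (simp add: scalar_prod_def)
      also have "\<dots> = (\<Sum>t = 0..<k. adj_mat D $$ (c, t) * (L * B) $$ (t, j))"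
        by (intro sum.cong) (auto simp: x_def)
      also have "\<dots> = (adj_mat D * (L * B)) $$ (c, j)"
        using that ij adj(1) LB
          by (subst (2) index_mult_mat) (auto simp: scalar_prod_def simp del: index_mult_mat)
      finally show ?thesis .
    qed
    then have "(y * z) $$ (0, 0) = (\<Sum>c = 0..<k. (B * G) $$ (i, c) * (adj_mat D * (L * B)) $$ (c, j))"
      using y z
        by (simp add: scalar_prod_def y_def del: index_mult_mat(1)) (simp add: scalar_prod_def y_def)
    also have "\<dots> = (B * G * (adj_mat D * (L * B))) $$ (i, j)"
    proof -
      have "row (B * G) i \<bullet> col (adj_mat D * (L * B)) j = (\<Sum>c = 0..<k. (B * G) $$ (i, c) * (adj_mat D * (L * B)) $$ (c, j))"
        using ij B G L BG aLB adj(1) by (auto simp: scalar_prod_def intro!: sum.cong)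
      then show ?thesis
        using ij carrier_matD[OF BG] carrier_matD[OF aLB] by (subst index_mult_mat(1)) auto
    qed
    finally show ?thesis .
  qed
  ultimately have "det D * (det D * B $$ (i, j) - (B * G * (adj_mat D * (L * B))) $$ (i, j)) = 0"
    by simp
  then show "((det D * det D) \<cdot>\<^sub>m B) $$ (i, j) = (det D \<cdot>\<^sub>m (B * G * (adj_mat D * (L * B)))) $$ (i, j)"
    using ij B carrier_matD[OF R] by (simp add: algebra_simps del: index_mult_mat(1) assoc_mult_mat)
next
  have "B * G * (adj_mat D * (L * B)) \<in> carrier_mat m n"
    using L B G adj_mat(1)[of D k] by (simp add: D_def mult_carrier_mat[of _ m k _ n])
  then show "dim_row ((det D * det D) \<cdot>\<^sub>m B) = dim_row (det D \<cdot>\<^sub>m (B * G * (adj_mat D * (L * B))))"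
    "dim_col ((det D * det D) \<cdot>\<^sub>m B) = dim_col (det D \<cdot>\<^sub>m (B * G * (adj_mat D * (L * B))))"
    using B by (auto simp del: index_mult_mat)
qed

lemma det_mult_smaller:
  fixes U V :: "'a :: comm_ring_1 mat"
  assumes U: "U \<in> carrier_mat (k + 1) k" and V: "V \<in> carrier_mat k (k + 1)"
  shows "det (U * V) = 0"
proof -
  define U' where "U' = mat (k + 1) (k + 1) (\<lambda>(i, j). if j < k then U $$ (i, j) else 0)"
  define V' where "V' = mat (k + 1) (k + 1) (\<lambda>(i, j). if i < k then V $$ (i, j) else 0)"
  have U': "U' \<in> carrier_mat (k + 1) (k + 1)" and V': "V' \<in> carrier_mat (k + 1) (k + 1)"
    by (simp_all add: U'_def V'_def)
  have "U * V = U' * V'"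
    using U V U' V' by (intro eq_matI) (simp_all add: scalar_prod_def U'_def V'_def)
  moreover have "det U' = 0"
    using laplace_expansion_column[OF U', of k] by (simp add: U'_def)
  ultimately show ?thesis by (simp add: det_mult[OF U' V'])
qed

text \<open>
  If a minor \<open>d\<close> of order \<open>k + 1\<close> were nonzero, a prime containing its annihilator would exist; but
  the factorization at that prime gives \<open>w ^ (k + 1) * d = 0\<close> with \<open>w\<close> outside the prime.
\<close>
lemma minors_vanish_local:
  fixes B :: "'a :: comm_ring_1 mat"
  assumes B: "B \<in> carrier_mat m n"
    and loc: "\<And>p. prime_ideal p \<Longrightarrow> \<exists>w X Y. w \<notin> p \<and> X \<in> carrier_mat m k \<and> Y \<in> carrier_mat k n \<and> w \<cdot>\<^sub>m B = X * Y"
  shows "minors_vanish k B"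
  unfolding minors_vanish_def
proof (intro ballI)
  interpret R: Modules.module "(*) :: 'a \<Rightarrow> 'a \<Rightarrow> 'a" by (rule module_ring)
  fix L H :: "'a mat" assume "L \<in> carrier_mat (k + 1) (dim_row B)" and "H \<in> carrier_mat (dim_col B) (k + 1)"
  then have L: "L \<in> carrier_mat (k + 1) m" and H: "H \<in> carrier_mat n (k + 1)" using B by auto
  let ?d = "det (L * B * H)"
  let ?I = "{a. a * ?d = 0}"
  have I: "R.subspace ?I"
    by (rule R.subspaceI) (simp_all add: distrib_right, simp only: mult.assoc mult_zero_right)
  show "?d = 0"
  proof (rule ccontr)
    assume "?d \<noteq> 0"
    then have "1 \<notin> ?I" by simp
    with I obtain p where p: "prime_ideal p" "?I \<subseteq> p" by (rule prime_ideal_above)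
    obtain w X Y where w: "w \<notin> p" and X: "X \<in> carrier_mat m k" and Y: "Y \<in> carrier_mat k n"
      and eq: "w \<cdot>\<^sub>m B = X * Y"
      using loc[OF p(1)] by (elim exE conjE)
    have LB: "L * B \<in> carrier_mat (k + 1) n" by (rule mult_carrier_mat[OF L B])
    have LBH: "L * B * H \<in> carrier_mat (k + 1) (k + 1)" by (rule mult_carrier_mat[OF LB H])
    have "w \<cdot>\<^sub>m (L * B * H) = (w \<cdot>\<^sub>m (L * B)) * H"
      by (rule mult_smult_assoc_mat[OF LB H, symmetric])
    also have "w \<cdot>\<^sub>m (L * B) = L * (w \<cdot>\<^sub>m B)"
      by (rule mult_smult_distrib[OF L B, symmetric])
    also have "\<dots> = L * X * Y"
      unfolding eq by (rule assoc_mult_mat[OF L X Y, symmetric])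
    also have "L * X * Y * H = L * X * (Y * H)"
      by (rule assoc_mult_mat[OF mult_carrier_mat[OF L X] Y H])
    finally have "det (w \<cdot>\<^sub>m (L * B * H)) = 0"
      by (simp only: det_mult_smaller[OF mult_carrier_mat[OF L X] mult_carrier_mat[OF Y H]])
    then have "w ^ (k + 1) \<in> ?I"
      using carrier_matD(2)[OF LBH] by (simp only: det_smult mem_Collect_eq)
    then show False
      using p(2) prime_ideal_power_notin[OF p(1) w] by blast
  qed
qed

section \<open>Crossed maps and the equivalence of the three conditions\<close>

lemma horner_map_commute:
  assumes s: "Modules.module s" and w: "lin_map s UNIV s UNIV w"
  shows "w (horner_map s a w k y) = horner_map s a w k (w y)"
proof (induction k)
  case 0
  then show ?case by (simp add: lin_map_0[OF w])
next
  case (Suc k)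
  then show ?case by (simp add: horner_map_Suc[OF s w] lin_map_diff[OF w] lin_mapD(3)[OF w])
qed

lemma direct_sumI:
  assumes "\<And>x. x \<in> U \<Longrightarrow> x \<in> V \<Longrightarrow> x = 0" and "0 \<in> U" "0 \<in> V" and "\<And>x. \<exists>u. u \<in> U \<and> x - u \<in> V"
  shows "direct_sum_is U V UNIV"
proof -
  have "x \<in> {u + v | u v. u \<in> U \<and> v \<in> V}" for x
  proof -
    obtain u where "u \<in> U" "x - u \<in> V" using assms(4) by blast
    then show ?thesis by (intro CollectI exI[of _ u] exI[of _ "x - u"]) simp
  qed
  then have "{u + v | u v. u \<in> U \<and> v \<in> V} = UNIV" by (rule UNIV_eq_I[symmetric])
  then show ?thesis using assms(1-3) unfolding direct_sum_is_def by blast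
qed

text \<open>
  The map \<open>f' h\<close> is a generalized inverse of \<open>f\<close>.  The projection \<open>f f' h\<close> has the image of \<open>f\<close> and the
  kernel of \<open>f'\<close>, and \<open>f' h f\<close> has the kernel of \<open>f\<close> and the image of \<open>f'\<close>.
\<close>
lemma crossedI:
  fixes sE :: "'a::comm_ring_1 \<Rightarrow> 'e::ab_group_add \<Rightarrow> 'e" and sF :: "'a \<Rightarrow> 'f::ab_group_add \<Rightarrow> 'f"
  assumes f: "lin_map sE UNIV sF UNIV f" and f': "lin_map sF UNIV sE UNIV f'" and h: "lin_map sF UNIV sF UNIV h"
    and comm: "\<And>y. f (f' (h y)) = h (f (f' y))"
    and fgf: "\<And>x. f (f' (h (f x))) = f x" and f'fg: "\<And>y. f' (f (f' (h y))) = f' y"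
  shows "crossed f f'"
proof -
  note f0 = lin_map_0[OF f] and f'0 = lin_map_0[OF f'] and h0 = lin_map_0[OF h]
    and fd = lin_map_diff[OF f] and f'd = lin_map_diff[OF f']
  have "direct_sum_is (range f) (ker f') UNIV"
  proof (rule direct_sumI)
    fix y assume "y \<in> range f" "y \<in> ker f'"
    then obtain x where x: "y = f x" "f' y = 0" by (auto simp: ker_def)
    have "f x = f (f' (h (f x)))" by (simp add: fgf)
    also have "\<dots> = h (f (f' (f x)))" by (rule comm)
    also have "\<dots> = 0" using x by (simp add: f0 h0)
    finally show "y = 0" using x by simp
  next
    show "0 \<in> range f" using f0 by (metis rangeI)
    show "0 \<in> ker f'" by (simp add: ker_def f'0)
    fix y show "\<exists>u. u \<in> range f \<and> y - u \<in> ker f'"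
      by (intro exI[of _ "f (f' (h y))"]) (simp add: ker_def f'd f'fg)
  qed
  moreover have "direct_sum_is (ker f) (range f') UNIV"
  proof (rule direct_sumI)
    fix x assume "x \<in> ker f" "x \<in> range f'"
    then obtain y where y: "x = f' y" "f x = 0" by (auto simp: ker_def)
    have "f' y = f' (f (f' (h y)))" by (simp add: f'fg)
    also have "\<dots> = f' (h (f (f' y)))" by (simp add: comm)
    also have "\<dots> = 0" using y by (simp add: h0 f'0)
    finally show "x = 0" using y by simp
  next
    show "0 \<in> ker f" by (simp add: ker_def f0)
    show "0 \<in> range f'" using f'0 by (metis rangeI)
    fix x show "\<exists>u. u \<in> ker f \<and> x - u \<in> range f'"
      by (intro exI[of _ "x - f' (h (f x))"]) (simp add: ker_def fd fgf)
  qed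
  ultimately show ?thesis by (simp add: crossed_def)
qed

lemma crossed_decomp:
  assumes cr: "crossed f f'"
    and f: "lin_map sE UNIV sF UNIV f" and f': "lin_map sF UNIV sE UNIV f'"
  shows "\<exists>x. f' y = f' (f x)" and "\<exists>z. f x = f (f' (f z))"
proof -
  have *: "\<exists>x. f' y = f' (f x)" for y
  proof -
    have "y \<in> {u + v | u v. u \<in> range f \<and> v \<in> ker f'}"
      using cr by (simp add: crossed_def direct_sum_is_def)
    then obtain x v where "y = f x + v" "f' v = 0" by (auto simp: ker_def)
    then show ?thesis using lin_mapD(2)[OF f', of "f x" v] by auto
  qed
  then show "\<exists>x. f' y = f' (f x)" .
  have "x \<in> {u + v | u v. u \<in> ker f \<and> v \<in> range f'}"
    using cr by (simp add: crossed_def direct_sum_is_def)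
  then obtain u y where "x = u + f' y" "f u = 0" by (auto simp: ker_def)
  then have "f x = f (f' y)" using lin_mapD(2)[OF f, of u "f' y"] by simp
  then show "\<exists>z. f x = f (f' (f z))" using *[of y] by metis
qed

lemma local_basis_span_family:
  assumes s: "Modules.module s" and p: "prime_ideal p" and bas: "local_basis s M k p x"
    and y: "\<And>j. j < (n::nat) \<Longrightarrow> y j \<in> M"
  shows "\<exists>w b. w \<notin> p \<and> (\<forall>j<n. s w (y j) = (\<Sum>i<k. s (b i j) (x i)))"
proof -
  interpret Modules.module s by fact
  have "\<exists>wb. fst wb \<notin> p \<and> (j < n \<longrightarrow> s (fst wb) (y j) = (\<Sum>i<k. s (snd wb i) (x i)))" for j
  proof (cases "j < n")
    case True
    then have "\<exists>w b. w \<notin> p \<and> s w (y j) = (\<Sum>i<k. s (b i) (x i))"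
      using bas y by (simp add: local_basis_def)
    then obtain w b where "w \<notin> p" "s w (y j) = (\<Sum>i<k. s (b i) (x i))" by (elim exE conjE)
    then show ?thesis by (intro exI[of _ "(w, b)"]) simp
  qed (use prime_ideal_compl(1)[OF p] in \<open>auto intro!: exI[of _ "(1, undefined)"]\<close>)
  then have "\<forall>j. \<exists>wb. fst wb \<notin> p \<and> (j < n \<longrightarrow> s (fst wb) (y j) = (\<Sum>i<k. s (snd wb i) (x i)))"
    by blast
  from choice[OF this] obtain g
    where g: "\<And>j. fst (g j) \<notin> p" "\<And>j. j < n \<Longrightarrow> s (fst (g j)) (y j) = (\<Sum>i<k. s (snd (g j) i) (x i))"
    by blast
  define w where "w = (\<Prod>j<n. fst (g j))"
  define c where "c = (\<lambda>j. \<Prod>t\<in>{..<n} - {j}. fst (g t))"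
  have "s w (y j) = (\<Sum>i<k. s (c j * snd (g j) i) (x i))" if j: "j < n" for j
  proof -
    have "w = c j * fst (g j)"
      unfolding w_def c_def using j by (subst prod.remove[of "{..<n}" j]) (auto simp: mult.commute)
    then have "s w (y j) = s (c j) (s (fst (g j)) (y j))" by simp
    also have "\<dots> = (\<Sum>i<k. s (c j * snd (g j) i) (x i))"
      unfolding g(2)[OF j] by (simp add: scale_sum_right)
    finally show ?thesis .
  qed
  moreover have "w \<notin> p" unfolding w_def by (rule prime_ideal_prod_notin[OF p g(1)])
  ultimately show ?thesis
    by (intro exI[of _ w] exI[of _ "\<lambda>i j. c j * snd (g j) i"]) simp
qed

lemma smult_lmat_eq_mult:
  assumes i: "lin_map s UNIV (\<cdot>\<^sub>v) (carrier_vec m) \<iota>" and s: "Modules.module s"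
    and eq: "\<And>j. j < n \<Longrightarrow> s w (g (unit_vec n j)) = (\<Sum>i<k. s (b i j) (x i))"
  shows "w \<cdot>\<^sub>m lmat m n (\<iota> \<circ> g) = mat m k (\<lambda>(a, i). \<iota> (x i) $ a) * mat k n (\<lambda>(i, j). b i j)"
proof (rule eq_matI)
  fix a j
  assume "a < dim_row (mat m k (\<lambda>(a, i). \<iota> (x i) $ a) * mat k n (\<lambda>(i, j). b i j))"
    and "j < dim_col (mat m k (\<lambda>(a, i). \<iota> (x i) $ a) * mat k n (\<lambda>(i, j). b i j))"
  then have aj: "a < m" "j < n" by auto
  note ia = lin_map_index[OF i aj(1)]
  have "(w \<cdot>\<^sub>m lmat m n (\<iota> \<circ> g)) $$ (a, j) = w * \<iota> (g (unit_vec n j)) $ a"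
    using aj by (simp add: lmat_def)
  also have "\<dots> = \<iota> (\<Sum>i<k. s (b i j) (x i)) $ a"
    using lin_mapD(3)[OF ia] eq[OF aj(2)] by (metis UNIV_I)
  also have "\<dots> = (\<Sum>i<k. b i j * \<iota> (x i) $ a)"
    using lin_mapD(3)[OF ia] by (simp add: lin_map_sum[OF ia])
  also have "\<dots> = (mat m k (\<lambda>(a, i). \<iota> (x i) $ a) * mat k n (\<lambda>(i, j). b i j)) $$ (a, j)"
    using aj by (simp add: scalar_prod_def atLeast0LessThan mult.commute)
  finally show "(w \<cdot>\<^sub>m lmat m n (\<iota> \<circ> g)) $$ (a, j) =
      (mat m k (\<lambda>(a, i). \<iota> (x i) $ a) * mat k n (\<lambda>(i, j). b i j)) $$ (a, j)" .
qed (auto simp: lmat_def)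

locale retract_pair =
  fixes sE :: "'a::comm_ring_1 \<Rightarrow> 'e::ab_group_add \<Rightarrow> 'e" and sF :: "'a \<Rightarrow> 'f::ab_group_add \<Rightarrow> 'f"
    and f :: "'e \<Rightarrow> 'f" and f' :: "'f \<Rightarrow> 'e" and m n \<iota>E \<pi>E \<iota>F \<pi>F
  assumes sE: "Modules.module sE" and sF: "Modules.module sF"
    and f: "lin_map sE UNIV sF UNIV f" and f': "lin_map sF UNIV sE UNIV f'"
    and rE: "free_retract sE UNIV n \<iota>E \<pi>E" and rF: "free_retract sF UNIV m \<iota>F \<pi>F"
begin

definition "B = lmat m n (\<iota>F \<circ> (f \<circ> \<pi>E))"
definition "C = lmat n m (\<iota>E \<circ> (f' \<circ> \<pi>F))"

lemma B: "B \<in> carrier_mat m n" and C: "C \<in> carrier_mat n m"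
  by (simp_all add: B_def C_def)

lemma BC: "B * C \<in> carrier_mat m m"
  by (rule mult_carrier_mat[OF B C])

lemmas iE = free_retractD(1)[OF rE] and pE = free_retractD(2)[OF rE] and piE = free_retractD(3)[OF rE UNIV_I]
lemmas iF = free_retractD(1)[OF rF] and pF = free_retractD(2)[OF rF] and piF = free_retractD(3)[OF rF UNIV_I]

lemma w: "lin_map sF UNIV sF UNIV (f \<circ> f')"
  by (rule lin_map_comp[OF f f'])

lemma BC_eq: "B * C = lmat m m (\<iota>F \<circ> (f \<circ> f' \<circ> \<pi>F))"
proof -
  have "B * C = lmat m m ((\<iota>F \<circ> (f \<circ> \<pi>E)) \<circ> (\<iota>E \<circ> (f' \<circ> \<pi>F)))"
    unfolding B_def C_def
    by (rule lmat_comp[symmetric, OF lin_map_comp[OF iF lin_map_comp[OF f pE]] lin_map_comp[OF iE lin_map_comp[OF f' pF]]])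
  also have "(\<iota>F \<circ> (f \<circ> \<pi>E)) \<circ> (\<iota>E \<circ> (f' \<circ> \<pi>F)) = \<iota>F \<circ> (f \<circ> f' \<circ> \<pi>F)"
    by (simp add: fun_eq_iff piE)
  finally show ?thesis .
qed

lemma char_P: "char_P sF f f' = fredholm (B * C)"
  unfolding BC_eq by (rule char_P_eq_fredholm[OF sF rF w])

lemma rank_f: "rank_le sE sF k f \<longleftrightarrow> minors_vanish k B"
  unfolding B_def by (rule rank_le_iff_minors_vanish[OF rE rF f])

lemma rank_f': "rank_le sF sE k f' \<longleftrightarrow> minors_vanish k C"
  unfolding C_def by (rule rank_le_iff_minors_vanish[OF rF rE f'])

abbreviation "a \<equiv> coeff (fredholm (B * C))"
abbreviation "T k \<equiv> horner_map sF a (f \<circ> f') k"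

lemma lin_T: "lin_map sF UNIV sF UNIV (T k)"
  by (rule lin_map_horner_map[OF sF w])

lemma T_Suc: "T (Suc k) y = sF (a k) y - f (f' (T k y))"
  using horner_map_Suc[OF sF w] by simp

lemma adj_coeff_B_eq_0_iff: "adj_coeff (B * C) k * B = 0\<^sub>m m n \<longleftrightarrow> (\<forall>x. T (Suc k) (f x) = 0)"
proof -
  have "adj_coeff (B * C) k * B = lmat m n (\<iota>F \<circ> (T (Suc k) \<circ> (f \<circ> \<pi>E)))"
    using adj_coeff_mult_lmat[OF sF rF w lin_map_comp[OF f pE], of k]
      by (simp only: BC_eq[symmetric] B_def)
  also have "T (Suc k) \<circ> (f \<circ> \<pi>E) = (T (Suc k) \<circ> f) \<circ> \<pi>E"
    by (simp only: o_assoc)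
  finally have eq: "adj_coeff (B * C) k * B = lmat m n (\<iota>F \<circ> ((T (Suc k) \<circ> f) \<circ> \<pi>E))" .
  show ?thesis
    unfolding eq lmat_eq_0_iff[OF rE rF lin_map_comp[OF lin_T f]] by simp
qed

lemma C_adj_coeff_eq_0_iff: "C * adj_coeff (B * C) k = 0\<^sub>m n m \<longleftrightarrow> (\<forall>y. f' (T (Suc k) y) = 0)"
proof -
  have "C = lmat n m ((\<iota>E \<circ> f') \<circ> \<pi>F)" by (simp only: C_def o_assoc)
  then have "C * adj_coeff (B * C) k = lmat n m ((\<iota>E \<circ> f') \<circ> (T (Suc k) \<circ> \<pi>F))"
    using lmat_mult_adj_coeff[OF sF rF w lin_map_comp[OF iE f'], of k] by (simp only: BC_eq[symmetric])
  also have "(\<iota>E \<circ> f') \<circ> (T (Suc k) \<circ> \<pi>F) = \<iota>E \<circ> ((f' \<circ> T (Suc k)) \<circ> \<pi>F)"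
    by (simp only: o_assoc)
  finally have eq: "C * adj_coeff (B * C) k = lmat n m (\<iota>E \<circ> ((f' \<circ> T (Suc k)) \<circ> \<pi>F))" .
  show ?thesis
    unfolding eq lmat_eq_0_iff[OF rF rE lin_map_comp[OF f' lin_T]] by simp
qed

lemma theta: "theta_map sE a k f f' y = f' (T k y)"
  by (rule theta_map_eq[OF f'])

lemma cond2_iff_cond3:
  assumes "a k dvd 1"
  shows "rank_le sE sF k f \<and> rank_le sF sE k f' \<longleftrightarrow>
    degree (fredholm (B * C)) \<le> k \<and>
    (\<forall>x. f (theta_map sE a k f f' (f x)) = sF (a k) (f x)) \<and>
    (\<forall>y. f' (f (theta_map sE a k f f' y)) = sE (a k) (f' y))"
proof -
  have 1: "T (Suc k) (f x) = 0 \<longleftrightarrow> f (theta_map sE a k f f' (f x)) = sF (a k) (f x)" for x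
    unfolding T_Suc theta by auto
  have 2: "f' (T (Suc k) y) = 0 \<longleftrightarrow> f' (f (theta_map sE a k f f' y)) = sE (a k) (f' y)" for y
    unfolding T_Suc theta lin_map_diff[OF f'] lin_mapD(3)[OF f' UNIV_I] by auto
  show ?thesis
    unfolding rank_f rank_f' minors_vanish_iff_adj_coeff[OF B C assms] adj_coeff_B_eq_0_iff C_adj_coeff_eq_0_iff 1 2 ..
qed

end

context retract_pair
begin

lemma B_mult_vec: "v \<in> carrier_vec n \<Longrightarrow> B *\<^sub>v v = \<iota>F (f (\<pi>E v))"
  using lmat_mult_vec[OF lin_map_comp[OF iF lin_map_comp[OF f pE]]] by (simp add: B_def)

lemma subspace_range: "Modules.module.subspace sF (range f)"
proof -
  interpret F: Modules.module sF by (rule sF)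
  show ?thesis
  proof (rule F.subspaceI)
    have "f 0 = 0" by (rule lin_map_0[OF f])
    then show "0 \<in> range f" by (rule range_eqI[OF sym])
  next
    fix x y assume "x \<in> range f" "y \<in> range f"
    then obtain x' y' where "x = f x'" "y = f y'" by blast
    then have "x + y = f (x' + y')" by (simp add: lin_mapD(2)[OF f UNIV_I UNIV_I])
    then show "x + y \<in> range f" by (rule range_eqI)
  next
    fix c x assume "x \<in> range f"
    then obtain x' where "x = f x'" by blast
    then have "sF c x = f (sE c x')" by (simp add: lin_mapD(3)[OF f UNIV_I])
    then show "sF c x \<in> range f" by (rule range_eqI)
  qed
qed

lemma minor_notin_prime:
  assumes unit: "a k dvd 1" and p: "prime_ideal p"
  obtains S where "S \<subseteq> {0..<m}" and "card S = k" and "principal_minor (B * C) S \<notin> p"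
proof -
  interpret R: Modules.module "(*) :: 'a \<Rightarrow> 'a \<Rightarrow> 'a" by (rule module_ring)
  have sub: "R.subspace p" using p by (simp add: prime_ideal_def)
  have "a k \<notin> p"
    using prime_ideal_dvd_notin[OF p prime_ideal_compl(1)[OF p] unit] .
  then have "\<not> (\<forall>S\<in>{S. S \<subseteq> {0..<m} \<and> card S = k}. principal_minor (B * C) S \<in> p)"
    using R.subspace_sum[OF sub, of "{S. S \<subseteq> {0..<m} \<and> card S = k}"]
      by (auto simp: coeff_fredholm[OF BC])
  then show ?thesis using that by blast
qed

text \<open>
  A principal minor \<open>det D\<close> of order \<open>k\<close> of \<open>B C\<close> outside \<open>p\<close> has \<open>D = L B G\<close> with \<open>G = C H\<close>; the
  columns of \<open>B G\<close> are the basis.  They span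
    by the bordered minor, and \<open>adj D * L\<close> recovers
  the coordinates up to the factor \<open>det D\<close>.
\<close>
lemma local_basis_range:
  assumes rk: "minors_vanish k B" and unit: "a k dvd 1" and p: "prime_ideal p"
  shows "\<exists>x. local_basis sF (range f) k p x"
proof -
  interpret F: Modules.module sF by (rule sF)
  obtain S where S: "S \<subseteq> {0..<m}" "card S = k" "principal_minor (B * C) S \<notin> p"
    using minor_notin_prime[OF unit p] .
  obtain L H where L: "L \<in> carrier_mat k m" and H: "H \<in> carrier_mat m k"
    and pm: "principal_minor (B * C) S = det (L * (B * C) * H)"
    using principal_minor_eq_det_mult[OF S(1)] BC unfolding S(2) by metis
  define G where "G = C * H"
  have G: "G \<in> carrier_mat n k" unfolding G_def by (rule mult_carrier_mat[OF C H])
  define D where "D = L * B * G"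
  have LB: "L * B \<in> carrier_mat k n" by (rule mult_carrier_mat[OF L B])
  have D: "D \<in> carrier_mat k k" unfolding D_def by (rule mult_carrier_mat[OF LB G])
  note adj = adj_mat[OF D]
  define \<delta> where "\<delta> = det D"
  have "L * (B * C) * H = L * B * C * H"
    by (simp only: assoc_mult_mat[OF L B C])
  also have "\<dots> = D" unfolding D_def G_def by (rule assoc_mult_mat[OF LB C H])
  finally have \<delta>: "\<delta> \<notin> p" using S(3) pm by (simp add: \<delta>_def)
  have bord: "(\<delta> * \<delta>) \<cdot>\<^sub>m B = \<delta> \<cdot>\<^sub>m (B * G * (adj_mat D * (L * B)))"
    unfolding \<delta>_def D_def by (rule minors_vanish_bordered[OF rk B L G])
  let ?g = "f \<circ> (\<pi>E \<circ> (*\<^sub>v) G)"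
  define x where "x = (\<lambda>c. ?g (unit_vec k c))"
  have g: "lin_map (\<cdot>\<^sub>v) (carrier_vec k) sF UNIV ?g"
    by (rule lin_map_comp[OF f lin_map_comp[OF pE lin_map_mult_mat_vec[OF G]]])
  have g_eq: "f (\<pi>E (G *\<^sub>v v)) = (\<Sum>c<k. sF (v $ c) (x c))" if "v \<in> carrier_vec k" for v
    using lin_map_vec_expand[OF sF g that] by (simp add: x_def)
  have "local_basis sF (range f) k p x"
    unfolding local_basis_def
  proof (intro conjI allI impI ballI)
    fix c show "x c \<in> range f" by (simp add: x_def)
  next
    fix y assume "y \<in> range f"
    then obtain z where y: "y = f z" by blast
    define v where "v = \<iota>E z"
    have v: "v \<in> carrier_vec n" unfolding v_def by (rule lin_mapD(1)[OF iE UNIV_I])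
    define u where "u = adj_mat D *\<^sub>v (L *\<^sub>v (B *\<^sub>v v))"
    have Bv: "B *\<^sub>v v \<in> carrier_vec m" and LBv: "L *\<^sub>v (B *\<^sub>v v) \<in> carrier_vec k"
      using B L v by auto
    then have u: "u \<in> carrier_vec k" using adj(1) by (simp add: u_def)
    have Gu: "G *\<^sub>v u \<in> carrier_vec n" using G u by simp
    have BG: "B * G \<in> carrier_mat m k" and aLB: "adj_mat D * (L * B) \<in> carrier_mat k n"
      by (rule mult_carrier_mat[OF B G], rule mult_carrier_mat[OF adj(1) LB])
    have smult: "(c \<cdot>\<^sub>m A) *\<^sub>v v = c \<cdot>\<^sub>v (A *\<^sub>v v)" if "A \<in> carrier_mat m n" for c and A :: "'a mat"
      using that v by (intro eq_vecI) auto
    have "(B * G * (adj_mat D * (L * B))) *\<^sub>v v = (B * G) *\<^sub>v ((adj_mat D * (L * B)) *\<^sub>v v)"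
      by (rule assoc_mult_mat_vec[OF BG aLB v])
    also have "(adj_mat D * (L * B)) *\<^sub>v v = adj_mat D *\<^sub>v ((L * B) *\<^sub>v v)"
      by (rule assoc_mult_mat_vec[OF adj(1) LB v])
    also have "(L * B) *\<^sub>v v = L *\<^sub>v (B *\<^sub>v v)"
      by (rule assoc_mult_mat_vec[OF L B v])
    also have "adj_mat D *\<^sub>v (L *\<^sub>v (B *\<^sub>v v)) = u" by (simp add: u_def)
    also have "(B * G) *\<^sub>v u = B *\<^sub>v (G *\<^sub>v u)"
      by (rule assoc_mult_mat_vec[OF B G u])
    finally have "(\<delta> * \<delta>) \<cdot>\<^sub>v (B *\<^sub>v v) = \<delta> \<cdot>\<^sub>v (B *\<^sub>v (G *\<^sub>v u))"
      using arg_cong[OF bord, of "\<lambda>A. A *\<^sub>v v"]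
      by (simp only: smult[OF B] smult[OF mult_carrier_mat[OF BG aLB]])
    moreover have "B *\<^sub>v v = \<iota>F y"
      unfolding B_mult_vec[OF v] unfolding v_def by (simp only: piE y)
    ultimately have "\<iota>F (sF (\<delta> * \<delta>) y) = \<iota>F (sF \<delta> (f (\<pi>E (G *\<^sub>v u))))"
      by (simp only: B_mult_vec[OF Gu] lin_mapD(3)[OF iF UNIV_I])
    then have "sF (\<delta> * \<delta>) y = sF \<delta> (f (\<pi>E (G *\<^sub>v u)))" by (metis piF)
    also have "\<dots> = (\<Sum>c<k. sF (\<delta> * u $ c) (x c))"
      unfolding g_eq[OF u] by (simp add: F.scale_sum_right)
    finally show "\<exists>w b. w \<notin> p \<and> sF w y = (\<Sum>c<k. sF (b c) (x c))"
      using prime_ideal_compl(2)[OF p \<delta> \<delta>]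
        by (intro exI[of _ "\<delta> * \<delta>"] exI[of _ "\<lambda>c. \<delta> * u $ c"] conjI)
  next
    fix b assume zero: "(\<Sum>c<k. sF (b c) (x c)) = 0"
    define \<beta> where "\<beta> = vec k b"
    have \<beta>: "\<beta> \<in> carrier_vec k" by (simp add: \<beta>_def)
    have G\<beta>: "G *\<^sub>v \<beta> \<in> carrier_vec n" using G \<beta> by simp
    have "f (\<pi>E (G *\<^sub>v \<beta>)) = (\<Sum>c<k. sF (b c) (x c))"
      unfolding g_eq[OF \<beta>] by (intro sum.cong) (auto simp: \<beta>_def)
    then have "B *\<^sub>v (G *\<^sub>v \<beta>) = \<iota>F 0"
      by (simp add: B_mult_vec[OF G\<beta>] zero)
    also have "\<dots> = 0\<^sub>v m"
      using lin_map_0[OF lin_map_index[OF iF]] lin_mapD(1)[OF iF, of 0] by (intro eq_vecI) auto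
    finally have "(L * B) *\<^sub>v (G *\<^sub>v \<beta>) = L *\<^sub>v 0\<^sub>v m"
      by (simp only: assoc_mult_mat_vec[OF L B G\<beta>])
    then have "D *\<^sub>v \<beta> = 0\<^sub>v k"
      unfolding D_def assoc_mult_mat_vec[OF LB G \<beta>] using L by (simp, intro eq_vecI) auto
    then have "(adj_mat D * D) *\<^sub>v \<beta> = adj_mat D *\<^sub>v 0\<^sub>v k"
      by (simp only: assoc_mult_mat_vec[OF adj(1) D \<beta>])
    then have "(\<delta> \<cdot>\<^sub>m 1\<^sub>m k) *\<^sub>v \<beta> = 0\<^sub>v k"
      unfolding adj(3) \<delta>_def using adj(1) by (simp, intro eq_vecI) auto
    moreover have "(\<delta> \<cdot>\<^sub>m 1\<^sub>m k) *\<^sub>v \<beta> = \<delta> \<cdot>\<^sub>v (1\<^sub>m k *\<^sub>v \<beta>)"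
      using \<beta> by (intro eq_vecI) auto
    ultimately have eq: "\<delta> \<cdot>\<^sub>v \<beta> = 0\<^sub>v k" using \<beta> by simp
    have "\<delta> * b c = 0" if "c < k" for c
      using arg_cong[OF eq, of "\<lambda>v. v $ c"] that by (simp add: \<beta>_def)
    then show "\<exists>w. w \<notin> p \<and> (\<forall>c<k. w * b c = 0)" using \<delta> by blast
  qed
  then show ?thesis by blast
qed

lemma cond2_imp_cond1:
  assumes rk: "rank_le sE sF k f" "rank_le sF sE k f'" and unit: "a k dvd 1"
  shows "crossed f f' \<and> projective_of_rank sF (range f) k"
proof -
  interpret F: Modules.module sF by (rule sF)
  interpret E: Modules.module sE by (rule sE)
  obtain u where "1 = a k * u" using unit by (rule dvdE)
  then have u: "u * a k = 1" by (simp add: mult.commute)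
  define h where "h = (\<lambda>y. sF u (T k y))"
  have h: "lin_map sF UNIV sF UNIV h"
    using lin_mapD(2,3)[OF lin_T UNIV_I]
    by (intro lin_mapI) (simp_all add: h_def F.scale_right_distrib mult.commute)
  have c3: "f (f' (T k (f x))) = sF (a k) (f x)" "f' (f (f' (T k y))) = sE (a k) (f' y)" for x y
    using cond2_iff_cond3[OF unit] rk unfolding theta by blast+
  have fgf: "f (f' (h (f x))) = f x" for x
  proof -
    have "f (f' (h (f x))) = sF u (f (f' (T k (f x))))"
      by (simp add: h_def lin_mapD(3)[OF f' UNIV_I] lin_mapD(3)[OF f UNIV_I])
    then show ?thesis by (simp add: c3 u)
  qed
  have f'fg: "f' (f (f' (h y))) = f' y" for y
  proof -
    have "f' (f (f' (h y))) = sE u (f' (f (f' (T k y))))"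
      by (simp add: h_def lin_mapD(3)[OF f' UNIV_I] lin_mapD(3)[OF f UNIV_I])
    then show ?thesis by (simp add: c3 u)
  qed
  have "f (f' (h y)) = h (f (f' y))" for y
    using horner_map_commute[OF sF w, of a k y]
    by (simp add: h_def lin_mapD(3)[OF f' UNIV_I] lin_mapD(3)[OF f UNIV_I])
  then have "crossed f f'" by (rule crossedI[OF f f' h _ fgf f'fg])
  moreover have "fg_projective sF (range f)"
  proof -
    have lin: "lin_map (\<cdot>\<^sub>v) (carrier_vec m) sF UNIV (f \<circ> (f' \<circ> (h \<circ> \<pi>F)))"
      by (intro lin_map_comp[OF f] lin_map_comp[OF f'] lin_map_comp[OF h] pF)
    have "free_retract sF (range f) m \<iota>F (f \<circ> (f' \<circ> (h \<circ> \<pi>F)))"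
      unfolding free_retract_def
    proof (intro conjI lin_mapI ballI)
      fix y assume "y \<in> range f"
      then show "(f \<circ> (f' \<circ> (h \<circ> \<pi>F))) (\<iota>F y) = y" by (auto simp: piF fgf)
    qed (use lin_mapD[OF iF UNIV_I] lin_mapD(2,3)[OF lin] in auto)
    then show ?thesis unfolding fg_projective_def using free_retract_imp_fgp_iso by blast
  qed
  moreover have "free_of_rank_at sF (range f) k p" if p: "prime_ideal p" for p
  proof -
    interpret localized_module sF "range f" p
      by unfold_locales (use subspace_range p in auto)
    obtain x where "local_basis sF (range f) k p x"
      using local_basis_range[OF _ unit p] rk rank_f by blast
    then show ?thesis by (rule local_basis_imp_free)
  qed
  ultimately show ?thesis by (simp add: projective_of_rank_def)
qed

text \<open>
  In a local basis \<open>x\<close> of the image, \<open>w1 B C = X Y\<close> where \<open>W = Y X\<close> is the matrix of \<open>w1 f f'\<close> on the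
  image, so that \<open>w1 ^ k * a k = det W\<close>.  As \<open>f f'\<close> maps the image onto itself, \<open>W\<close> has a right
  inverse \<open>V\<close> up to factors outside \<open>p\<close>.  A prime \<open>p\<close> containing \<open>a k\<close> would contain \<open>det W\<close>, hence
  also those factors.
\<close>
lemma cond1_imp_cond2:
  assumes cr: "crossed f f'" and free: "\<And>p. prime_ideal p \<Longrightarrow> free_of_rank_at sF (range f) k p"
  shows "minors_vanish k B" and "minors_vanish k C" and "a k dvd 1"
proof -
  interpret F: Modules.module sF by (rule sF)
  have basis: "\<exists>x. local_basis sF (range f) k p x" if p: "prime_ideal p" for p
  proof -
    interpret localized_module sF "range f" p
      by unfold_locales (use subspace_range p in auto)
    obtain x where "local_basis sF (range f) k p x" using free[OF p] by (rule free_imp_local_basis)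
    then show "\<exists>x. local_basis sF (range f) k p x" by blast
  qed
  show "minors_vanish k B"
  proof (rule minors_vanish_local[OF B])
    fix p :: "'a set" assume p: "prime_ideal p"
    obtain x where x: "local_basis sF (range f) k p x" using basis[OF p] ..
    obtain w b where w: "w \<notin> p" and b: "\<And>j. j < n \<Longrightarrow> sF w ((f \<circ> \<pi>E) (unit_vec n j)) = (\<Sum>i<k. sF (b i j) (x i))"
      using local_basis_span_family[OF sF p x, of n "\<lambda>j. (f \<circ> \<pi>E) (unit_vec n j)"]
        by auto
    from smult_lmat_eq_mult[where g = "f \<circ> \<pi>E" and b = b and x = x, OF iF sF b] w
    show "\<exists>w X Y. w \<notin> p \<and> X \<in> carrier_mat m k \<and> Y \<in> carrier_mat k n \<and> w \<cdot>\<^sub>m B = X * Y"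
      unfolding B_def by (intro exI conjI) auto
  qed
  show "minors_vanish k C"
  proof (rule minors_vanish_local[OF C])
    fix p :: "'a set" assume p: "prime_ideal p"
    obtain x where x: "local_basis sF (range f) k p x" using basis[OF p] ..
    have "\<forall>j. \<exists>z. f' (\<pi>F (unit_vec m j)) = f' (f z)"
      using crossed_decomp(1)[OF cr f f'] by blast
    from choice[OF this] obtain z where z: "\<And>j. f' (\<pi>F (unit_vec m j)) = f' (f (z j))" by blast
    obtain w b where w: "w \<notin> p" and b: "\<And>j. j < m \<Longrightarrow> sF w (f (z j)) = (\<Sum>i<k. sF (b i j) (x i))"
      using local_basis_span_family[OF sF p x, of m "\<lambda>j. f (z j)"] by auto
    have "sE w ((f' \<circ> \<pi>F) (unit_vec m j)) = (\<Sum>i<k. sE (b i j) (f' (x i)))" if "j < m" for j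
      using arg_cong[OF b[OF that], of f'] lin_mapD(3)[OF f' UNIV_I] by (simp add: z lin_map_sum[OF f'])
    from smult_lmat_eq_mult[where g = "f' \<circ> \<pi>F" and b = b and x = "\<lambda>i. f' (x i)", OF iE sE this] w
    show "\<exists>w X Y. w \<notin> p \<and> X \<in> carrier_mat n k \<and> Y \<in> carrier_mat k m \<and> w \<cdot>\<^sub>m C = X * Y"
      unfolding C_def by (intro exI conjI) auto
  qed
  show "a k dvd 1"
  proof (rule ccontr)
    assume nunit: "\<not> a k dvd 1"
    have "Modules.module.subspace (*) {c. a k dvd c}"
      by (rule Modules.module.subspaceI[OF module_ring]) auto
    then obtain p where p: "prime_ideal p" and sub: "{c. a k dvd c} \<subseteq> p"
      using nunit by (elim prime_ideal_above) auto
    have ak: "a k \<in> p" using sub by (rule subsetD) simp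
    obtain x where x: "local_basis sF (range f) k p x" using basis[OF p] ..
    have xr: "x i \<in> range f" if "i < k" for i using x that by (simp add: local_basis_def)
    let ?w = "f \<circ> f' \<circ> \<pi>F"
    have lw: "lin_map (\<cdot>\<^sub>v) (carrier_vec m) sF UNIV ?w" by (rule lin_map_comp[OF w pF])
    obtain w1 b where w1: "w1 \<notin> p" and b: "\<And>j. j < m \<Longrightarrow> sF w1 (?w (unit_vec m j)) = (\<Sum>i<k. sF (b i j) (x i))"
      using local_basis_span_family[OF sF p x, of m "\<lambda>j. ?w (unit_vec m j)"] by auto
    define X where "X = mat m k (\<lambda>(a, i). \<iota>F (x i) $ a)"
    define Y where "Y = mat k m (\<lambda>(i, j). b i j)"
    have X: "X \<in> carrier_mat m k" and Y: "Y \<in> carrier_mat k m" by (simp_all add: X_def Y_def)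
    define W where "W = Y * X"
    have W: "W \<in> carrier_mat k k" unfolding W_def by (rule mult_carrier_mat[OF Y X])
    have "w1 \<cdot>\<^sub>m (B * C) = X * Y"
      unfolding BC_eq X_def Y_def
        by (rule smult_lmat_eq_mult[where g = ?w and b = b and x = x, OF iF sF b])
    then have "w1 ^ k * a k = coeff (fredholm (X * Y)) k"
      by (simp only: coeff_fredholm_smult[OF BC, symmetric])
    also have "\<dots> = det W"
      unfolding fredholm_mult_commute[OF X Y] W_def[symmetric] by (rule coeff_fredholm_full[OF W])
    finally have detW: "det W \<in> p"
      using ak p Modules.module.subspace_scale[OF module_ring, of p "a k" "w1 ^ k"]
        by (simp add: prime_ideal_def)
    have img: "sF w1 (f (f' (x l))) = (\<Sum>i<k. sF (W $$ (i, l)) (x i))" if l: "l < k" for l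
    proof -
      define v where "v = \<iota>F (x l)"
      have v: "v \<in> carrier_vec m" unfolding v_def by (rule lin_mapD(1)[OF iF UNIV_I])
      have "sF w1 (f (f' (x l))) = sF w1 (?w v)" by (simp add: v_def piF)
      also have "\<dots> = (\<Sum>j<m. sF (v $ j) (sF w1 (?w (unit_vec m j))))"
        unfolding lin_map_vec_expand[OF sF lw v] by (simp add: F.scale_sum_right mult.commute)
      also have "\<dots> = (\<Sum>j<m. \<Sum>i<k. sF (v $ j * b i j) (x i))"
      proof (intro sum.cong refl)
        fix j assume "j \<in> {..<m}"
        then have "j < m" by simp
        show "sF (v $ j) (sF w1 (?w (unit_vec m j))) = (\<Sum>i<k. sF (v $ j * b i j) (x i))"
          unfolding b[OF \<open>j < m\<close>] by (simp add: F.scale_sum_right)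
      qed
      also have "\<dots> = (\<Sum>i<k. sF (\<Sum>j<m. b i j * v $ j) (x i))"
        by (subst sum.swap) (simp add: F.scale_sum_left mult.commute)
      also have "\<dots> = (\<Sum>i<k. sF (W $$ (i, l)) (x i))"
        using l by (intro sum.cong refl) (simp add: W_def X_def Y_def v_def scalar_prod_def atLeast0LessThan)
      finally show ?thesis .
    qed
    have "\<exists>z. j < k \<longrightarrow> x j = f (f' (f z))" for j
    proof (cases "j < k")
      case True
      obtain \<xi> where \<xi>: "x j = f \<xi>" using xr[OF True] by (rule rangeE)
      obtain z where "f \<xi> = f (f' (f z))" using crossed_decomp(2)[OF cr f f', of \<xi>]
        by (rule exE)
      then show ?thesis using \<xi> by auto
    qed simp
    then have "\<forall>j. \<exists>z. j < k \<longrightarrow> x j = f (f' (f z))" by (rule allI)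
    from choice[OF this] obtain z where z: "\<And>j. j < k \<Longrightarrow> x j = f (f' (f (z j)))"
      by blast
    obtain w2 c where w2: "w2 \<notin> p" and c: "\<And>j. j < k \<Longrightarrow> sF w2 (f (z j)) = (\<Sum>l<k. sF (c l j) (x l))"
      using local_basis_span_family[OF sF p x, of k "\<lambda>j. f (z j)"] by auto
    define V where "V = mat k k (\<lambda>(l, j). c l j)"
    have V: "V \<in> carrier_mat k k" by (simp add: V_def)
    have WV: "W * V \<in> carrier_mat k k" by (rule mult_carrier_mat[OF W V])
    have rel: "sF (w1 * w2) (x j) = (\<Sum>i<k. sF ((W * V) $$ (i, j)) (x i))" if j: "j < k" for j
    proof -
      have "sF (w1 * w2) (x j) = sF w1 (f (f' (sF w2 (f (z j)))))"
        by (simp only: F.scale_scale[symmetric] lin_mapD(3)[OF f' UNIV_I] lin_mapD(3)[OF f UNIV_I] z[OF j, symmetric])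
      also have "\<dots> = (\<Sum>l<k. sF (c l j) (sF w1 (f (f' (x l)))))"
        unfolding c[OF j]
        by (simp add: lin_map_sum[OF f'] lin_map_sum[OF f] lin_mapD(3)[OF f' UNIV_I] lin_mapD(3)[OF f UNIV_I] F.scale_sum_right mult.commute)
      also have "\<dots> = (\<Sum>l<k. \<Sum>i<k. sF (c l j * W $$ (i, l)) (x i))"
        by (intro sum.cong refl) (simp add: img F.scale_sum_right)
      also have "\<dots> = (\<Sum>i<k. sF (\<Sum>l<k. W $$ (i, l) * c l j) (x i))"
        by (subst sum.swap) (simp add: F.scale_sum_left mult.commute)
      also have "\<dots> = (\<Sum>i<k. sF ((W * V) $$ (i, j)) (x i))"
        using j W by (intro sum.cong refl) (simp add: V_def scalar_prod_def atLeast0LessThan)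
      finally show ?thesis .
    qed
    have indep: "\<exists>t. t \<notin> p \<and> (\<forall>i<k. t * b i = 0)" if "(\<Sum>i<k. sF (b i) (x i)) = 0" for b
      using x that by (simp add: local_basis_def)
    have "\<exists>t. t \<notin> p \<and> (j < k \<longrightarrow> (\<forall>i<k. t * (W * V) $$ (i, j) = t * (if i = j then w1 * w2 else 0)))" for j
    proof (cases "j < k")
      case True
      have "(\<Sum>i<k. sF ((W * V) $$ (i, j) - (if i = j then w1 * w2 else 0)) (x i)) =
          sF (w1 * w2) (x j) - (\<Sum>i<k. if i = j then sF (w1 * w2) (x j) else 0)"
        unfolding rel[OF True] F.scale_left_diff_distrib sum_subtractf
        by (intro arg_cong2[where f = "(-)"] refl sum.cong) (simp flip: rel[OF True])
      also have "\<dots> = 0" using True by simp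
      finally obtain t where t: "t \<notin> p"
        and "\<forall>i<k. t * ((W * V) $$ (i, j) - (if i = j then w1 * w2 else 0)) = 0"
        using indep by meson
      then have "\<forall>i<k. t * (W * V) $$ (i, j) = t * (if i = j then w1 * w2 else 0)"
        by (simp only: right_diff_distrib right_minus_eq)
      then show ?thesis using t by (intro exI[of _ t] conjI impI)
    qed (use w1 in auto)
    then have "\<forall>j. \<exists>t. t \<notin> p \<and> (j < k \<longrightarrow> (\<forall>i<k. t * (W * V) $$ (i, j) = t * (if i = j then w1 * w2 else 0)))"
      by blast
    from choice[OF this] obtain t where t: "\<And>j. t j \<notin> p"
      and tWV: "\<And>i j. i < k \<Longrightarrow> j < k \<Longrightarrow> t j * (W * V) $$ (i, j) = t j * (if i = j then w1 * w2 else 0)"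
      by blast
    define \<tau> where "\<tau> = (\<Prod>j<k. t j)"
    have \<tau>: "\<tau> \<notin> p" unfolding \<tau>_def by (rule prime_ideal_prod_notin[OF p t])
    have "\<tau> * (W * V) $$ (i, j) = \<tau> * (if i = j then w1 * w2 else 0)" if "i < k" "j < k" for i j
    proof -
      have "\<tau> = (\<Prod>l\<in>{..<k} - {j}. t l) * t j"
        unfolding \<tau>_def using that by (subst prod.remove[of "{..<k}" j]) (auto simp: mult.commute)
      then show ?thesis using tWV[OF that] by (simp only: mult.assoc)
    qed
    then have "\<tau> \<cdot>\<^sub>m (W * V) = (\<tau> * (w1 * w2)) \<cdot>\<^sub>m 1\<^sub>m k"
      using W V by (intro eq_matI) (auto simp del: index_mult_mat(1))
    from arg_cong[OF this, of det] have "\<tau> ^ k * (det W * det V) = (\<tau> * (w1 * w2)) ^ k"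
      by (simp only: det_smult carrier_matD(2)[OF WV] index_one_mat(3) det_one mult_1_right det_mult[OF W V])
    then have "det W dvd (\<tau> * (w1 * w2)) ^ k" by (metis dvd_mult dvd_triv_left)
    moreover have "(\<tau> * (w1 * w2)) ^ k \<notin> p"
      by (rule prime_ideal_power_notin[OF p prime_ideal_compl(2)[OF p \<tau> prime_ideal_compl(2)[OF p w1 w2]]])
    ultimately have "det W \<notin> p" by (rule prime_ideal_dvd_notin[OF p, rotated])
    then show False using detW by simp
  qed
qed

end

lemma fg_projective_retract:
  assumes "fg_projective s UNIV"
  obtains n \<iota> \<pi> where "free_retract s UNIV n \<iota> \<pi>"
  using assms fgp_iso_imp_free_retract(1) unfolding fg_projective_def by blast

theorem mainTheorem2:
  fixes sE :: "'a::comm_ring_1 \<Rightarrow> 'e::ab_group_add \<Rightarrow> 'e"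
    and sF :: "'a \<Rightarrow> 'f::ab_group_add \<Rightarrow> 'f"
    and \<phi> :: "'e \<Rightarrow> 'f" and \<phi>' :: "'f \<Rightarrow> 'e"
    and k :: nat
  assumes "Modules.module sE" and "Modules.module sF"
    and "fg_projective sE UNIV" and "fg_projective sF UNIV"
    and "module_hom sE sF \<phi>" and "module_hom sF sE \<phi>'"
  shows "let P = char_P sF \<phi> \<phi>';
             a = coeff P;
             \<theta> = theta_map sE a k \<phi> \<phi>';
             C1 = (crossed \<phi> \<phi>' \<and> projective_of_rank sF (range \<phi>) k);
             C2 = (rank_le sE sF k \<phi> \<and> rank_le sF sE k \<phi>' \<and> a k dvd 1);
             C3 = (degree P \<le> k \<and> a k dvd 1 \<and>
                   (\<forall>x. \<phi> (\<theta> (\<phi> x)) = sF (a k) (\<phi> x)) \<and>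
                   (\<forall>y. \<phi>' (\<phi> (\<theta> y)) = sE (a k) (\<phi>' y)))
         in (C1 \<longleftrightarrow> C2) \<and> (C2 \<longleftrightarrow> C3)"
proof -
  obtain n \<iota>E \<pi>E where rE: "free_retract sE UNIV n \<iota>E \<pi>E"
    using fg_projective_retract[OF assms(3)] .
  obtain m \<iota>F \<pi>F where rF: "free_retract sF UNIV m \<iota>F \<pi>F"
    using fg_projective_retract[OF assms(4)] .
  interpret retract_pair sE sF \<phi> \<phi>' m n \<iota>E \<pi>E \<iota>F \<pi>F
    by (rule retract_pair.intro[OF assms(1,2) module_hom_lin_map[OF assms(5)] module_hom_lin_map[OF assms(6)] rE rF])
  have "crossed \<phi> \<phi>' \<and> projective_of_rank sF (range \<phi>) k \<longleftrightarrow>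
      rank_le sE sF k \<phi> \<and> rank_le sF sE k \<phi>' \<and> a k dvd 1"
    using cond2_imp_cond1[of k] cond1_imp_cond2[of k]
    unfolding rank_f rank_f' projective_of_rank_def by blast
  moreover have "rank_le sE sF k \<phi> \<and> rank_le sF sE k \<phi>' \<and> a k dvd 1 \<longleftrightarrow>
      degree (fredholm (B * C)) \<le> k \<and> a k dvd 1 \<and>
      (\<forall>x. \<phi> (theta_map sE a k \<phi> \<phi>' (\<phi> x)) = sF (a k) (\<phi> x)) \<and>
      (\<forall>y. \<phi>' (\<phi> (theta_map sE a k \<phi> \<phi>' y)) = sE (a k) (\<phi>' y))"
    using cond2_iff_cond3[of k] by blast
  ultimately show ?thesis
    unfolding Let_def char_P by (rule conjI)
qed

end
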